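(* Let $p$ be a prime number. The number of sum-free triplets $A,B,C\subseteq \mathbb{Z}/p\mathbb{Z}$ is at most $$3\cdot 4^p+3p\cdot 3^p+3\binom{p}{2}\left(\frac{1+\sqrt5}{2}\right)^{2p}+Q_{3,1}(p)\cdot(1+\sqrt2)^p+Q_{3,2}(p)\cdot 458^{p/7}+3\binom{p}{4}(1+o(1))\cdot 31^{p/4},$$ and at least $$3\cdot 4^p+3p\cdot 3^p+3\binom{p}{2}\left(\frac{1+\sqrt5}{2}\right)^{2p}+Q_{3,1}(p)\cdot(1+\sqrt2)^p+Q_{3,2}(p)\cdot 2.38898^{p},$$ where $$Q_{3,1}(p)=3\cdot\frac{3}{p-2}\cdot\binom{p}{3}=3\cdot\binom{p}{2},\qquad Q_{3,2}(p)=3\cdot\frac{p-5}{p-2}\cdot\binom{p}{3}.$$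
   Context: $\mathbb{Z}/p\mathbb{Z}$ is the additive abelian group of integers modulo the prime $p$. An ordered triplet $(A,B,C)$ of subsets of $\mathbb{Z}/p\mathbb{Z}$ is called a sum-free triplet if there are no $a\in A$, $b\in B$, $c\in C$ with $a+b=c$. The triplets are counted as ordered triplets; the sets may be empty and need not be distinct or disjoint. The term $o(1)$ denotes a quantity tending to $0$ as $p\to\infty$.
   Formalization: The lower bound is asserted only for all sufficiently large primes p (it fails for p=3, where it is about 641 but only 512 triplets exist), and Q_{3,1}(p)=3·binom(p,2) only for p>2, since the first expressions for Q_{3,1}, Q_{3,2} are undefined at p=2, where they are taken as 0. *)

theory Defs
  imports
    Complex_Main
    "HOL-Computational_Algebra.Primes"
    "HOL-Algebra.Elementary_Groups"
begin

definition sum_free_triplet ::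
  "('a, 'b) monoid_scheme \<Rightarrow> 'a set \<Rightarrow> 'a set \<Rightarrow> 'a set \<Rightarrow> bool" where
  "sum_free_triplet G A B C \<longleftrightarrow>
     A \<subseteq> carrier G \<and> B \<subseteq> carrier G \<and> C \<subseteq> carrier G \<and>
     \<not> (\<exists>a\<in>A. \<exists>b\<in>B. \<exists>c\<in>C. a \<otimes>\<^bsub>G\<^esub> b = c)"

text \<open>The group \<^term>\<open>integer_mod_group p\<close> has carrier \<^term>\<open>{0..<int p}\<close> and operation
  addition modulo \<^term>\<open>p\<close> (written multiplicatively in HOL-Algebra).\<close>

definition num_sum_free_triplets :: "nat \<Rightarrow> nat" where
  "num_sum_free_triplets p = card {(A, B, C). sum_free_triplet (integer_mod_group p) A B C}"

text \<open>For \<^term>\<open>p = 2\<close> the formulas below divide by zero, and so take the value 0.\<close>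

definition Q31 :: "nat \<Rightarrow> real" where
  "Q31 p = 3 * (3 / (real p - 2)) * real (p choose 3)"

definition Q32 :: "nat \<Rightarrow> real" where
  "Q32 p = 3 * ((real p - 5) / (real p - 2)) * real (p choose 3)"

end

theory Submission
  imports
    Defs
    "HOL-Real_Asymp.Real_Asymp"
    "HOL-Number_Theory.Cong"
begin

text \<open>
  Summing over the set \<open>A\<close>, the number of sum-free triplets is the sum of the numbers \<open>i(A)\<close> of
  independent sets in the bipartite Cayley graphs with connection set \<open>A\<close>. Triplets in which one of
  the sets has at most three elements give the main terms; the three choices of that set overlap
  only in few triplets, and triplets whose sets all have more elements are negligible apart from
  those with a set of size four.

  For \<open>|A| \<le> 2\<close> and for three-term progressions \<open>i(A)\<close> is computed exactly with a transfer matrix.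
  For every other three-element \<open>A\<close>, Dirichlet approximation moves \<open>A\<close> by an affine map to
  \<open>{0, a, b}\<close> with \<open>0 < 2 a < b\<close> and \<open>b\<close> a tiny multiple of \<open>p\<close>. The elements of \<open>B\<close> are then decided
  one after the other, and an explicit product of local weights along the boundary grows in each step
  by a factor between \<open>2.3891\<close> and \<open>2.398\<close>, whatever happened before.

  Finner's inequality gives Kahn's bound \<open>i(A) \<le> (2 ^ (|A| + 1) - 1) powr (p / |A|)\<close>, which handles
  \<open>4 \<le> |A| \<le> p / 100\<close>. If all three sets are larger than that, the method of containers together
  with Pollard's theorem confines the triplet to one of few boxes of total size little more than \<open>p\<close>.
\<close>

section \<open>Pairs compatible with a fixed set\<close>

text \<open>The target rates dictate the case distinction. Everything of rate below 31^(1/4) =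
  2.3596 disappears in the o(1), while general three-element sets must be placed between 2.38898 and
  458^(1/7) = 2.3995. Kahn's bound at size three only gives 15^(1/3) = 2.466, too much; at size five
  it gives 63^(1/5) = 2.2902, which leaves room for the number of sets A. Once sizes are
  proportional to p, that number is exponential and eventually ruins the product, hence the
  containers. The obstacle at size three is that a and b grow with p, so a transfer matrix would
  have unbounded size; the potentials give a bound for each step that is the same for all a and b.
  The strict inequality 2 a < b is essential, because progressions grow at the rate 1 + sqrt 2 =
  2.4142. The price, for the wrap-around of the cycle and for the potentials, is 4^b, and b < 2 p /
  10^6 makes it smaller than the distance from 2.398 to 2.399 and from 2.3891 to 2.389.\<close>

definition sumset :: "nat \<Rightarrow> int set \<Rightarrow> int set \<Rightarrow> int set" where
  "sumset p A B = (\<lambda>(a, b). (a + b) mod int p) ` (A \<times> B)"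

abbreviation Zn :: "nat \<Rightarrow> int set" where
  "Zn p \<equiv> {0..<int p}"

text \<open>The cardinality is the i(A) of the overview. A may be any set of integers and is read
  modulo p, so that affine images can be used without reducing them.\<close>

definition free_pairs :: "nat \<Rightarrow> int set \<Rightarrow> (int set \<times> int set) set" where
  "free_pairs p A = {(B, C). B \<subseteq> Zn p \<and> C \<subseteq> Zn p \<and> sumset p A B \<inter> C = {}}"

definition free_triples :: "nat \<Rightarrow> (int set \<times> int set \<times> int set) set" where
  "free_triples p = {(A, B, C). A \<subseteq> Zn p \<and> (B, C) \<in> free_pairs p A}"

lemma sumset_mono: "A \<subseteq> A' \<Longrightarrow> B \<subseteq> B' \<Longrightarrow> sumset p A B \<subseteq> sumset p A' B'"
  unfolding sumset_def by blast

lemma sumset_subset_Zn: "p > 0 \<Longrightarrow> sumset p A B \<subseteq> Zn p"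
  unfolding sumset_def by auto

lemma in_sumset_iff:
  assumes "p > 0" "B \<subseteq> Zn p" "c \<in> Zn p"
  shows "c \<in> sumset p A B \<longleftrightarrow> (\<exists>a\<in>A. (c - a) mod int p \<in> B)"
proof
  assume "c \<in> sumset p A B"
  then obtain a b where ab: "a \<in> A" "b \<in> B" "c = (a + b) mod int p"
    by (auto simp: sumset_def)
  have "(c - a) mod int p = b mod int p"
    using ab(3) by (simp add: mod_diff_left_eq)
  also have "\<dots> = b"
    using assms ab by auto
  finally show "\<exists>a\<in>A. (c - a) mod int p \<in> B"
    using ab(1,2) by metis
next
  assume "\<exists>a\<in>A. (c - a) mod int p \<in> B"
  then obtain a where a: "a \<in> A" "(c - a) mod int p \<in> B" by auto
  have "(a + (c - a) mod int p) mod int p = c"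
    using assms by (simp add: mod_add_right_eq)
  thus "c \<in> sumset p A B"
    unfolding sumset_def using a by force
qed

lemma free_triples_eq:
  assumes "p > 0"
  shows "{(A, B, C). sum_free_triplet (integer_mod_group p) A B C} = free_triples p"
  using assms
  by (auto simp: sum_free_triplet_def free_triples_def free_pairs_def carrier_integer_mod_group sumset_def)

lemma finite_free_pairs [simp]: "finite (free_pairs p A)"
  by (rule finite_subset[of _ "Pow (Zn p) \<times> Pow (Zn p)"]) (auto simp: free_pairs_def)

lemma finite_free_triples [simp]: "finite (free_triples p)"
  by (rule finite_subset[of _ "Pow (Zn p) \<times> Pow (Zn p) \<times> Pow (Zn p)"])
     (auto simp: free_triples_def free_pairs_def)

lemma free_pairs_antimono: "T \<subseteq> A \<Longrightarrow> free_pairs p A \<subseteq> free_pairs p T"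
  using sumset_mono[of T A] unfolding free_pairs_def by fast

lemma card_free_pairs_antimono: "T \<subseteq> A \<Longrightarrow> card (free_pairs p A) \<le> card (free_pairs p T)"
  by (intro card_mono free_pairs_antimono finite_free_pairs)

lemma card_free_pairs_sum:
  assumes "p > 0"
  shows "card (free_pairs p A) = (\<Sum>B\<in>Pow (Zn p). 2 ^ card (Zn p - sumset p A B))"
proof -
  have "free_pairs p A = (SIGMA B : Pow (Zn p). Pow (Zn p - sumset p A B))"
    by (auto simp: free_pairs_def)
  thus ?thesis
    by (simp add: card_SigmaI card_Pow)
qed

text \<open>Once B is fixed, each c outside the sumset is free to be in C or not, so the count
  factors into one local weight per c. The potentials, Finner's inequality and the transfer matrices
  all start from this product.\<close>

lemma card_free_pairs_prod:
  assumes "p > 0"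
  shows "real (card (free_pairs p A)) =
    (\<Sum>B\<in>Pow (Zn p). \<Prod>c\<in>Zn p. if \<exists>a\<in>A. (c - a) mod int p \<in> B then 1 else 2)"
proof -
  have "2 ^ card (Zn p - sumset p A B) =
      (\<Prod>c\<in>Zn p. if \<exists>a\<in>A. (c - a) mod int p \<in> B then 1 else 2 :: real)" if "B \<subseteq> Zn p" for B
  proof -
    have "Zn p - sumset p A B = {c \<in> Zn p. \<not> (\<exists>a\<in>A. (c - a) mod int p \<in> B)}"
      using in_sumset_iff[OF assms that] by blast
    thus ?thesis
      by (simp add: prod.If_cases Int_def)
  qed
  thus ?thesis
    unfolding card_free_pairs_sum[OF assms] by simp
qed

lemma card_free_triples_sum:
  "card {(A, B, C) \<in> free_triples p. P A} = (\<Sum>A | A \<subseteq> Zn p \<and> P A. card (free_pairs p A))"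
proof -
  have "{(A, B, C) \<in> free_triples p. P A} = (SIGMA A : {A. A \<subseteq> Zn p \<and> P A}. free_pairs p A)"
    by (auto simp: free_triples_def)
  moreover have "finite {A. A \<subseteq> Zn p \<and> P A}"
    by (rule finite_subset[of _ "Pow (Zn p)"]) auto
  ultimately show ?thesis
    by (simp add: card_SigmaI)
qed

section \<open>Invariance under congruence and affine maps\<close>

lemma sumset_cong_mod:
  assumes "(\<lambda>a. a mod int p) ` A = (\<lambda>a. a mod int p) ` A'"
  shows "sumset p A B = sumset p A' B"
proof -
  have *: "sumset p A B = (\<lambda>(a, b). (a + b) mod int p) ` ((\<lambda>a. a mod int p) ` A \<times> B)" for A
    unfolding sumset_def by (force simp: image_iff mod_add_left_eq)
  show ?thesis
    by (subst (1 2) *) (simp add: assms)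
qed

lemma free_pairs_cong_mod:
  assumes "(\<lambda>a. a mod int p) ` A = (\<lambda>a. a mod int p) ` A'"
  shows "free_pairs p A = free_pairs p A'"
  unfolding free_pairs_def using sumset_cong_mod[OF assms] by simp

lemma inj_on_affine_mod:
  assumes "p > 0" "coprime u (int p)"
  shows "inj_on (\<lambda>b. (u * b + v) mod int p) (Zn p)"
proof (rule inj_onI)
  fix x y assume xy: "x \<in> Zn p" "y \<in> Zn p" "(u * x + v) mod int p = (u * y + v) mod int p"
  have "[u * x + v = u * y + v] (mod int p)"
    using xy(3) by (simp add: cong_def)
  hence "[x = y] (mod int p)"
    using assms by (simp add: cong_add_rcancel cong_mult_lcancel)
  thus "x = y"
    using xy by (simp add: cong_def)
qed

lemma affine_mod_image_Zn:
  assumes "p > 0" "coprime u (int p)"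
  shows "(\<lambda>b. (u * b + v) mod int p) ` Zn p = Zn p"
  by (rule card_seteq) (use assms inj_on_affine_mod in \<open>auto simp: card_image\<close>)

text \<open>As (u a + v) + u b = u (a + b) + v, the dilation acts on all three sets, while the
  translation passes from A to C and leaves B alone.\<close>

lemma sumset_affine:
  "sumset p ((\<lambda>a. u * a + v) ` A) ((\<lambda>b. (u * b) mod int p) ` B) =
     (\<lambda>c. (u * c + v) mod int p) ` sumset p A B"
proof -
  have *: "(u * a + v + (u * b) mod int p) mod int p = (u * ((a + b) mod int p) + v) mod int p" for a b
  proof -
    have "(u * ((a + b) mod int p) + v) mod int p = (u * (a + b) + v) mod int p"
      by (metis mod_add_left_eq mod_mult_right_eq)
    also have "\<dots> = (u * a + v + (u * b) mod int p) mod int p"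
      by (metis distrib_left group_cancel.add1 mod_add_right_eq add.commute)
    finally show ?thesis by simp
  qed
  show ?thesis
    unfolding sumset_def by (force simp: image_iff * Bex_def)
qed

lemma card_free_pairs_affine_le:
  assumes "p > 0" "coprime u (int p)"
  shows "card (free_pairs p A) \<le> card (free_pairs p ((\<lambda>a. u * a + v) ` A))"
proof -
  define f where "f = (\<lambda>b. (u * b + 0) mod int p)"
  define g where "g = (\<lambda>b. (u * b + v) mod int p)"
  have inj: "inj_on f (Zn p)" "inj_on g (Zn p)"
    unfolding f_def g_def using inj_on_affine_mod assms by blast+
  have im: "f ` Zn p = Zn p" "g ` Zn p = Zn p"
    unfolding f_def g_def using affine_mod_image_Zn assms by blast+
  have "inj_on (map_prod (image f) (image g)) (Pow (Zn p) \<times> Pow (Zn p))"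
    by (intro map_prod_inj_on inj_on_image_Pow inj)
  hence "inj_on (map_prod (image f) (image g)) (free_pairs p A)"
    by (rule inj_on_subset) (auto simp: free_pairs_def)
  moreover have "map_prod (image f) (image g) ` free_pairs p A
      \<subseteq> free_pairs p ((\<lambda>a. u * a + v) ` A)"
  proof (rule image_subsetI)
    fix X assume X: "X \<in> free_pairs p A"
    obtain B C where [simp]: "X = (B, C)" by (cases X)
    have BC: "(B, C) \<in> free_pairs p A" using X by simp
    have "sumset p ((\<lambda>a. u * a + v) ` A) (f ` B) \<inter> g ` C = g ` (sumset p A B \<inter> C)"
      unfolding f_def using sumset_affine[of p u v A B] inj_on_image_Int[OF inj(2), of "sumset p A B" C]
        BC sumset_subset_Zn[OF assms(1)] by (simp add: g_def free_pairs_def)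
    moreover have "f ` B \<subseteq> Zn p" "g ` C \<subseteq> Zn p"
      using BC image_mono[of B "Zn p" f] image_mono[of C "Zn p" g] unfolding im by (auto simp: free_pairs_def)
    ultimately show "map_prod (image f) (image g) X \<in> free_pairs p ((\<lambda>a. u * a + v) ` A)"
      using BC by (simp add: free_pairs_def)
  qed
  ultimately show ?thesis
    by (rule card_inj_on_le) simp
qed

lemma card_free_pairs_affine:
  assumes "p > 0" "coprime u (int p)"
  shows "card (free_pairs p ((\<lambda>a. u * a + v) ` A)) = card (free_pairs p A)"
proof (rule antisym[OF _ card_free_pairs_affine_le[OF assms]])
  \<comment> \<open>The inverse affine map gives the other inequality; it returns to A only modulo
    p, which \<open>free_pairs_cong_mod\<close> absorbs.\<close>
  obtain w where w: "[u * w = 1] (mod int p)"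
    using assms cong_solve_coprime_int by blast
  have "coprime (w * u) (int p)"
    using w cong_imp_coprime[of 1 "w * u" "int p"] by (simp add: cong_sym mult.commute)
  hence cw: "coprime w (int p)" by simp
  have "[w * (u * a + v) + - (w * v) = a] (mod int p)" for a
  proof -
    have "w * (u * a + v) + - (w * v) = (u * w) * a" by (simp add: algebra_simps)
    thus ?thesis using cong_scalar_right[OF w, of a] by simp
  qed
  hence "(\<lambda>a. a mod int p) ` (\<lambda>a. w * a + - (w * v)) ` (\<lambda>a. u * a + v) ` A = (\<lambda>a. a mod int p) ` A"
    unfolding image_image cong_def by (intro image_cong) auto
  from free_pairs_cong_mod[OF this]
  show "card (free_pairs p ((\<lambda>a. u * a + v) ` A)) \<le> card (free_pairs p A)"
    using card_free_pairs_affine_le[OF assms(1) cw, of "(\<lambda>a. u * a + v) ` A" "- (w * v)"] by simp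
qed

section \<open>Three-element sets in general position\<close>

lemma sum_Pow_insert:
  fixes g :: "'a set \<Rightarrow> 'b :: comm_monoid_add"
  assumes "finite V" "x \<notin> V"
  shows "(\<Sum>X\<in>Pow (insert x V). g X) = (\<Sum>X\<in>Pow V. g X + g (insert x X))"
proof -
  have "Pow V \<inter> insert x ` Pow V = {}" using assms by force
  moreover have "inj_on (insert x) (Pow V)"
  proof (rule inj_onI)
    fix X Y assume "X \<in> Pow V" "Y \<in> Pow V" "insert x X = insert x Y"
    moreover from this have "x \<notin> X" "x \<notin> Y" using assms by auto
    ultimately show "X = Y" by (simp add: insert_ident)
  qed
  ultimately show ?thesis
    unfolding Pow_insert using assms by (simp add: sum.union_disjoint sum.reindex sum.distrib o_def)
qed

lemma sum_Pow_Zn_Suc: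
  "(\<Sum>X\<in>Pow (Zn (Suc n)). g X) = (\<Sum>X\<in>Pow (Zn n). g X + g (insert (int n) X))"
proof -
  have "Zn (Suc n) = insert (int n) (Zn n)" by auto
  thus ?thesis by (simp add: sum_Pow_insert)
qed

text \<open>The set {0, a, b} is entered through a and d = b - 2 a. Positivity of d excludes
  progressions: the position n - d consulted when n is appended has then been decided before.
  Looking back from n - a by c and d leads to n - b and n - c, and from n - c by a to n - b, so that
  the distances a, b, c, d are closed under all lookups. The bounds 1/2 and 1 limit what it costs to
  remove the potentials.\<close>

locale triangular_transfer =
  fixes a d :: nat and f :: "bool \<Rightarrow> bool \<Rightarrow> bool \<Rightarrow> real" and h :: "bool \<Rightarrow> bool \<Rightarrow> real"
  assumes a_pos: "a > 0" and d_pos: "d > 0"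
    and f_bounds: "\<And>x y z. 1 / 2 \<le> f x y z \<and> f x y z \<le> 1"
    and h_bounds: "\<And>x y. 1 / 2 \<le> h x y \<and> h x y \<le> 1"
begin

abbreviation "c \<equiv> a + d"
abbreviation "b \<equiv> a + c"

definition fw :: "int set \<Rightarrow> int \<Rightarrow> real" where
  "fw X m = f (m \<in> X) (m - int c \<in> X) (m - int d \<in> X)"

definition hw :: "int set \<Rightarrow> int \<Rightarrow> real" where
  "hw X m = h (m \<in> X) (m - int a \<in> X)"

definition wt :: "int set \<Rightarrow> int \<Rightarrow> real" where
  "wt X t = (if t \<in> X \<or> t - int a \<in> X \<or> t - int b \<in> X then 1 else 2)"

text \<open>The potentials on the last \<open>a\<close> and \<open>c\<close> positions telescope: appending a position replaces a
  factor by one at distance \<open>a\<close> resp. \<open>c\<close>, so that the growth of the weighted total depends only on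
  membership at the four distances \<open>a\<close>, \<open>b\<close>, \<open>c\<close>, \<open>d\<close>. Positions outside \<open>{0..<n}\<close> count as non-members.\<close>

definition Phi :: "int \<Rightarrow> int set \<Rightarrow> real" where
  "Phi n X = (\<Prod>m\<in>{n - int a..<n}. fw X m) * (\<Prod>m\<in>{n - int c..<n}. hw X m)"

definition total :: "nat \<Rightarrow> real" where
  "total n = (\<Sum>X\<in>Pow (Zn n). Phi (int n) X * (\<Prod>t\<in>Zn n. wt X t))"

text \<open>The numerator adds the choices n not in X and n in X, each with its local weight and the
  potentials entering at n. The denominator holds the potentials leaving the windows:
  \<open>f xa xb xc\<close> is \<open>fw\<close> at n - a and \<open>h xc xb\<close> is
  \<open>hw\<close> at n - c.\<close>

definition ratio :: "bool \<Rightarrow> bool \<Rightarrow> bool \<Rightarrow> bool \<Rightarrow> real" where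
  "ratio xa xb xc xd =
     ((if xa \<or> xb then 1 else 2) * f False xc xd * h False xa + f True xc xd * h True xa)
     / (f xa xb xc * h xc xb)"

lemma f_pos: "f x y z > 0" and h_pos: "h x y > 0"
  using f_bounds[of x y z] h_bounds[of x y] by linarith+

lemma fw_pos: "fw X m > 0" and hw_pos: "hw X m > 0"
  by (simp_all add: fw_def hw_def f_pos h_pos)

lemma wt_bounds: "1 \<le> wt X t" "wt X t \<le> 2"
  by (simp_all add: wt_def)

lemma Phi_pos: "Phi n X > 0"
  unfolding Phi_def by (intro mult_pos_pos prod_pos) (auto simp: fw_pos hw_pos)

lemma Phi_le_1: "Phi n X \<le> 1"
  unfolding Phi_def
  by (intro mult_le_one prod_nonneg prod_le_1) (auto simp: fw_def hw_def f_bounds h_bounds f_pos h_pos less_imp_le)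

lemma Phi_ge: "(1 / 2) ^ b \<le> Phi n X"
proof -
  have "(1 / 2) ^ a \<le> (\<Prod>m\<in>{n - int a..<n}. fw X m)"
  proof -
    have "(\<Prod>m\<in>{n - int a..<n}. 1 / 2 :: real) \<le> (\<Prod>m\<in>{n - int a..<n}. fw X m)"
      by (rule prod_mono) (use f_bounds in \<open>auto simp: fw_def\<close>)
    thus ?thesis by simp
  qed
  moreover have "(1 / 2) ^ c \<le> (\<Prod>m\<in>{n - int c..<n}. hw X m)"
  proof -
    have "(\<Prod>m\<in>{n - int c..<n}. 1 / 2 :: real) \<le> (\<Prod>m\<in>{n - int c..<n}. hw X m)"
      by (rule prod_mono) (use h_bounds in \<open>auto simp: hw_def\<close>)
    thus ?thesis by (simp add: nat_add_distrib)
  qed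
  ultimately show ?thesis
    unfolding Phi_def power_add[of _ a c] by (intro mult_mono) (auto intro!: prod_nonneg simp: fw_pos less_imp_le)
qed

lemma prod_window_Suc:
  fixes g :: "int \<Rightarrow> real"
  assumes "s > 0"
  shows "(\<Prod>m\<in>{n + 1 - int s..<n + 1}. g m) * g (n - int s) = (\<Prod>m\<in>{n - int s..<n}. g m) * g n"
proof -
  have "{n + 1 - int s..<n + 1} = insert n {n + 1 - int s..<n}"
       "{n - int s..<n} = insert (n - int s) {n + 1 - int s..<n}"
    using assms by auto
  thus ?thesis by simp
qed

text \<open>Both windows slide by one position. Only agreement of the two sets below n is required,
  so that one statement serves X itself and \<open>insert n X\<close>.\<close>

lemma Phi_Suc:
  assumes "X' \<inter> {..<n} = X \<inter> {..<n}"
  shows "Phi (n + 1) X' * (fw X (n - int a) * hw X (n - int c)) = Phi n X * (fw X' n * hw X' n)"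
proof -
  have mem: "m \<in> X' \<longleftrightarrow> m \<in> X" if "m < n" for m
    using assms that by blast
  have fw: "fw X' m = fw X m" and hw: "hw X' m = hw X m" if "m < n" for m
    using that a_pos d_pos by (auto simp: fw_def hw_def mem)
  have "Phi (n + 1) X' * (fw X (n - int a) * hw X (n - int c)) =
      ((\<Prod>m\<in>{n + 1 - int a..<n + 1}. fw X' m) * fw X' (n - int a)) *
      ((\<Prod>m\<in>{n + 1 - int c..<n + 1}. hw X' m) * hw X' (n - int c))"
    unfolding Phi_def using a_pos d_pos by (simp add: fw hw)
  also have "\<dots> = ((\<Prod>m\<in>{n - int a..<n}. fw X' m) * fw X' n) * ((\<Prod>m\<in>{n - int c..<n}. hw X' m) * hw X' n)"
    using prod_window_Suc[of a "fw X'" n] prod_window_Suc[of c "hw X'" n] a_pos by simp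
  also have "(\<Prod>m\<in>{n - int a..<n}. fw X' m) = (\<Prod>m\<in>{n - int a..<n}. fw X m)"
    by (intro prod.cong) (auto simp: fw)
  also have "(\<Prod>m\<in>{n - int c..<n}. hw X' m) = (\<Prod>m\<in>{n - int c..<n}. hw X m)"
    by (intro prod.cong) (auto simp: hw)
  finally show ?thesis
    unfolding Phi_def by (simp only: mult_ac)
qed

text \<open>X and \<open>insert n X\<close> agree below n; their joint contribution is the old
  contribution of X times a factor depending on four memberships. Uniform bounds on that factor then
  bound the growth whatever X is.\<close>

lemma total_Suc:
  "total (Suc n) = (\<Sum>X\<in>Pow (Zn n). Phi (int n) X * (\<Prod>t\<in>Zn n. wt X t) *
     ratio (int n - int a \<in> X) (int n - int b \<in> X) (int n - int c \<in> X) (int n - int d \<in> X))"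
proof -
  have "Phi (int (Suc n)) X * (\<Prod>t\<in>Zn (Suc n). wt X t)
      + Phi (int (Suc n)) (insert (int n) X) * (\<Prod>t\<in>Zn (Suc n). wt (insert (int n) X) t)
      = Phi (int n) X * (\<Prod>t\<in>Zn n. wt X t) *
     ratio (int n - int a \<in> X) (int n - int b \<in> X) (int n - int c \<in> X) (int n - int d \<in> X)"
    (is "?l1 + ?l2 = ?r") if X: "X \<subseteq> Zn n" for X
  proof -
    define Y where "Y = insert (int n) X"
    define D where "D = fw X (int n - int a) * hw X (int n - int c)"
    have D: "D > 0" unfolding D_def by (simp add: fw_pos hw_pos)
    have D_eq: "D = f (int n - int a \<in> X) (int n - int b \<in> X) (int n - int c \<in> X)
        * h (int n - int c \<in> X) (int n - int b \<in> X)"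
      by (simp add: D_def fw_def hw_def algebra_simps)
    have nX: "int n \<notin> X" using X by auto
    have Z: "Zn (Suc n) = insert (int n) (Zn n)" by auto
    have wt: "(\<Prod>t\<in>Zn n. wt Y t) = (\<Prod>t\<in>Zn n. wt X t)"
      by (intro prod.cong) (auto simp: wt_def Y_def)
    have 1: "Phi (int n + 1) X * D = Phi (int n) X * (fw X (int n) * hw X (int n))"
      unfolding D_def by (rule Phi_Suc) simp
    have 2: "Phi (int n + 1) Y * D = Phi (int n) X * (fw Y (int n) * hw Y (int n))"
      unfolding D_def by (rule Phi_Suc) (auto simp: Y_def)
    have "(?l1 + ?l2) * D = wt X (int n) * (\<Prod>t\<in>Zn n. wt X t) * (Phi (int n + 1) X * D)
        + wt Y (int n) * (\<Prod>t\<in>Zn n. wt X t) * (Phi (int n + 1) Y * D)"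
      unfolding Z by (simp add: wt Y_def[symmetric] algebra_simps)
    also have "\<dots> = Phi (int n) X * (\<Prod>t\<in>Zn n. wt X t) *
        (wt X (int n) * (fw X (int n) * hw X (int n)) + wt Y (int n) * (fw Y (int n) * hw Y (int n)))"
      unfolding 1 2 by (simp add: algebra_simps)
    also have "wt X (int n) * (fw X (int n) * hw X (int n)) + wt Y (int n) * (fw Y (int n) * hw Y (int n))
        = D * ratio (int n - int a \<in> X) (int n - int b \<in> X) (int n - int c \<in> X) (int n - int d \<in> X)"
      unfolding ratio_def D_eq[symmetric]
      using D a_pos d_pos nX by (simp add: fw_def hw_def wt_def Y_def)
    finally show ?thesis using D by simp
  qed
  thus ?thesis
    unfolding total_def sum_Pow_Zn_Suc by (intro sum.cong) auto
qed

lemma weight_nonneg: "0 \<le> Phi (int n) X * (\<Prod>t\<in>Zn n. wt X t)"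
  using wt_bounds(1)
  by (intro mult_nonneg_nonneg prod_nonneg less_imp_le[OF Phi_pos]) (meson order_trans zero_le_one)

lemma total_le:
  assumes "\<And>xa xb xc xd. ratio xa xb xc xd \<le> hi" and "hi \<ge> 0"
  shows "total n \<le> hi ^ n"
proof (induction n)
  case 0
  show ?case by (simp add: total_def Phi_le_1)
next
  case (Suc n)
  have "total (Suc n) \<le> (\<Sum>X\<in>Pow (Zn n). Phi (int n) X * (\<Prod>t\<in>Zn n. wt X t) * hi)"
    unfolding total_Suc by (intro sum_mono mult_left_mono assms weight_nonneg)
  also have "\<dots> = hi * total n"
    by (simp add: total_def sum_distrib_left mult_ac)
  also have "\<dots> \<le> hi * hi ^ n"
    by (intro mult_left_mono Suc.IH assms)
  finally show ?case by simp
qed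

lemma total_ge:
  assumes "\<And>xa xb xc xd. lo \<le> ratio xa xb xc xd" and "lo \<ge> 0"
  shows "(1 / 2) ^ b * lo ^ n \<le> total n"
proof (induction n)
  case 0
  show ?case using Phi_ge by (simp add: total_def)
next
  case (Suc n)
  have "lo * ((1 / 2) ^ b * lo ^ n) \<le> lo * total n"
    by (intro mult_left_mono Suc.IH assms)
  also have "\<dots> = (\<Sum>X\<in>Pow (Zn n). Phi (int n) X * (\<Prod>t\<in>Zn n. wt X t) * lo)"
    by (simp add: total_def sum_distrib_left mult_ac)
  also have "\<dots> \<le> total (Suc n)"
    unfolding total_Suc by (intro sum_mono mult_left_mono assms weight_nonneg)
  finally show ?case by (simp add: mult_ac)
qed

lemma prod_boundary:
  assumes "b \<le> p"
  shows "(\<Prod>t\<in>Zn p. if t < int b then 2 else 1 :: real) = 2 ^ b"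
proof -
  have "Zn p \<inter> {t. t < int b} = {0..<int b}" using assms by auto
  thus ?thesis by (simp add: prod.If_cases)
qed

context
  fixes p :: nat
  assumes b_less: "b < p"
begin

text \<open>Only the first b positions can look back across 0. There both weights lie between 1 and
  2 and differ by a factor of at most 2; at all later positions they agree.\<close>

lemma cyclic_weight:
  assumes "B \<subseteq> Zn p" "t \<in> Zn p"
  defines "w \<equiv> (if \<exists>x\<in>{0, int a, int b}. (t - x) mod int p \<in> B then 1 else 2 :: real)"
  shows "w \<le> (if t < int b then 2 else 1) * wt B t" "wt B t \<le> (if t < int b then 2 else 1) * w"
proof -
  have "w = wt B t" if "\<not> t < int b"
  proof -
    have "(t - x) mod int p = t - x" if "x \<in> {0, int a, int b}" for x
      using that \<open>\<not> t < int b\<close> assms b_less by (intro mod_pos_pos_trivial) auto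
    thus ?thesis by (auto simp: w_def wt_def)
  qed
  moreover have "1 \<le> w" "w \<le> 2" by (auto simp: w_def)
  ultimately show "w \<le> (if t < int b then 2 else 1) * wt B t" "wt B t \<le> (if t < int b then 2 else 1) * w"
    using wt_bounds[of B t] by auto
qed

text \<open>One factor 2^b pays for the wrap-around and another for the a + c = b potentials still
  present at the end. In the lower bound below, the second factor is paid for the potentials at the
  start.\<close>

lemma card_free_pairs_le:
  assumes "\<And>xa xb xc xd. ratio xa xb xc xd \<le> hi" and "hi \<ge> 0"
  shows "real (card (free_pairs p {0, int a, int b})) \<le> 4 ^ b * hi ^ p"
proof -
  have "real (card (free_pairs p {0, int a, int b})) =
      (\<Sum>B\<in>Pow (Zn p). \<Prod>t\<in>Zn p. if \<exists>x\<in>{0, int a, int b}. (t - x) mod int p \<in> B then 1 else 2)"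
    using b_less by (intro card_free_pairs_prod) auto
  also have "\<dots> \<le> (\<Sum>B\<in>Pow (Zn p). \<Prod>t\<in>Zn p. (if t < int b then 2 else 1) * wt B t)"
    by (intro sum_mono prod_mono conjI cyclic_weight(1)) auto
  also have "\<dots> = (\<Sum>B\<in>Pow (Zn p). 2 ^ b * (\<Prod>t\<in>Zn p. wt B t))"
    unfolding prod.distrib by (simp only: prod_boundary less_imp_le[OF b_less])
  also have "\<dots> \<le> (\<Sum>B\<in>Pow (Zn p). 4 ^ b * (Phi (int p) B * (\<Prod>t\<in>Zn p. wt B t)))"
  proof (rule sum_mono)
    fix B
    have "2 ^ b * (\<Prod>t\<in>Zn p. wt B t) = 4 ^ b * ((1 / 2) ^ b * (\<Prod>t\<in>Zn p. wt B t))"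
      by (simp add: power_divide power_mult_distrib[symmetric] field_simps)
    also have "\<dots> \<le> 4 ^ b * (Phi (int p) B * (\<Prod>t\<in>Zn p. wt B t))"
      by (intro mult_left_mono mult_right_mono Phi_ge prod_nonneg)
         (auto intro: order_trans[OF zero_le_one wt_bounds(1)])
    finally show "2 ^ b * (\<Prod>t\<in>Zn p. wt B t) \<le> 4 ^ b * (Phi (int p) B * (\<Prod>t\<in>Zn p. wt B t))" .
  qed
  also have "\<dots> = 4 ^ b * total p"
    by (simp add: total_def sum_distrib_left)
  also have "\<dots> \<le> 4 ^ b * hi ^ p"
    using total_le[OF assms] by (intro mult_left_mono) auto
  finally show ?thesis .
qed

lemma card_free_pairs_ge:
  assumes "\<And>xa xb xc xd. lo \<le> ratio xa xb xc xd" and "lo \<ge> 0"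
  shows "lo ^ p \<le> 4 ^ b * real (card (free_pairs p {0, int a, int b}))"
proof -
  have "lo ^ p = 2 ^ b * ((1 / 2) ^ b * lo ^ p)"
    by (simp add: power_divide)
  also have "\<dots> \<le> 2 ^ b * total p"
    by (intro mult_left_mono total_ge assms) auto
  also have "\<dots> \<le> 2 ^ b * (\<Sum>B\<in>Pow (Zn p). 1 * (\<Prod>t\<in>Zn p. wt B t))"
    unfolding total_def
    by (intro mult_left_mono sum_mono mult_right_mono Phi_le_1 prod_nonneg)
         (auto intro: order_trans[OF zero_le_one wt_bounds(1)])
  also have "\<dots> \<le> 2 ^ b * (\<Sum>B\<in>Pow (Zn p). 
      \<Prod>t\<in>Zn p. (if t < int b then 2 else 1) * (if \<exists>x\<in>{0, int a, int b}. (t - x) mod int p \<in> B then 1 else 2))"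
    unfolding mult_1
    by (intro mult_left_mono sum_mono prod_mono conjI cyclic_weight(2))
       (auto intro: order_trans[OF zero_le_one wt_bounds(1)])
  also have "\<dots> = 2 ^ b * (2 ^ b * (\<Sum>B\<in>Pow (Zn p). \<Prod>t\<in>Zn p. if \<exists>x\<in>{0, int a, int b}. (t - x) mod int p \<in> B then 1 else 2))"
    using b_less unfolding prod.distrib sum_distrib_left by (simp only: prod_boundary less_imp_le)
  also have "(\<Sum>B\<in>Pow (Zn p). \<Prod>t\<in>Zn p. if \<exists>x\<in>{0, int a, int b}. (t - x) mod int p \<in> B then 1 else 2) = real (card (free_pairs p {0, int a, int b}))"
    using b_less by (intro card_free_pairs_prod[symmetric]) auto
  also have "2 ^ b * (2 ^ b * real (card (free_pairs p {0, int a, int b}))) = 4 ^ b * real (card (free_pairs p {0, int a, int b}))"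
    by (simp add: power_mult_distrib[symmetric])
  finally show ?thesis .
qed

end

end

text \<open>The tables were found by numerically minimising the maximum (\<open>hi\<close>) and maximising the minimum
  (\<open>lo\<close>) of \<open>ratio\<close> over its 16 arguments, and then rounding.\<close>

definition f_hi :: "bool \<Rightarrow> bool \<Rightarrow> bool \<Rightarrow> real" where
  "f_hi x y z = (if z then if y then if x then 56 else 60 else if x then 54 else 92
                 else if y then if x then 56 else 60 else if x then 51 else 94) / 100"

definition h_hi :: "bool \<Rightarrow> bool \<Rightarrow> real" where
  "h_hi x y = (if y then if x then 50 else 65 else if x then 52 else 71) / 100"

definition f_lo :: "bool \<Rightarrow> bool \<Rightarrow> bool \<Rightarrow> real" where
  "f_lo x y z = (if z then if y then if x then 417 else 444 else if x then 406 else 692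
                 else if y then if x then 415 else 445 else if x then 380 else 701) / 760"

definition h_lo :: "bool \<Rightarrow> bool \<Rightarrow> real" where
  "h_lo x y = (if y then if x then 474 else 620 else if x then 486 else 677) / 760"

lemma card_free_pairs_triangular_le:
  assumes "a > 0" "d > 0" "2 * a + d < p"
  shows "real (card (free_pairs p {0, int a, int (2 * a + d)})) \<le> 4 ^ (2 * a + d) * (2398 / 1000) ^ p"
proof -
  interpret triangular_transfer a d f_hi h_hi
    by unfold_locales (use assms in \<open>auto simp: f_hi_def h_hi_def\<close>)
  have "ratio xa xb xc xd \<le> 2398 / 1000" for xa xb xc xd
    by (cases xa; cases xb; cases xc; cases xd) (simp_all add: ratio_def f_hi_def h_hi_def)
  note * = card_free_pairs_le[OF _ this]
  have b: "a + (a + d) = 2 * a + d" by simp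
  show ?thesis
    using *[unfolded b, OF assms(3)] by simp
qed

lemma card_free_pairs_triangular_ge:
  assumes "a > 0" "d > 0" "2 * a + d < p"
  shows "(23891 / 10000) ^ p \<le> 4 ^ (2 * a + d) * real (card (free_pairs p {0, int a, int (2 * a + d)}))"
proof -
  interpret triangular_transfer a d f_lo h_lo
    by unfold_locales (use assms in \<open>auto simp: f_lo_def h_lo_def\<close>)
  have "23891 / 10000 \<le> ratio xa xb xc xd" for xa xb xc xd
    by (cases xa; cases xb; cases xc; cases xd) (simp_all add: ratio_def f_lo_def h_lo_def)
  note * = card_free_pairs_ge[OF _ this]
  have b: "a + (a + d) = 2 * a + d" by simp
  show ?thesis
    using *[unfolded b, OF assms(3)] by simp
qed

section \<open>Finner's inequality and Kahn's bound\<close>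

text \<open>This is the AM-GM inequality for the numbers \<open>w i ^ d\<close>: after division by
  their mean, y <= exp (y - 1) is multiplied over J, and the exponents add up to 0.\<close>

lemma prod_le_mean_power:
  fixes w :: "'a \<Rightarrow> real"
  assumes "finite J" "card J = d" "d > 0" "\<And>i. i \<in> J \<Longrightarrow> w i \<ge> 0"
  shows "(\<Prod>i\<in>J. w i) \<le> (\<Sum>i\<in>J. w i ^ d) / d"
proof (cases "(\<Sum>i\<in>J. w i ^ d) = 0")
  case True
  hence "\<forall>i\<in>J. w i ^ d = 0"
    using assms by (subst (asm) sum_nonneg_eq_0_iff) auto
  moreover obtain i where "i \<in> J"
    using assms by fastforce
  ultimately have "(\<Prod>i\<in>J. w i) = 0"
    using assms by (intro prod_zero) auto
  thus ?thesis using True by simp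
next
  case False
  define m where "m = (\<Sum>i\<in>J. w i ^ d) / d"
  have "(\<Sum>i\<in>J. w i ^ d) \<ge> 0" by (intro sum_nonneg) (use assms in auto)
  hence m: "m > 0" using False assms(3) by (simp add: m_def)
  have "(\<Prod>i\<in>J. w i ^ d / m) \<le> (\<Prod>i\<in>J. exp (w i ^ d / m - 1))"
  proof (intro prod_mono conjI)
    fix i assume "i \<in> J"
    show "w i ^ d / m \<le> exp (w i ^ d / m - 1)"
      using exp_ge_add_one_self[of "w i ^ d / m - 1"] by simp
    show "0 \<le> w i ^ d / m"
      using m assms(4) \<open>i \<in> J\<close> by simp
  qed
  also have "\<dots> = exp ((\<Sum>i\<in>J. w i ^ d) / m - d)"
    using assms by (simp add: exp_sum[symmetric] sum_subtractf sum_divide_distrib)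
  also have "(\<Sum>i\<in>J. w i ^ d) / m - d = 0"
    using assms(3) False by (simp add: m_def)
  finally have "(\<Prod>i\<in>J. w i) ^ d \<le> m ^ d"
    using m assms(2) by (simp add: prod_dividef prod_power_distrib)
  hence "(\<Prod>i\<in>J. w i) \<le> m"
    using m assms(3) by (simp add: power_mono_iff prod_nonneg assms(4))
  thus ?thesis by (simp add: m_def)
qed

text \<open>This is Hoelder's inequality for d functions on a two-point set. Dividing by the roots
  achieves u^d + v^d = 1 for each factor, and AM-GM is applied to either product.\<close>

lemma Holder_two_terms:
  fixes u v :: "'a \<Rightarrow> real"
  assumes "finite J" "card J = d" "d > 0" "\<And>i. i \<in> J \<Longrightarrow> u i \<ge> 0" "\<And>i. i \<in> J \<Longrightarrow> v i \<ge> 0"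
  shows "(\<Prod>i\<in>J. u i) + (\<Prod>i\<in>J. v i) \<le> (\<Prod>i\<in>J. root d (u i ^ d + v i ^ d))"
proof (cases "\<exists>i\<in>J. u i ^ d + v i ^ d = 0")
  case True
  then obtain i where i: "i \<in> J" "u i ^ d + v i ^ d = 0" by auto
  hence "u i ^ d = 0" "v i ^ d = 0"
    using assms by (simp_all add: add_nonneg_eq_0_iff)
  hence "(\<Prod>i\<in>J. u i) = 0" "(\<Prod>i\<in>J. v i) = 0"
    using i assms by (auto intro!: prod_zero)
  moreover have "0 \<le> (\<Prod>i\<in>J. root d (u i ^ d + v i ^ d))"
    by (intro prod_nonneg) (auto simp: assms)
  ultimately show ?thesis by linarith
next
  case False
  define r where "r = (\<lambda>i. root d (u i ^ d + v i ^ d))"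
  have s: "u i ^ d + v i ^ d > 0" if "i \<in> J" for i
    using False assms that by (metis add_nonneg_nonneg order_le_less zero_le_power)
  have r: "r i > 0" "r i ^ d = u i ^ d + v i ^ d" if "i \<in> J" for i
    using s[OF that] assms by (simp_all add: r_def)
  have "(\<Prod>i\<in>J. u i / r i) + (\<Prod>i\<in>J. v i / r i)
      \<le> (\<Sum>i\<in>J. (u i / r i) ^ d) / d + (\<Sum>i\<in>J. (v i / r i) ^ d) / d"
    by (intro add_mono prod_le_mean_power assms) (use r assms in \<open>auto intro: divide_nonneg_pos\<close>)
  also have "\<dots> = (\<Sum>i\<in>J. (u i / r i) ^ d + (v i / r i) ^ d) / d"
    by (simp add: sum.distrib add_divide_distrib)
  also have "(\<Sum>i\<in>J. (u i / r i) ^ d + (v i / r i) ^ d) = (\<Sum>i\<in>J. 1)"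
  proof (rule sum.cong)
    fix i assume "i \<in> J"
    thus "(u i / r i) ^ d + (v i / r i) ^ d = 1"
      using s[of i] r(2)[of i] by (simp add: power_divide add_divide_distrib[symmetric])
  qed simp
  also have "\<dots> / d = 1" using assms by simp
  finally have "(\<Prod>i\<in>J. u i) / (\<Prod>i\<in>J. r i) + (\<Prod>i\<in>J. v i) / (\<Prod>i\<in>J. r i) \<le> 1"
    by (simp add: prod_dividef)
  moreover have "(\<Prod>i\<in>J. r i) > 0" by (intro prod_pos r) auto
  ultimately show ?thesis
    by (simp add: add_divide_distrib[symmetric] r_def)
qed

text \<open>Removing one x from V splits the sum according to x in X. Only the d factors with x in
  \<open>N i\<close> notice; Hoelder's inequality merges their two values into \<open>f' i\<close>,
  the l^d norm over x. Since every x lies in exactly d of the sets, the same exponent serves at each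
  step.\<close>

lemma Finner:
  fixes f :: "'i \<Rightarrow> 'a set \<Rightarrow> real"
  assumes "finite V" "finite I" "d > 0"
    and "\<And>i. i \<in> I \<Longrightarrow> N i \<subseteq> V"
    and "\<And>x. x \<in> V \<Longrightarrow> card {i \<in> I. x \<in> N i} = d"
    and "\<And>i Y. i \<in> I \<Longrightarrow> f i Y \<ge> 0"
  shows "(\<Sum>X\<in>Pow V. \<Prod>i\<in>I. f i (X \<inter> N i)) \<le> (\<Prod>i\<in>I. root d (\<Sum>Y\<in>Pow (N i). f i Y ^ d))"
  using assms(1,4-6)
proof (induction V arbitrary: f N rule: finite_induct)
  case empty
  have "N i = {}" if "i \<in> I" for i using empty(1)[OF that] by auto
  thus ?case
    using empty(3) \<open>d > 0\<close> by (simp add: real_root_power_cancel cong: prod.cong)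
next
  case (insert x V)
  define J where "J = {i \<in> I. x \<in> N i}"
  define N' where "N' = (\<lambda>i. N i - {x})"
  define f' where "f' = (\<lambda>i Y. if i \<in> J then root d (f i Y ^ d + f i (insert x Y) ^ d) else f i Y)"
  have J: "J \<subseteq> I" "card J = d" "finite J"
    using insert.prems(2)[of x] \<open>finite I\<close> by (auto simp: J_def)
  have "(\<Sum>X\<in>Pow (insert x V). \<Prod>i\<in>I. f i (X \<inter> N i))
      = (\<Sum>X\<in>Pow V. (\<Prod>i\<in>I. f i (X \<inter> N i)) + (\<Prod>i\<in>I. f i (insert x X \<inter> N i)))"
    using insert.hyps by (rule sum_Pow_insert)
  also have "\<dots> \<le> (\<Sum>X\<in>Pow V. \<Prod>i\<in>I. f' i (X \<inter> N' i))"
  proof (rule sum_mono)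
    fix X assume "X \<in> Pow V"
    hence x: "x \<notin> X" using insert.hyps by auto
    have 1: "X \<inter> N i = X \<inter> N' i" for i using x by (auto simp: N'_def)
    have 2: "insert x X \<inter> N i = insert x (X \<inter> N' i)" if "i \<in> J" for i
      using that x by (auto simp: N'_def J_def)
    have 3: "insert x X \<inter> N i = X \<inter> N' i" if "i \<in> I - J" for i
      using that x by (auto simp: N'_def J_def)
    have split: "(\<Prod>i\<in>I. g i) = (\<Prod>i\<in>I - J. g i) * (\<Prod>i\<in>J. g i)" for g :: "'i \<Rightarrow> real"
      using \<open>finite I\<close> J(1) by (intro prod.subset_diff)
    have "(\<Prod>i\<in>I. f i (X \<inter> N i)) + (\<Prod>i\<in>I. f i (insert x X \<inter> N i))
      = (\<Prod>i\<in>I - J. f i (X \<inter> N' i)) * ((\<Prod>i\<in>J. f i (X \<inter> N' i)) + (\<Prod>i\<in>J. f i (insert x (X \<inter> N' i))))"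
      by (subst (1 2) split) (simp add: 1 2 3 distrib_left)
    also have "\<dots> \<le> (\<Prod>i\<in>I - J. f i (X \<inter> N' i)) *
        (\<Prod>i\<in>J. root d (f i (X \<inter> N' i) ^ d + f i (insert x (X \<inter> N' i)) ^ d))"
      using J \<open>d > 0\<close> insert.prems(3)
      by (intro mult_left_mono Holder_two_terms prod_nonneg) auto
    also have "\<dots> = (\<Prod>i\<in>I. f' i (X \<inter> N' i))"
      unfolding split[of "\<lambda>i. f' i (X \<inter> N' i)"] by (simp add: f'_def)
    finally show "(\<Prod>i\<in>I. f i (X \<inter> N i)) + (\<Prod>i\<in>I. f i (insert x X \<inter> N i))
        \<le> (\<Prod>i\<in>I. f' i (X \<inter> N' i))" .
  qed
  also have "\<dots> \<le> (\<Prod>i\<in>I. root d (\<Sum>Y\<in>Pow (N' i). f' i Y ^ d))"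
  proof (rule insert.IH)
    show "N' i \<subseteq> V" if "i \<in> I" for i
      using insert.prems(1)[OF that] by (auto simp: N'_def)
    show "card {i \<in> I. y \<in> N' i} = d" if "y \<in> V" for y
    proof -
      have "{i \<in> I. y \<in> N' i} = {i \<in> I. y \<in> N i}"
        using that insert.hyps by (auto simp: N'_def)
      thus ?thesis using insert.prems(2)[of y] that by simp
    qed
    show "f' i Y \<ge> 0" if "i \<in> I" for i Y
      using insert.prems(3)[OF that]
      by (auto simp: f'_def intro!: real_root_ge_zero add_nonneg_nonneg)
  qed
  also have "\<dots> = (\<Prod>i\<in>I. root d (\<Sum>Y\<in>Pow (N i). f i Y ^ d))"
  proof (intro prod.cong refl arg_cong[where f = "root d"])
    fix i assume i: "i \<in> I"
    show "(\<Sum>Y\<in>Pow (N' i). f' i Y ^ d) = (\<Sum>Y\<in>Pow (N i). f i Y ^ d)"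
    proof (cases "i \<in> J")
      case True
      have "finite (N' i)"
        using insert.prems(1)[OF i] insert.hyps by (auto simp: N'_def intro: finite_subset)
      moreover have "N i = Set.insert x (N' i)" "x \<notin> N' i"
        using True by (auto simp: N'_def J_def)
      ultimately have "(\<Sum>Y\<in>Pow (N i). f i Y ^ d) = (\<Sum>Y\<in>Pow (N' i). f i Y ^ d + f i (Set.insert x Y) ^ d)"
        using sum_Pow_insert[of "N' i" x "\<lambda>Y. f i Y ^ d"] by simp
      thus ?thesis
        using True \<open>d > 0\<close> insert.prems(3)[OF i] by (simp add: f'_def)
    next
      case False
      hence "N' i = N i" using i by (auto simp: N'_def J_def)
      thus ?thesis using False by (simp add: f'_def)
    qed
  qed
  finally show ?case .
qed

text \<open>The sets N c = c - A have size d = |A|, and each x lies in d of them. The local weight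
  is 2 on the empty set and 1 elsewhere, so its d-th powers sum to 2^d + (2^d - 1), the number of
  independent sets of the complete bipartite graph with d vertices on each side.\<close>

lemma card_free_pairs_le_Kahn:
  assumes "p > 0" "A \<subseteq> Zn p" "A \<noteq> {}"
  shows "real (card (free_pairs p A)) \<le> (2 ^ (card A + 1) - 1) powr (real p / real (card A))"
proof -
  define d where "d = card A"
  have fin: "finite A" using assms finite_subset by blast
  hence d: "d > 0" using assms by (simp add: d_def card_gt_0_iff)
  define N where "N = (\<lambda>c. (\<lambda>a. (c - a) mod int p) ` A)"
  define f :: "int set \<Rightarrow> real" where "f = (\<lambda>Y. if Y = {} then 2 else 1)"
  have cardN: "card (N c) = d" for c
  proof -
    have "inj_on (\<lambda>a. (c - a) mod int p) A"
      using inj_on_affine_mod[of p "-1" c] assms by (auto intro: inj_on_subset)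
    thus ?thesis by (simp add: N_def card_image d_def)
  qed
  have finN: "finite (N c)" for c using fin by (simp add: N_def)
  have deg: "card {c \<in> Zn p. x \<in> N c} = d" if x: "x \<in> Zn p" for x
  proof -
    have "{c \<in> Zn p. x \<in> N c} = (\<lambda>a. (a + x) mod int p) ` A"
    proof (intro equalityI subsetI)
      fix c assume "c \<in> {c \<in> Zn p. x \<in> N c}"
      then obtain a where a: "c \<in> Zn p" "a \<in> A" "x = (c - a) mod int p"
        by (auto simp: N_def)
      have "(a + x) mod int p = c"
        using a by (simp add: mod_add_right_eq)
      thus "c \<in> (\<lambda>a. (a + x) mod int p) ` A" using a by force
    next
      fix c assume "c \<in> (\<lambda>a. (a + x) mod int p) ` A"
      then obtain a where a: "a \<in> A" "c = (a + x) mod int p" by auto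
      have "(c - a) mod int p = x"
        using a x by (simp add: mod_diff_left_eq)
      hence "x \<in> N c"
        unfolding N_def using a(1) by (metis imageI)
      thus "c \<in> {c \<in> Zn p. x \<in> N c}"
        using a(2) assms(1) by simp
    qed
    moreover have "inj_on (\<lambda>a. (a + x) mod int p) A"
      using inj_on_affine_mod[of p 1 x] assms by (auto intro: inj_on_subset)
    ultimately show ?thesis by (simp add: card_image d_def)
  qed
  have sum: "(\<Sum>Y\<in>Pow (N c). f Y ^ d) = 2 ^ (d + 1) - 1" for c
  proof -
    have "(\<Sum>Y\<in>Pow (N c). f Y ^ d) = f {} ^ d + (\<Sum>Y\<in>Pow (N c) - {{}}. f Y ^ d)"
      using finN by (intro sum.remove) auto
    also have "(\<Sum>Y\<in>Pow (N c) - {{}}. f Y ^ d) = (\<Sum>Y\<in>Pow (N c) - {{}}. 1)"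
      by (intro sum.cong) (auto simp: f_def)
    also have "\<dots> = real (2 ^ d - 1)"
      using finN by (simp add: card_Diff_subset card_Pow cardN)
    finally show ?thesis by (simp add: f_def of_nat_diff)
  qed
  have "real (card (free_pairs p A)) =
      (\<Sum>B\<in>Pow (Zn p). \<Prod>c\<in>Zn p. if \<exists>a\<in>A. (c - a) mod int p \<in> B then 1 else 2)"
    by (rule card_free_pairs_prod) fact
  also have "\<dots> = (\<Sum>B\<in>Pow (Zn p). \<Prod>c\<in>Zn p. f (B \<inter> N c))"
    by (intro sum.cong prod.cong) (auto simp: f_def N_def)
  also have "\<dots> \<le> (\<Prod>c\<in>Zn p. root d (\<Sum>Y\<in>Pow (N c). f Y ^ d))"
    by (rule Finner) (use d deg assms(1) in \<open>auto simp: f_def N_def\<close>)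
  also have "\<dots> = root d (2 ^ (d + 1) - 1) ^ p"
    by (simp only: sum prod_constant card_atLeastLessThan_int) simp
  also have "\<dots> = (2 ^ (d + 1) - 1) powr (real p / real d)"
  proof -
    have pos: "(2 :: real) ^ (d + 1) - 1 > 0" using one_less_power[of "2::real" "d+1"] by linarith
    thus ?thesis
      using d by (simp add: root_powr_inverse powr_realpow[symmetric] powr_powr field_simps)
  qed
  finally show ?thesis by (simp add: d_def)
qed

section \<open>Pollard's theorem\<close>

definition reps :: "nat \<Rightarrow> int set \<Rightarrow> int set \<Rightarrow> int \<Rightarrow> nat" where
  "reps p A B z = card {a \<in> A. (z - a) mod int p \<in> B}"

lemma sum_card_swap:
  assumes "finite X" "finite Y"
  shows "(\<Sum>x\<in>X. card {y \<in> Y. R x y}) = (\<Sum>y\<in>Y. card {x \<in> X. R x y})"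
proof -
  have "card {y \<in> Y. R x y} = (\<Sum>y\<in>Y. if R x y then 1 else 0)" for x
    using assms by (simp add: sum.If_cases Int_def)
  moreover have "card {x \<in> X. R x y} = (\<Sum>x\<in>X. if R x y then 1 else 0)" for y
    using assms by (simp add: sum.If_cases Int_def)
  ultimately show ?thesis
    by (simp only: sum.swap[of _ X])
qed

lemma inj_on_diff_mod: "p > 0 \<Longrightarrow> A \<subseteq> Zn p \<Longrightarrow> inj_on (\<lambda>a. (z - a) mod int p) A"
  using inj_on_affine_mod[of p "-1" z] by (auto intro: inj_on_subset)

lemma diff_mod_cancel: "a \<in> Zn p \<Longrightarrow> (z - (z - a) mod int p) mod int p = a"
  by (simp add: mod_diff_right_eq)

context
  fixes p :: nat
  assumes p_pos: "p > 0"
begin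

lemma card_shift_preimage:
  assumes "B \<subseteq> Zn p"
  shows "card {z \<in> Zn p. (z + e) mod int p \<in> B} = card B"
proof (rule bij_betw_same_card[of "\<lambda>z. (z + e) mod int p"], rule bij_betwI')
  fix x y assume "x \<in> {z \<in> Zn p. (z + e) mod int p \<in> B}" "y \<in> {z \<in> Zn p. (z + e) mod int p \<in> B}"
  thus "((x + e) mod int p = (y + e) mod int p) = (x = y)"
    using inj_on_eq_iff[OF inj_on_affine_mod[of p 1 e], of x y] p_pos by simp
next
  fix y assume y: "y \<in> B"
  have "((y - e) mod int p + e) mod int p = y"
    using y assms by (auto simp: mod_add_left_eq)
  moreover have "(y - e) mod int p \<in> Zn p" using p_pos by simp
  ultimately show "\<exists>x\<in>{z \<in> Zn p. (z + e) mod int p \<in> B}. y = (x + e) mod int p"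
    using y by (intro bexI[of _ "(y - e) mod int p"]) simp_all
qed simp

lemma sum_reps:
  assumes "A \<subseteq> Zn p" "B \<subseteq> Zn p"
  shows "(\<Sum>z\<in>Zn p. reps p A B z) = card A * card B"
proof -
  have "finite A" using assms finite_subset by blast
  hence "(\<Sum>z\<in>Zn p. reps p A B z) = (\<Sum>a\<in>A. card {z \<in> Zn p. (z - a) mod int p \<in> B})"
    unfolding reps_def by (intro sum_card_swap) auto
  also have "\<dots> = (\<Sum>a\<in>A. card B)"
    using card_shift_preimage[OF assms(2), of "- a" for a] by simp
  finally show ?thesis by simp
qed

lemma reps_le_right:
  assumes "A \<subseteq> Zn p" "B \<subseteq> Zn p"
  shows "reps p A B z \<le> card B"
  unfolding reps_def
proof (rule card_inj_on_le)
  show "inj_on (\<lambda>a. (z - a) mod int p) {a \<in> A. (z - a) mod int p \<in> B}"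
    by (rule inj_on_diff_mod[OF p_pos]) (use assms in auto)
qed (use assms finite_subset in auto)

text \<open>The effect of the Dyson transform, which replaces \<open>(A, B)\<close> by \<open>(A \<union> B, A \<inter> B)\<close>.\<close>

lemma reps_transform:
  assumes "A \<subseteq> Zn p" "B \<subseteq> Zn p"
  shows "reps p A B z = reps p (A \<union> B) (A \<inter> B) z + reps p (A - B) (B - A) z"
proof -
  define g where "g = (\<lambda>a. (z - a) mod int p)"
  have fin: "finite A" "finite B" using assms finite_subset by blast+
  have gg: "g (g a) = a" if "a \<in> A \<union> B" for a
    using diff_mod_cancel[of a p z] that assms by (auto simp: g_def)
  define S1 where "S1 = {a \<in> A. g a \<in> A \<inter> B}"
  define S2 where "S2 = {a \<in> A \<inter> B. g a \<in> B - A}"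
  define S3 where "S3 = {a \<in> A - B. g a \<in> B - A}"
  define S4 where "S4 = {a \<in> B - A. g a \<in> A \<inter> B}"
  have finS: "finite S1" "finite S2" "finite S3" "finite S4"
    using fin by (auto simp: S1_def S2_def S3_def S4_def)
  have "card S2 = card S4"
    by (rule bij_betw_same_card[of g], rule bij_betw_byWitness[of _ g])
       (auto simp: S2_def S4_def gg)
  moreover have "reps p A B z = card (S1 \<union> (S2 \<union> S3))"
    unfolding reps_def S1_def S2_def S3_def g_def by (rule arg_cong[of _ _ card]) auto
  moreover have "card (S1 \<union> (S2 \<union> S3)) = card S1 + card (S2 \<union> S3)"
    using finS by (intro card_Un_disjoint) (auto simp: S1_def S2_def S3_def)
  moreover have "card (S2 \<union> S3) = card S2 + card S3"
    using finS by (intro card_Un_disjoint) (auto simp: S2_def S3_def)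
  moreover have "reps p (A \<union> B) (A \<inter> B) z = card (S1 \<union> S4)"
    unfolding reps_def S1_def S4_def g_def by (rule arg_cong[of _ _ card]) auto
  moreover have "card (S1 \<union> S4) = card S1 + card S4"
    using finS by (intro card_Un_disjoint) (auto simp: S1_def S4_def)
  moreover have "reps p (A - B) (B - A) z = card S3"
    unfolding reps_def S3_def g_def by simp
  ultimately show ?thesis by simp
qed

text \<open>Translating B only translates the sums. This permits moving B to a position where the
  Dyson transform makes progress.\<close>

lemma sum_reps_shift:
  assumes "A \<subseteq> Zn p" "B \<subseteq> Zn p"
  shows "(\<Sum>z\<in>Zn p. min t (reps p A ((\<lambda>b. (b + e) mod int p) ` B) z)) = (\<Sum>z\<in>Zn p. min t (reps p A B z))"
proof -
  have mem: "(z + e - a) mod int p \<in> (\<lambda>b. (b + e) mod int p) ` B \<longleftrightarrow> (z - a) mod int p \<in> B" for z a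
  proof -
    have "(z + e - a) mod int p = ((z - a) mod int p + e) mod int p"
      by (metis mod_add_left_eq diff_add_eq)
    moreover have "inj_on (\<lambda>b. (b + e) mod int p) (Zn p)"
      using inj_on_affine_mod[of p 1 e] p_pos by simp
    ultimately show ?thesis
      using assms(2) inj_on_image_mem_iff[of "\<lambda>b. (b + e) mod int p" "Zn p" "(z - a) mod int p" B] p_pos by simp
  qed
  have eq: "reps p A ((\<lambda>b. (b + e) mod int p) ` B) ((z + e) mod int p) = reps p A B z" for z
    unfolding reps_def by (simp add: mod_diff_left_eq mem)
  have "(\<Sum>z\<in>Zn p. min t (reps p A ((\<lambda>b. (b + e) mod int p) ` B) z))
      = (\<Sum>z\<in>(\<lambda>z. (z + e) mod int p) ` Zn p. min t (reps p A ((\<lambda>b. (b + e) mod int p) ` B) z))"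
    using affine_mod_image_Zn[of p 1 e] p_pos by simp
  also have "\<dots> = (\<Sum>z\<in>Zn p. min t (reps p A B z))"
    using inj_on_affine_mod[of p 1 e] p_pos by (simp add: sum.reindex eq)
  finally show ?thesis .
qed

end

text \<open>Modulo a prime, every nonzero s generates the group, so the walk from x with steps s
  visits all residues.\<close>

lemma closed_under_shift_imp_all:
  assumes "prime p" "A \<subseteq> Zn p" "x \<in> A" "\<not> int p dvd s"
    and closed: "\<And>y. y \<in> A \<Longrightarrow> (y + s) mod int p \<in> A"
  shows "A = Zn p"
proof -
  have p: "p > 0" using assms(1) prime_gt_0_nat by blast
  have step: "(x + int n * s) mod int p \<in> A" for n
  proof (induction n)
    case 0
    thus ?case using assms(2,3) by auto
  next
    case (Suc n)
    have "(x + int (Suc n) * s) mod int p = (x + int n * s + s) mod int p"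
      by (simp add: algebra_simps)
    also have "\<dots> = ((x + int n * s) mod int p + s) mod int p"
      by (simp only: mod_add_left_eq)
    finally show ?case using closed[OF Suc] by simp
  qed
  have "coprime s (int p)"
    using assms(1,4) by (metis coprime_commute prime_imp_coprime prime_nat_int_transfer)
  hence "(\<lambda>b. (s * b + x) mod int p) ` Zn p = Zn p"
    by (rule affine_mod_image_Zn[OF p])
  moreover have "(\<lambda>b. (s * b + x) mod int p) ` Zn p \<subseteq> A"
  proof (rule image_subsetI)
    fix b assume "b \<in> Zn p"
    thus "(s * b + x) mod int p \<in> A"
      using step[of "nat b"] by (simp add: algebra_simps)
  qed
  ultimately show ?thesis using assms(2) by blast
qed

text \<open>If every translate of B that meets A were contained in A, then A would be closed under
  adding the difference of two elements of B, hence would be everything.\<close>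

lemma exists_proper_shift:
  assumes "prime p" "A \<subseteq> Zn p" "B \<subseteq> Zn p" "A \<noteq> {}" "A \<noteq> Zn p" "card B \<ge> 2"
  shows "\<exists>e. A \<inter> (\<lambda>b. (b + e) mod int p) ` B \<noteq> {} \<and> \<not> (\<lambda>b. (b + e) mod int p) ` B \<subseteq> A"
proof (rule ccontr)
  assume "\<not> ?thesis"
  hence H: "(\<lambda>b. (b + e) mod int p) ` B \<subseteq> A" if "A \<inter> (\<lambda>b. (b + e) mod int p) ` B \<noteq> {}" for e
    using that by blast
  obtain b b' where b: "b \<in> B" "b' \<in> B" "b \<noteq> b'"
    using assms(6) card_le_Suc0_iff_eq[OF finite_subset[OF assms(3)]] by force
  have ndvd: "\<not> int p dvd b' - b"
  proof
    assume "int p dvd b' - b"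
    hence "b' mod int p = b mod int p" by (simp add: mod_eq_dvd_iff)
    moreover have "b \<in> Zn p" "b' \<in> Zn p" using b assms(3) by blast+
    ultimately show False using b(3) by simp
  qed
  have "(y + (b' - b)) mod int p \<in> A" if y: "y \<in> A" for y
  proof -
    have "(b + (y - b)) mod int p = y" using y assms(2) by auto
    hence "A \<inter> (\<lambda>c. (c + (y - b)) mod int p) ` B \<noteq> {}"
      using y b(1) by force
    hence "(b' + (y - b)) mod int p \<in> A"
      using H b(2) by blast
    thus ?thesis by (simp add: algebra_simps)
  qed
  with closed_under_shift_imp_all[OF assms(1,2) _ ndvd] assms(4,5) show False by blast
qed

text \<open>Let C be a translate of B that meets A without lying in it, and i the size of the
  intersection, so that i < |B|. For t <= i the pair of union and intersection already suffices. For
  t > i no sum has more than i representations by that pair, so it contributes its full i |A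
  \<union> C|, and the two differences are used with t - i in place of t.\<close>

theorem Pollard:
  assumes "prime p" "A \<subseteq> Zn p" "B \<subseteq> Zn p" "t \<le> card A" "t \<le> card B"
  shows "t * min p (card A + card B - t) \<le> (\<Sum>z\<in>Zn p. min t (reps p A B z))"
  using assms(2-)
proof (induction "card B" arbitrary: A B t rule: less_induct)
  case less
  have p: "p > 0" using assms(1) prime_gt_0_nat by blast
  have fin: "finite A" "finite B" using less.prems finite_subset by blast+
  consider "t = 0" | "t = card B" | "A = Zn p" | "0 < t" "t < card B" "A \<noteq> Zn p"
    using less.prems by linarith
  thus ?case
  proof cases
    case 1
    thus ?thesis by simp
  next
    case 2
    have "(\<Sum>z\<in>Zn p. min t (reps p A B z)) = card A * card B"
      using reps_le_right[OF p less.prems(1,2)] sum_reps[OF p less.prems(1,2)] 2 by (simp add: min_absorb2)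
    thus ?thesis using 2 by (simp add: min.coboundedI2)
  next
    case 3
    have "reps p A B z = card B" for z
    proof -
      have "{a \<in> Zn p. (z - a) mod int p \<in> B} = (\<lambda>b. (z - b) mod int p) ` B"
      proof (intro equalityI subsetI)
        fix a assume a: "a \<in> {a \<in> Zn p. (z - a) mod int p \<in> B}"
        hence "a = (z - (z - a) mod int p) mod int p" using diff_mod_cancel[of a p z] by simp
        thus "a \<in> (\<lambda>b. (z - b) mod int p) ` B" using a by blast
      next
        fix a assume "a \<in> (\<lambda>b. (z - b) mod int p) ` B"
        then obtain b where b: "b \<in> B" "a = (z - b) mod int p" by auto
        hence "(z - a) mod int p = b" using diff_mod_cancel[of b p z] less.prems by auto
        thus "a \<in> {a \<in> Zn p. (z - a) mod int p \<in> B}" using b p by simp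
      qed
      thus ?thesis
        using 3 inj_on_diff_mod[OF p less.prems(2), of z] by (simp add: reps_def card_image)
    qed
    thus ?thesis using less.prems(4) by simp
  next
    case 4
    obtain e where e: "A \<inter> (\<lambda>b. (b + e) mod int p) ` B \<noteq> {}"
        "\<not> (\<lambda>b. (b + e) mod int p) ` B \<subseteq> A"
      using exists_proper_shift[OF assms(1) less.prems(1,2)] 4 less.prems(3) by force
    define C where "C = (\<lambda>b. (b + e) mod int p) ` B"
    have C: "C \<subseteq> Zn p" using p by (auto simp: C_def)
    have "inj_on (\<lambda>b. (b + e) mod int p) B"
      using inj_on_affine_mod[of p 1 e] p less.prems(2) by (auto intro: inj_on_subset)
    hence cardC: "card C = card B" by (simp add: C_def card_image)
    have finC: "finite C" using fin by (simp add: C_def)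
    define i where "i = card (A \<inter> C)"
    have i_pos: "i > 0" using e finC by (simp add: i_def C_def card_gt_0_iff)
    have i_less: "i < card B"
      unfolding i_def cardC[symmetric] using e finC by (intro psubset_card_mono) (auto simp: C_def)
    have cardU: "card (A \<union> C) + i = card A + card B"
      using card_Un_Int[OF fin(1) finC] by (simp add: i_def cardC)
    have cardD: "card (A - C) + i = card A" "card (C - A) + i = card B"
      using card_Diff_subset_Int[of A C] card_Diff_subset_Int[of C A] fin finC
        card_mono[OF fin(1), of "A \<inter> C"] card_mono[OF finC, of "A \<inter> C"]
      by (simp_all add: i_def Int_commute cardC)
    have U_le: "card (A \<union> C) \<le> p"
      using card_mono[of "Zn p" "A \<union> C"] less.prems(1) C by simp
    have shift: "(\<Sum>z\<in>Zn p. min t (reps p A B z)) = (\<Sum>z\<in>Zn p. min t (reps p A C z))"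
      unfolding C_def using sum_reps_shift[OF p less.prems(1,2)] by simp
    have tr: "reps p A C z = reps p (A \<union> C) (A \<inter> C) z + reps p (A - C) (C - A) z" for z
      using reps_transform[OF p less.prems(1) C] .
    show ?thesis
    proof (cases "t \<le> i")
      case True
      have "t * min p (card (A \<union> C) + card (A \<inter> C) - t) \<le> (\<Sum>z\<in>Zn p. min t (reps p (A \<union> C) (A \<inter> C) z))"
      proof (rule less.hyps)
        show "t \<le> card (A \<union> C)"
          using less.prems(3) card_mono[of "A \<union> C" A] fin finC by simp
      qed (use i_less less.prems(1) C True in \<open>auto simp: i_def[symmetric]\<close>)
      also have "\<dots> \<le> (\<Sum>z\<in>Zn p. min t (reps p A C z))"
        by (intro sum_mono) (simp add: tr)
      finally show ?thesis using cardU by (simp add: shift i_def)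
    next
      case False
      have IH: "(t - i) * min p (card (A - C) + card (C - A) - (t - i))
          \<le> (\<Sum>z\<in>Zn p. min (t - i) (reps p (A - C) (C - A) z))"
        using i_pos cardD less.prems C False
        by (intro less.hyps) auto
      have le_i: "reps p (A \<union> C) (A \<inter> C) z \<le> i" for z
        unfolding i_def by (rule reps_le_right[OF p]) (use less.prems C in auto)
      have "A \<inter> C \<subseteq> Zn p" "A \<union> C \<subseteq> Zn p" using C less.prems(1) by blast+
      hence "card (A \<union> C) * i + (\<Sum>z\<in>Zn p. min (t - i) (reps p (A - C) (C - A) z))
          = (\<Sum>z\<in>Zn p. reps p (A \<union> C) (A \<inter> C) z + min (t - i) (reps p (A - C) (C - A) z))"
        using sum_reps[OF p, of "A \<union> C" "A \<inter> C"]
        by (simp add: sum.distrib i_def)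
      also have "\<dots> \<le> (\<Sum>z\<in>Zn p. min t (reps p A C z))"
      proof (rule sum_mono)
        fix z
        show "reps p (A \<union> C) (A \<inter> C) z + min (t - i) (reps p (A - C) (C - A) z) \<le> min t (reps p A C z)"
          using le_i[of z] False tr[of z] by simp
      qed
      finally have sum: "card (A \<union> C) * i + (t - i) * min p (card (A - C) + card (C - A) - (t - i))
          \<le> (\<Sum>z\<in>Zn p. min t (reps p A B z))"
        using IH shift by linarith
      define u where "u = card (A \<union> C)"
      have 1: "card (A - C) + card (C - A) - (t - i) = u - t"
        using cardU cardD False by (simp add: u_def)
      have ut: "t \<le> u" "u \<le> p"
        using card_mono[of "A \<union> C" A] fin finC less.prems(3) U_le by (auto simp: u_def)
      \<comment> \<open>As u <= p, the minimum is u - t. With u = t + k and t = i + l both sides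
        become t (i + k).\<close>
      have "u * i + (t - i) * min p (u - t) = t * (u + i - t)"
      proof -
        obtain k where k: "u = t + k" using ut(1) le_Suc_ex by blast
        obtain l where l: "t = i + l" using False by (metis le_Suc_ex nat_le_linear)
        have "min p (u - t) = k" using ut k by simp
        thus ?thesis unfolding k l by (simp add: algebra_simps)
      qed
      moreover have "card A + card B - t = u + i - t" using cardU by (simp add: u_def)
      ultimately show ?thesis
        using sum unfolding 1 u_def[symmetric]
        by (metis (no_types, lifting) min.cobounded2 mult_le_mono2 order_trans)
    qed
  qed
qed

section \<open>Containers for sum-free triplets\<close>

lemma sum_power_card_Pow:
  fixes x :: real
  assumes "finite V"
  shows "(\<Sum>F\<in>Pow V. x ^ card F) = (1 + x) ^ card V"
  using assms
proof (induction V rule: finite_induct)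
  case (insert v V)
  have "(\<Sum>F\<in>Pow (insert v V). x ^ card F) = (\<Sum>F\<in>Pow V. x ^ card F + x ^ card (insert v F))"
    using insert.hyps by (rule sum_Pow_insert)
  also have "\<dots> = (\<Sum>F\<in>Pow V. (1 + x) * x ^ card F)"
  proof (rule sum.cong)
    fix F assume "F \<in> Pow V"
    hence "finite F" "v \<notin> F" using insert.hyps finite_subset by auto
    thus "x ^ card F + x ^ card (insert v F) = (1 + x) * x ^ card F"
      by (simp add: algebra_simps)
  qed simp
  also have "\<dots> = (1 + x) ^ card (insert v V)"
    using insert by (simp flip: sum_distrib_left)
  finally show ?case .
qed simp

text \<open>Markov's inequality for the weights \<open>x ^ card F\<close>: each counted set weighs
  at least \<open>x powr m\<close>, and all subsets together weigh (1 + x)^|V|.\<close>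

lemma card_small_subsets_le:
  fixes x m :: real
  assumes "finite V" "0 < x" "x \<le> 1"
  shows "real (card {F. F \<subseteq> V \<and> real (card F) \<le> m}) \<le> x powr (- m) * (1 + x) ^ card V"
proof -
  have "real (card {F. F \<subseteq> V \<and> real (card F) \<le> m}) * x powr m
      = (\<Sum>F | F \<subseteq> V \<and> real (card F) \<le> m. x powr m)"
    by simp
  also have "\<dots> \<le> (\<Sum>F | F \<subseteq> V \<and> real (card F) \<le> m. x ^ card F)"
  proof (rule sum_mono)
    fix F assume "F \<in> {F. F \<subseteq> V \<and> real (card F) \<le> m}"
    hence "x powr m \<le> x powr real (card F)"
      using assms by (intro powr_mono') auto
    thus "x powr m \<le> x ^ card F" using assms by (simp add: powr_realpow)
  qed
  also have "\<dots> \<le> (\<Sum>F\<in>Pow V. x ^ card F)"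
    using assms by (intro sum_mono2) auto
  finally show ?thesis
    using assms by (simp add: sum_power_card_Pow powr_minus field_simps)
qed

text \<open>In the preceding bound, x is first taken so small that 1 + x is at most the square root
  of \<gamma>, and then \<theta> so small that \<open>x powr (- \<theta>)\<close> is too.\<close>

lemma few_small_subsets:
  fixes \<gamma> :: real
  assumes "\<gamma> > 1"
  obtains \<theta> where "\<theta> > 0"
    "\<And>p. real (card {F. F \<subseteq> Zn p \<and> real (card F) \<le> \<theta> * real p}) \<le> \<gamma> ^ p"
proof -
  define x where "x = min 1 (sqrt \<gamma> - 1)"
  have x: "0 < x" "x \<le> 1" "1 + x \<le> sqrt \<gamma>"
    using assms by (auto simp: x_def)
  \<comment> \<open>The summand 1 keeps the denominator positive when x = 1.\<close>
  define \<theta> where "\<theta> = ln (sqrt \<gamma>) / (1 - ln x)"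
  have lnx: "1 - ln x > 0" using x by (smt (verit) ln_le_zero_iff)
  have \<theta>: "\<theta> > 0" unfolding \<theta>_def using lnx assms by (intro divide_pos_pos) auto
  have "\<theta> * (- ln x) \<le> \<theta> * (1 - ln x)" by (rule mult_left_mono) (use \<theta> in auto)
  also have "\<dots> = ln (sqrt \<gamma>)" using lnx by (simp add: \<theta>_def)
  finally have "x powr (- \<theta>) \<le> sqrt \<gamma>"
    using x assms ln_ge_iff[of "sqrt \<gamma>" "- \<theta> * ln x"] by (simp add: powr_def)
  have "real (card {F. F \<subseteq> Zn p \<and> real (card F) \<le> \<theta> * real p}) \<le> \<gamma> ^ p" for p
  proof -
    have "real (card {F. F \<subseteq> Zn p \<and> real (card F) \<le> \<theta> * real p})
        \<le> x powr (- (\<theta> * real p)) * (1 + x) ^ card (Zn p)"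
      by (rule card_small_subsets_le) (use x in auto)
    also have "x powr (- (\<theta> * real p)) = (x powr (- \<theta>)) ^ p"
      using x by (simp add: powr_powr flip: powr_realpow)
    also have "(x powr (- \<theta>)) ^ p * (1 + x) ^ card (Zn p) \<le> sqrt \<gamma> ^ p * sqrt \<gamma> ^ p"
      using \<open>x powr (- \<theta>) \<le> sqrt \<gamma>\<close> x assms
      by (auto intro!: mult_mono power_mono)
    also have "\<dots> = \<gamma> ^ p"
      using assms by (simp flip: power_mult_distrib)
    finally show ?thesis .
  qed
  with \<theta> that show ?thesis by blast
qed

section \<open>The container method\<close>

definition solutions :: "nat \<Rightarrow> int set \<Rightarrow> int set \<Rightarrow> int set \<Rightarrow> (int \<times> int) set" where
  "solutions p A B C = {(a, b) \<in> A \<times> B. (a + b) mod int p \<in> C}"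

definition contained :: "nat \<Rightarrow> int set \<times> int set \<times> int set \<Rightarrow> (int set \<times> int set \<times> int set) set" where
  "contained p = (\<lambda>(A', B', C'). {(A, B, C) \<in> free_triples p. A \<subseteq> A' \<and> B \<subseteq> B' \<and> C \<subseteq> C'})"

definition total_size :: "int set \<times> int set \<times> int set \<Rightarrow> nat" where
  "total_size = (\<lambda>(A, B, C). card A + card B + card C)"

definition in_Zn :: "nat \<Rightarrow> int set \<times> int set \<times> int set \<Rightarrow> bool" where
  "in_Zn p = (\<lambda>(A, B, C). A \<subseteq> Zn p \<and> B \<subseteq> Zn p \<and> C \<subseteq> Zn p)"

definition num_solutions :: "nat \<Rightarrow> int set \<times> int set \<times> int set \<Rightarrow> nat" where
  "num_solutions p = (\<lambda>(A, B, C). card (solutions p A B C))"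

lemma finite_subset_Zn: "X \<subseteq> Zn p \<Longrightarrow> finite X"
  by (rule finite_subset) auto

lemma card_contained_le:
  assumes "in_Zn p c"
  shows "card (contained p c) \<le> 2 ^ total_size c"
proof -
  obtain A B C where c: "c = (A, B, C)" by (cases c)
  have fin: "finite A" "finite B" "finite C"
    using assms finite_subset by (auto simp: in_Zn_def c)
  have "card (contained p c) \<le> card (Pow A \<times> Pow B \<times> Pow C)"
    using fin by (intro card_mono) (auto simp: contained_def c)
  thus ?thesis using fin by (simp add: c total_size_def card_cartesian_product card_Pow power_add mult_ac)
qed

text \<open>If the box still has many solutions, then its elements of \<open>A0\<close> of high degree are many. Either at
  most \<open>K\<close> of them lie in \<open>A\<close>, and naming these removes all others; or \<open>K\<close> of them, \<open>T\<close>, do, and then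
  \<open>(B, C)\<close> is independent in a dense graph of maximal degree \<open>K\<close>, where naming a small \<open>F \<subseteq> B\<close> removes
  a positive proportion of \<open>B0\<close> or \<open>C0\<close>.\<close>

locale container_round =
  fixes p :: nat and \<epsilon> :: real and K :: nat and A0 B0 C0 :: "int set"
  assumes p_pos: "p > 0" and eps: "\<epsilon> > 0" and K_pos: "K > 0" and K_small: "4 * real K \<le> \<epsilon> * real p"
    and sub: "A0 \<subseteq> Zn p" "B0 \<subseteq> Zn p" "C0 \<subseteq> Zn p"
    and many: "\<epsilon> * real p ^ 2 \<le> real (card (solutions p A0 B0 C0))"
begin

definition deg :: "int \<Rightarrow> nat" where
  "deg a = card {b \<in> B0. (a + b) mod int p \<in> C0}"

definition high :: "int set" where
  "high = {a \<in> A0. real (deg a) \<ge> \<epsilon> * real p / 2}"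

text \<open>The elements of \<open>C0\<close> that cannot lie in C once T is known to lie in A and F
  in B.\<close>

definition nbh :: "int set \<Rightarrow> int set \<Rightarrow> int set" where
  "nbh T F = C0 \<inter> sumset p T F"

text \<open>T of size K produces at least K \<epsilon> p / 2 edges between \<open>B0\<close> and
  \<open>C0\<close>. With this threshold the elements of \<open>low\<close> account for at most a
  quarter of them.\<close>

definition thr :: real where "thr = real K * \<epsilon> / 8"

text \<open>The elements whose remaining neighbours are too few to extend a maximal fingerprint; B
  is confined to them.\<close>

definition low :: "int set \<Rightarrow> int set \<Rightarrow> int set" where
  "low T F = {b \<in> B0. real (card {a \<in> T. (a + b) mod int p \<in> C0 - nbh T F}) < thr}"

lemma fin: "finite A0" "finite B0" "finite C0" "finite high"
proof -
  show "finite A0" "finite B0" "finite C0"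
    using sub by (blast intro: finite_subset_Zn)+
  thus "finite high" by (simp add: high_def)
qed

lemma card_Zn_sub: "X \<subseteq> Zn p \<Longrightarrow> card X \<le> p"
  using card_mono[of "Zn p" X] by simp

lemma inj_add: "T \<subseteq> Zn p \<Longrightarrow> inj_on (\<lambda>a. (a + b) mod int p) T"
  using inj_on_affine_mod[of p 1 b] p_pos by (auto intro: inj_on_subset)

text \<open>Elements of low degree carry at most \<epsilon> p^2 / 2 solutions. The other half rests
  on elements of high degree, each with at most p solutions.\<close>

lemma card_high: "\<epsilon> * real p / 2 \<le> real (card high)"
proof -
  have "solutions p A0 B0 C0 = (SIGMA a : A0. {b \<in> B0. (a + b) mod int p \<in> C0})"
    by (auto simp: solutions_def)
  hence "real (card (solutions p A0 B0 C0)) = (\<Sum>a\<in>A0. real (deg a))"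
    using fin by (simp add: card_SigmaI deg_def)
  also have "\<dots> = (\<Sum>a\<in>A0 - high. real (deg a)) + (\<Sum>a\<in>high. real (deg a))"
    using fin by (intro sum.subset_diff) (auto simp: high_def)
  also have "\<dots> \<le> (\<Sum>a\<in>A0 - high. \<epsilon> * real p / 2) + (\<Sum>a\<in>high. real p)"
  proof (intro add_mono sum_mono)
    fix a
    show "a \<in> A0 - high \<Longrightarrow> real (deg a) \<le> \<epsilon> * real p / 2"
      by (auto simp: high_def)
    have "deg a \<le> card B0"
      unfolding deg_def using fin by (intro card_mono) auto
    thus "real (deg a) \<le> real p" using card_Zn_sub[OF sub(2)] by simp
  qed
  also have "\<dots> \<le> real p * (\<epsilon> * real p / 2) + real (card high) * real p"
  proof -
    have "A0 - high \<subseteq> Zn p" using sub by blast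
    thus ?thesis using card_Zn_sub[of "A0 - high"] eps by (auto intro!: mult_right_mono)
  qed
  finally have "real p * (\<epsilon> * real p / 2) \<le> real p * real (card high)"
    using many by (simp add: power2_eq_square algebra_simps)
  thus ?thesis using p_pos by simp
qed

text \<open>The high elements, at least \<epsilon> p / 2, are removed, and at most K <= \<epsilon> p
  / 4 named ones are put back.\<close>

lemma drop_first:
  assumes "T \<subseteq> Zn p" "card T \<le> K"
  shows "real (total_size ((A0 - high) \<union> T, B0, C0)) + \<epsilon> * real p / 4 \<le> real (total_size (A0, B0, C0))"
proof -
  have "card ((A0 - high) \<union> T) \<le> card (A0 - high) + card T"
    by (rule card_Un_le)
  moreover have "card (A0 - high) + card high = card A0"
    using card_Diff_subset[of high A0] card_mono[of A0 high] fin by (auto simp: high_def)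
  ultimately have "real (card ((A0 - high) \<union> T)) + real (card high) \<le> real (card A0) + real K"
    using assms(2) by linarith
  thus ?thesis
    using card_high K_small by (simp add: total_size_def)
qed

text \<open>Each removed element of \<open>B0\<close> or \<open>C0\<close> meets at most K of the
  edges labelled by T. The edges that survive at both ends number at most K \<epsilon> p / 8, so the
  other 3 K \<epsilon> p / 8 force the removal of at least 3 \<epsilon> p / 8 elements.\<close>

lemma drop_second:
  assumes "T \<subseteq> high" "card T = K"
  shows "real (total_size (A0, low T F, C0 - nbh T F)) + \<epsilon> * real p / 4 \<le> real (total_size (A0, B0, C0))"
proof -
  have T: "T \<subseteq> A0" "T \<subseteq> Zn p"
    using assms sub by (auto simp: high_def)
  hence "finite T" by (blast intro: finite_subset_Zn)
  note T = T this
  define Nb where "Nb = nbh T F"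
  define L where "L = low T F"
  have L: "L \<subseteq> B0" "finite L" using fin by (auto simp: L_def low_def)
  have Nb: "Nb \<subseteq> C0" "finite Nb" using fin by (auto simp: Nb_def nbh_def)
  define E where "E = (SIGMA a : T. {b \<in> B0. (a + b) mod int p \<in> C0})"
  define E1 where "E1 = T \<times> (B0 - L)"
  define E2 where "E2 = {(a, b) \<in> T \<times> B0. (a + b) mod int p \<in> Nb}"
  define E3 where "E3 = (SIGMA b : L. {a \<in> T. (a + b) mod int p \<in> C0 - Nb})"
  have "real K * (\<epsilon> * real p / 2) = (\<Sum>a\<in>T. \<epsilon> * real p / 2)"
    using assms by simp
  also have "\<dots> \<le> (\<Sum>a\<in>T. real (deg a))"
    using assms by (intro sum_mono) (auto simp: high_def)
  also have "\<dots> = real (card E)"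
    using T fin by (simp add: E_def card_SigmaI deg_def)
  finally have 1: "real K * (\<epsilon> * real p / 2) \<le> real (card E)" .
  have finE: "finite E1" "finite E2" "finite E3"
    using T fin L by (auto simp: E1_def E2_def E3_def intro: finite_subset[of _ "T \<times> B0"])
  have "E \<subseteq> E1 \<union> (E2 \<union> prod.swap ` E3)"
    by (auto simp: E_def E1_def E2_def E3_def image_iff)
  hence "card E \<le> card (E1 \<union> (E2 \<union> prod.swap ` E3))"
    using finE by (intro card_mono) auto
  also have "\<dots> \<le> card E1 + (card E2 + card (prod.swap ` E3))"
    by (intro order_trans[OF card_Un_le] add_left_mono card_Un_le)
  also have "card (prod.swap ` E3) \<le> card E3"
    using finE by (rule_tac card_image_le)
  finally have 2: "card E \<le> card E1 + (card E2 + card E3)" by simp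
  have c1: "card E1 = K * card (B0 - L)"
    using assms by (simp add: E1_def card_cartesian_product)
  have c2: "card E2 \<le> K * card Nb"
  proof -
    have "card E2 \<le> card (T \<times> Nb)"
    proof (rule card_inj_on_le)
      show "inj_on (\<lambda>(a, b). (a, (a + b) mod int p)) E2"
      proof (rule inj_onI)
        fix x y assume xy: "x \<in> E2" "y \<in> E2"
          "(case x of (a, b) \<Rightarrow> (a, (a + b) mod int p)) = (case y of (a, b) \<Rightarrow> (a, (a + b) mod int p))"
        obtain a b a' b' where [simp]: "x = (a, b)" "y = (a', b')" by (cases x; cases y)
        have "a' = a" "(b + a) mod int p = (b' + a) mod int p"
          using xy(3) by (auto simp: add.commute)
        moreover have "b \<in> Zn p" "b' \<in> Zn p" using sub xy by (auto simp: E2_def)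
        ultimately show "x = y"
          using inj_on_eq_iff[OF inj_add[of "Zn p" a], of b b'] by simp
      qed
    qed (use T Nb in \<open>auto simp: E2_def\<close>)
    thus ?thesis using assms by (simp add: card_cartesian_product)
  qed
  have c3: "real (card E3) \<le> real p * thr"
  proof -
    have "real (card E3) = (\<Sum>b\<in>L. real (card {a \<in> T. (a + b) mod int p \<in> C0 - Nb}))"
      using L T by (simp add: E3_def card_SigmaI)
    also have "\<dots> \<le> (\<Sum>b\<in>L. thr)"
      by (intro sum_mono) (auto simp: L_def low_def Nb_def less_imp_le)
    also have "\<dots> \<le> real p * thr"
      using card_Zn_sub[of L] L sub eps by (auto simp: thr_def intro!: mult_right_mono)
    finally show ?thesis .
  qed
  have "real K * (\<epsilon> * real p / 2) \<le> real K * (real (card (B0 - L)) + real (card Nb) + \<epsilon> * real p / 8)"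
  proof -
    have "real (card E) \<le> real (K * card (B0 - L)) + real (K * card Nb) + real p * thr"
      using 2 c1 c2 c3 by linarith
    thus ?thesis using 1 by (simp add: thr_def algebra_simps)
  qed
  hence "\<epsilon> * real p / 2 \<le> real (card (B0 - L)) + real (card Nb) + \<epsilon> * real p / 8"
    using K_pos by (simp only: mult_le_cancel_left_pos of_nat_0_less_iff)
  moreover have "card (B0 - L) + card L = card B0"
    using card_Diff_subset[of L B0] card_mono[of B0 L] fin L by auto
  moreover have "card (C0 - Nb) + card Nb = card C0"
    using card_Diff_subset[of Nb C0] card_mono[of C0 Nb] fin Nb by auto
  moreover have "\<epsilon> * real p \<ge> 0" using eps by simp
  ultimately show ?thesis
    unfolding total_size_def L_def[symmetric] Nb_def[symmetric] by simp
qed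

text \<open>A largest \<open>F\<close> each of whose elements excludes many new elements of \<open>C0\<close>.\<close>

lemma fingerprint:
  assumes "(A, B, C) \<in> contained p (A0, B0, C0)" "T \<subseteq> A" "card T = K"
  obtains F where "F \<subseteq> Zn p" "real (card F) * thr \<le> real p"
    "(A, B, C) \<in> contained p (A0, low T F, C0 - nbh T F)"
proof -
  have ABC: "(A, B, C) \<in> free_triples p" "A \<subseteq> A0" "B \<subseteq> B0" "C \<subseteq> C0"
    using assms by (auto simp: contained_def)
  have T: "T \<subseteq> Zn p" using assms ABC sub by blast
  hence "finite T" by (blast intro: finite_subset_Zn)
  note T = T this
  have thr: "thr > 0" using K_pos eps by (simp add: thr_def)
  have finB: "finite B" using ABC fin finite_subset by blast
  define FF where "FF = {F. F \<subseteq> B \<and> real (card F) * thr \<le> real (card (nbh T F))}"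
  have "finite FF" using finB by (auto simp: FF_def)
  moreover have "{} \<in> FF" by (auto simp: FF_def)
  ultimately have "Max (card ` FF) \<in> card ` FF" "\<forall>G\<in>FF. card G \<le> Max (card ` FF)"
    by (auto intro!: Max_in)
  then obtain F where F: "F \<in> FF" "\<And>G. G \<in> FF \<Longrightarrow> card G \<le> card F"
    by auto
  have FB: "F \<subseteq> B" "finite F" using F finB finite_subset by (auto simp: FF_def)
  have "B \<subseteq> low T F"
  proof
    fix b assume b: "b \<in> B"
    show "b \<in> low T F"
    proof (rule ccontr)
      assume "b \<notin> low T F"
      \<comment> \<open>S is found to inject into the new neighbours that b would add. It has at
        least \<open>thr\<close> elements, so \<open>insert b F\<close> would belong to
        \<open>FF\<close>, against the maximality of F.\<close>
      define S where "S = {a \<in> T. (a + b) mod int p \<in> C0 - nbh T F}"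
      have S: "thr \<le> real (card S)"
        using \<open>b \<notin> low T F\<close> b ABC by (auto simp: low_def S_def)
      have finS: "finite S" using T by (auto simp: S_def)
      have bF: "b \<notin> F"
      proof
        assume "b \<in> F"
        hence "S = {}" by (auto simp: S_def nbh_def sumset_def)
        thus False using S thr by simp
      qed
      have inj: "inj_on (\<lambda>a. (a + b) mod int p) S"
        by (rule inj_add) (use T in \<open>auto simp: S_def\<close>)
      have "nbh T F \<union> (\<lambda>a. (a + b) mod int p) ` S \<subseteq> nbh T (insert b F)"
        by (auto simp: nbh_def sumset_def S_def)
      hence "card (nbh T F \<union> (\<lambda>a. (a + b) mod int p) ` S) \<le> card (nbh T (insert b F))"
        using fin by (intro card_mono) (auto simp: nbh_def)
      moreover have "card (nbh T F \<union> (\<lambda>a. (a + b) mod int p) ` S) = card (nbh T F) + card S"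
        using fin finS inj by (subst card_Un_disjoint) (auto simp: nbh_def S_def card_image)
      moreover have "real (card F) * thr \<le> real (card (nbh T F))"
        using F(1) by (simp add: FF_def)
      ultimately have "real (card (insert b F)) * thr \<le> real (card (nbh T (insert b F)))"
        using S bF FB by (simp add: algebra_simps)
      hence "insert b F \<in> FF" using b FB by (simp add: FF_def)
      from F(2)[OF this] show False using bF FB by simp
    qed
  qed
  moreover have "C \<subseteq> C0 - nbh T F"
  proof -
    have "sumset p A B \<inter> C = {}"
      using ABC(1) by (auto simp: free_triples_def free_pairs_def)
    moreover have "nbh T F \<subseteq> sumset p A B"
      using sumset_mono[of T A F B p] assms FB by (auto simp: nbh_def)
    ultimately show ?thesis using ABC by blast
  qed
  moreover have "real (card F) * thr \<le> real p"
  proof -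
    have "card (nbh T F) \<le> p" using sub by (intro card_Zn_sub) (auto simp: nbh_def)
    thus ?thesis using F(1) by (auto simp: FF_def)
  qed
  moreover have "F \<subseteq> Zn p" using FB ABC sub by blast
  ultimately show ?thesis
    using that[of F] ABC by (auto simp: contained_def)
qed

text \<open>\<open>GG\<close> is a common reservoir for the named sets T and the fingerprints F. A
  box depends only on T or on the pair (T, F), which bounds the number of boxes independently of how
  many triplets they hold.\<close>

lemma containers:
  assumes G: "\<And>X. X \<subseteq> Zn p \<Longrightarrow> card X \<le> K \<or> real (card X) * thr \<le> real p \<Longrightarrow> X \<in> GG"
    and finG: "finite GG"
  obtains CC where "finite CC" "card CC \<le> 2 * (card GG)\<^sup>2"
    "contained p (A0, B0, C0) \<subseteq> (\<Union>c\<in>CC. contained p c)"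
    "\<And>c. c \<in> CC \<Longrightarrow> in_Zn p c \<and> real (total_size c) + \<epsilon> * real p / 4 \<le> real (total_size (A0, B0, C0))"
proof -
  define g1 where "g1 = (\<lambda>T. ((A0 - high) \<union> T, B0, C0))"
  define g2 where "g2 = (\<lambda>(T, F). (A0, low T F, C0 - nbh T F))"
  define good where "good = (\<lambda>c. in_Zn p c \<and> real (total_size c) + \<epsilon> * real p / 4 \<le> real (total_size (A0, B0, C0)))"
  \<comment> \<open>Arbitrary pairs from \<open>GG\<close> need not shrink the box; the filter keeps
    those that do, and those arising from an actual triplet always pass it.\<close>
  define CC where "CC = {c \<in> g1 ` GG \<union> g2 ` (GG \<times> GG). good c}"
  have finU: "finite (g1 ` GG \<union> g2 ` (GG \<times> GG))" using finG by simp
  show ?thesis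
  proof (rule that[of CC])
    show "finite CC" using finU by (simp add: CC_def)
    have "card CC \<le> card (g1 ` GG \<union> g2 ` (GG \<times> GG))"
      using finU by (intro card_mono) (auto simp: CC_def)
    also have "\<dots> \<le> card (g1 ` GG) + card (g2 ` (GG \<times> GG))"
      by (rule card_Un_le)
    also have "\<dots> \<le> card GG + card (GG \<times> GG)"
      using finG by (intro add_mono card_image_le) auto
    also have "\<dots> \<le> 2 * (card GG)\<^sup>2"
      by (cases "card GG") (auto simp: card_cartesian_product power2_eq_square)
    finally show "card CC \<le> 2 * (card GG)\<^sup>2" .
    show "contained p (A0, B0, C0) \<subseteq> (\<Union>c\<in>CC. contained p c)"
    proof (rule subsetI)
      fix X assume X: "X \<in> contained p (A0, B0, C0)"
      obtain A B C where ABC: "X = (A, B, C)" by (cases X)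
      have sub': "(A, B, C) \<in> free_triples p" "A \<subseteq> A0" "B \<subseteq> B0" "C \<subseteq> C0"
        using X by (auto simp: contained_def ABC)
      have finA: "finite (A \<inter> high)" using fin by simp
      show "X \<in> (\<Union>c\<in>CC. contained p c)"
      proof (cases "card (A \<inter> high) \<le> K")
        case True
        have T: "A \<inter> high \<subseteq> Zn p" using sub' sub by blast
        have "good (g1 (A \<inter> high))"
          using drop_first[OF T True] T sub by (auto simp: good_def g1_def in_Zn_def)
        moreover have "A \<inter> high \<in> GG" using G T True by blast
        moreover have "X \<in> contained p (g1 (A \<inter> high))"
          using sub' by (auto simp: ABC contained_def g1_def)
        ultimately show ?thesis
          unfolding CC_def by (intro UN_I[of "g1 (A \<inter> high)"]) auto
      next
        case False
        then obtain T where T: "T \<subseteq> A \<inter> high" "card T = K"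
          by (meson nat_le_linear obtain_subset_with_card_n)
        obtain F where F: "F \<subseteq> Zn p" "real (card F) * thr \<le> real p"
            "(A, B, C) \<in> contained p (A0, low T F, C0 - nbh T F)"
          using fingerprint[of A B C T] X T ABC by auto
        have "T \<in> GG" "F \<in> GG" using G[of T] G[of F] T F sub' sub by auto
        moreover have "good (g2 (T, F))"
          using drop_second[of T F] T sub by (auto simp: good_def g2_def in_Zn_def low_def)
        moreover have "X \<in> contained p (g2 (T, F))"
          using F ABC by (simp add: g2_def)
        ultimately show ?thesis
          unfolding CC_def by (intro UN_I[of "g2 (T, F)"]) auto
      qed
    qed
  qed (auto simp: CC_def good_def)
qed

end

text \<open>Each round removes at least \<epsilon> p / 4 from the total size, so after at most j
  rounds every box has few solutions. The number of boxes is multiplied by at most the same factor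
  in each round.\<close>

lemma iterated_containers:
  fixes p K :: nat and \<epsilon> :: real
  assumes "p > 0" "\<epsilon> > 0" "K > 0" "4 * real K \<le> \<epsilon> * real p"
    and G: "\<And>X. X \<subseteq> Zn p \<Longrightarrow> card X \<le> K \<or> real (card X) * (real K * \<epsilon> / 8) \<le> real p \<Longrightarrow> X \<in> GG"
    and finG: "finite GG"
    and c: "in_Zn p c" "real (total_size c) < real j * (\<epsilon> * real p / 4)"
  shows "\<exists>CC. finite CC \<and> card CC \<le> (2 * (card GG)\<^sup>2) ^ j \<and> contained p c \<subseteq> (\<Union>c\<in>CC. contained p c) \<and>
    (\<forall>c\<in>CC. in_Zn p c \<and> real (num_solutions p c) < \<epsilon> * real p ^ 2)"
  using c
proof (induction j arbitrary: c)
  case 0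
  thus ?case by simp
next
  case (Suc j)
  have "{} \<in> GG" by (rule G) auto
  hence GG: "card GG \<ge> 1" using finG by (metis One_nat_def Suc_leI card_gt_0_iff empty_iff)
  show ?case
  proof (cases "real (num_solutions p c) < \<epsilon> * real p ^ 2")
    case True
    thus ?thesis
      using Suc.prems GG by (intro exI[of _ "{c}"]) auto
  next
    case False
    obtain A0 B0 C0 where c0: "c = (A0, B0, C0)" by (cases c)
    interpret container_round p \<epsilon> K A0 B0 C0
      by unfold_locales (use assms Suc.prems False in \<open>auto simp: c0 in_Zn_def num_solutions_def\<close>)
    obtain CC where CC: "finite CC" "card CC \<le> 2 * (card GG)\<^sup>2" "contained p c \<subseteq> (\<Union>c\<in>CC. contained p c)"
        "\<And>c'. c' \<in> CC \<Longrightarrow> in_Zn p c' \<and> real (total_size c') + \<epsilon> * real p / 4 \<le> real (total_size c)"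
      using containers[OF G finG] unfolding thr_def c0 by blast
    have "\<forall>c'\<in>CC. \<exists>DD. finite DD \<and> card DD \<le> (2 * (card GG)\<^sup>2) ^ j \<and> contained p c' \<subseteq> (\<Union>c\<in>DD. contained p c) \<and>
        (\<forall>c\<in>DD. in_Zn p c \<and> real (num_solutions p c) < \<epsilon> * real p ^ 2)"
    proof
      fix c' assume "c' \<in> CC"
      from CC(4)[OF this] show "\<exists>DD. finite DD \<and> card DD \<le> (2 * (card GG)\<^sup>2) ^ j \<and> contained p c' \<subseteq> (\<Union>c\<in>DD. contained p c) \<and>
        (\<forall>c\<in>DD. in_Zn p c \<and> real (num_solutions p c) < \<epsilon> * real p ^ 2)"
        using Suc.prems by (intro Suc.IH) (auto simp: algebra_simps)
    qed
    from bchoice[OF this] obtain D where "\<forall>c'\<in>CC. finite (D c') \<and> card (D c') \<le> (2 * (card GG)\<^sup>2) ^ j \<and>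
        contained p c' \<subseteq> (\<Union>c\<in>D c'. contained p c) \<and>
        (\<forall>c\<in>D c'. in_Zn p c \<and> real (num_solutions p c) < \<epsilon> * real p ^ 2)"
      by blast
    hence D: "finite (D c')" "card (D c') \<le> (2 * (card GG)\<^sup>2) ^ j"
        "contained p c' \<subseteq> (\<Union>c\<in>D c'. contained p c)"
        "\<And>c. c \<in> D c' \<Longrightarrow> in_Zn p c \<and> real (num_solutions p c) < \<epsilon> * real p ^ 2" if "c' \<in> CC" for c'
      using that by simp_all
    have "card (\<Union>c'\<in>CC. D c') \<le> (\<Sum>c'\<in>CC. card (D c'))"
      using CC(1) by (rule card_UN_le)
    also have "\<dots> \<le> card CC * (2 * (card GG)\<^sup>2) ^ j"
      using sum_bounded_above[of CC "\<lambda>c'. card (D c')"] D(2) by simp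
    also have "\<dots> \<le> (2 * (card GG)\<^sup>2) ^ Suc j"
      using CC(2) by simp
    finally have "card (\<Union>c'\<in>CC. D c') \<le> (2 * (card GG)\<^sup>2) ^ Suc j" .
    moreover have "contained p c \<subseteq> (\<Union>c\<in>\<Union>c'\<in>CC. D c'. contained p c)"
    proof
      fix x assume "x \<in> contained p c"
      then obtain c' where c': "c' \<in> CC" "x \<in> contained p c'" using CC(3) by blast
      then obtain c'' where "c'' \<in> D c'" "x \<in> contained p c''" using D(3)[of c'] by blast
      thus "x \<in> (\<Union>c\<in>\<Union>c'\<in>CC. D c'. contained p c)" using c' by blast
    qed
    moreover have "finite (\<Union>c'\<in>CC. D c')" using CC(1) D(1) by blast
    moreover have "\<forall>c\<in>\<Union>c'\<in>CC. D c'. in_Zn p c \<and> real (num_solutions p c) < \<epsilon> * real p ^ 2"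
      using D(4) by blast
    ultimately show ?thesis by blast
  qed
qed

text \<open>This is a robust Cauchy-Davenport theorem. In Pollard's sum with t close to \<delta> p,
  each z outside C contributes at most t, and all z in C together contribute no more than the
  solutions, fewer than t \<delta> p. Dividing by t bounds |A| + |B| - t by p - |C| + \<delta>
  p.\<close>

lemma total_size_few_solutions:
  fixes \<delta> :: real
  assumes "prime p" "in_Zn p (A, B, C)"
    and large: "\<delta> * real p \<le> real (card A)" "\<delta> * real p \<le> real (card B)" "\<delta> * real p \<le> real (card C)"
    and \<delta>: "0 < \<delta>" "2 \<le> \<delta> * real p"
    and few: "real (num_solutions p (A, B, C)) < \<delta>\<^sup>2 / 2 * real p ^ 2"
  shows "real (total_size (A, B, C)) \<le> (1 + 2 * \<delta>) * real p"
proof -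
  have p: "p > 0" using assms(1) prime_gt_0_nat by blast
  have sub: "A \<subseteq> Zn p" "B \<subseteq> Zn p" "C \<subseteq> Zn p" using assms(2) by (auto simp: in_Zn_def)
  have fin: "finite A" "finite B" "finite C" using sub finite_subset by blast+
  define t where "t = nat \<lfloor>\<delta> * real p\<rfloor>"
  have t: "real t \<le> \<delta> * real p" "\<delta> * real p / 2 \<le> real t"
    using \<delta> by (simp_all add: t_def) linarith+
  have tle: "t \<le> card A" "t \<le> card B" using t large by linarith+
  have "bij_betw (\<lambda>(z, a). (a, (z - a) mod int p)) (SIGMA z : C. {a \<in> A. (z - a) mod int p \<in> B}) (solutions p A B C)"
  proof (rule bij_betw_byWitness[where f' = "\<lambda>(a, b). ((a + b) mod int p, a)"])
    show "\<forall>x\<in>SIGMA z : C. {a \<in> A. (z - a) mod int p \<in> B}.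
        (case case x of (z, a) \<Rightarrow> (a, (z - a) mod int p) of (a, b) \<Rightarrow> ((a + b) mod int p, a)) = x"
      using sub by (auto simp: mod_add_right_eq)
    show "\<forall>x\<in>solutions p A B C. (case case x of (a, b) \<Rightarrow> ((a + b) mod int p, a) of (z, a) \<Rightarrow> (a, (z - a) mod int p)) = x"
      using sub by (auto simp: solutions_def mod_diff_left_eq)
    show "(\<lambda>(z, a). (a, (z - a) mod int p)) ` (SIGMA z : C. {a \<in> A. (z - a) mod int p \<in> B}) \<subseteq> solutions p A B C"
      using sub by (auto simp: solutions_def mod_add_right_eq)
    show "(\<lambda>(a, b). ((a + b) mod int p, a)) ` solutions p A B C \<subseteq> (SIGMA z : C. {a \<in> A. (z - a) mod int p \<in> B})"
      using sub by (auto simp: solutions_def mod_diff_left_eq)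
  qed
  from bij_betw_same_card[OF this] have nsol: "num_solutions p (A, B, C) = (\<Sum>z\<in>C. reps p A B z)"
    using fin by (simp add: num_solutions_def reps_def card_SigmaI)
  have "t * min p (card A + card B - t) \<le> (\<Sum>z\<in>Zn p. min t (reps p A B z))"
    by (rule Pollard) (use assms sub tle in auto)
  also have "\<dots> = (\<Sum>z\<in>Zn p - C. min t (reps p A B z)) + (\<Sum>z\<in>C. min t (reps p A B z))"
    using sub by (intro sum.subset_diff) auto
  also have "\<dots> \<le> (\<Sum>z\<in>Zn p - C. t) + (\<Sum>z\<in>C. reps p A B z)"
    by (intro add_mono sum_mono) auto
  also have "(\<Sum>z\<in>Zn p - C. t) = (p - card C) * t"
    using sub fin by (simp add: card_Diff_subset)
  finally have *: "t * min p (card A + card B - t) \<le> (p - card C) * t + num_solutions p (A, B, C)"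
    by (simp add: nsol)
  have Cp: "card C \<le> p" using card_mono[of "Zn p" C] sub by simp
  have "real t * (\<delta> * real p) \<ge> \<delta> * real p / 2 * (\<delta> * real p)"
    using t(2) \<delta> by (intro mult_right_mono) auto
  hence few': "real (num_solutions p (A, B, C)) < real t * (\<delta> * real p)"
    using few by (simp add: power2_eq_square algebra_simps)
  have tpos: "real t > 0" using t \<delta> by linarith
  have "real (t * min p (card A + card B - t)) < real ((p - card C) * t) + real t * (\<delta> * real p)"
    using * few' by linarith
  hence "real t * real (min p (card A + card B - t)) < real t * (real (p - card C) + \<delta> * real p)"
    unfolding of_nat_mult distrib_left by (simp only: mult.commute[of "real t"])
  hence "real (min p (card A + card B - t)) < real (p - card C) + \<delta> * real p"
    using tpos by simp
  hence "real (min p (card A + card B - t)) < real p - real (card C) + \<delta> * real p"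
    using Cp by (simp add: of_nat_diff)
  \<comment> \<open>As C has at least \<delta> p elements, the minimum cannot be p.\<close>
  moreover have "real (card C) - \<delta> * real p \<ge> 0" using large by simp
  ultimately have "real (card A + card B - t) < real p - real (card C) + \<delta> * real p"
    by (auto simp: min_def split: if_splits)
  thus ?thesis using tle t by (simp add: total_size_def of_nat_diff algebra_simps)
qed

definition large_triples :: "nat \<Rightarrow> real \<Rightarrow> (int set \<times> int set \<times> int set) set" where
  "large_triples p m = {(A, B, C) \<in> free_triples p. m \<le> real (card A) \<and> m \<le> real (card B) \<and> m \<le> real (card C)}"

text \<open>There are subexponentially few boxes up to any prescribed rate, and each box that
  contains a large triplet is itself large, hence has total size at most (1 + 2 \<delta>) p. The
  value of \<epsilon> is the number of solutions tolerated by
  \<open>total_size_few_solutions\<close>.\<close>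

lemma few_large_triples:
  fixes \<delta> \<beta> :: real
  assumes "\<delta> > 0" "\<beta> > 1 + 2 * \<delta>"
  shows "\<forall>\<^sub>F p in sequentially. prime p \<longrightarrow> real (card (large_triples p (\<delta> * real p))) \<le> 2 powr (\<beta> * real p)"
proof -
  define \<epsilon> where "\<epsilon> = \<delta>\<^sup>2 / 2"
  have \<epsilon>: "\<epsilon> > 0" using assms by (simp add: \<epsilon>_def)
  \<comment> \<open>The initial box has total size 3 p, and each round takes away \<epsilon> p /
    4.\<close>
  obtain j :: nat where j: "real j > 12 / \<epsilon>" using reals_Archimedean2 by blast
  have jpos: "real j > 0" using j \<epsilon> by (smt (verit) divide_pos_pos)
  define \<eta> where "\<eta> = (\<beta> - (1 + 2 * \<delta>)) / 2"
  have \<eta>: "\<eta> > 0" "\<beta> = 1 + 2 * \<delta> + 2 * \<eta>" using assms by (auto simp: \<eta>_def field_simps)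
  \<comment> \<open>With at most \<open>\<gamma> ^ p\<close> named sets there are at most (2
    \<gamma>^(2 p))^j = 2^j 2^(\<eta> p) boxes.\<close>
  define \<gamma> where "\<gamma> = 2 powr (\<eta> / (2 * real j))"
  have "\<gamma> > 1" using \<eta> jpos by (simp add: \<gamma>_def)
  then obtain \<theta> where \<theta>: "\<theta> > 0"
    "\<And>p. real (card {F. F \<subseteq> Zn p \<and> real (card F) \<le> \<theta> * real p}) \<le> \<gamma> ^ p"
    using few_small_subsets by blast
  \<comment> \<open>A fingerprint satisfies |F| K \<epsilon> / 8 <= p, and this K turns that into
    |F| <= \<theta> p.\<close>
  obtain K :: nat where K: "real K > 8 / (\<epsilon> * \<theta>)" using reals_Archimedean2 by blast
  have Kpos: "real K > 0" using K \<epsilon> \<theta> by (smt (verit) divide_pos_pos mult_pos_pos)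
  have ev: "\<forall>\<^sub>F p in sequentially. c \<le> real p" for c :: real
    using eventually_ge_at_top[of "nat \<lceil>c\<rceil>"] by eventually_elim linarith
  show ?thesis
    using ev[of "4 * real K / \<epsilon>"] ev[of "2 / \<delta>"] ev[of "real K / \<theta>"] ev[of "real j / \<eta>"]
  proof eventually_elim
    case (elim p)
    have p: "4 * real K \<le> \<epsilon> * real p" "2 \<le> \<delta> * real p" "real K \<le> \<theta> * real p" "real j \<le> \<eta> * real p"
      using elim \<epsilon> assms(1) \<theta> \<eta> by (simp_all add: field_simps)
    show ?case
    proof
      assume prime: "prime p"
      hence p0: "p > 0" using prime_gt_0_nat by blast
      define GG where "GG = {F. F \<subseteq> Zn p \<and> real (card F) \<le> \<theta> * real p}"
      have finG: "finite GG" by (simp add: GG_def)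
      have G: "X \<in> GG" if X: "X \<subseteq> Zn p" "card X \<le> K \<or> real (card X) * (real K * \<epsilon> / 8) \<le> real p" for X
      proof -
        have "real (card X) \<le> \<theta> * real p" if "real (card X) * (real K * \<epsilon> / 8) \<le> real p"
        proof -
          have "1 \<le> \<theta> * (real K * \<epsilon> / 8)" using K \<epsilon> \<theta>(1) by (simp add: field_simps)
          hence "real (card X) \<le> real (card X) * (\<theta> * (real K * \<epsilon> / 8))"
            using mult_left_mono[of 1 "\<theta> * (real K * \<epsilon> / 8)" "real (card X)"] by simp
          also have "\<dots> = \<theta> * (real (card X) * (real K * \<epsilon> / 8))" by simp
          also have "\<dots> \<le> \<theta> * real p" using that \<theta>(1) by (intro mult_left_mono) auto
          finally show ?thesis .
        qed
        moreover have "real (card X) \<le> \<theta> * real p" if "card X \<le> K" using that p by linarith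
        ultimately show ?thesis using X by (auto simp: GG_def)
      qed
      define c0 where "c0 = (Zn p, Zn p, Zn p)"
      have "real (total_size c0) = 3 * real p" by (simp add: c0_def total_size_def)
      also have "\<dots> < real j * (\<epsilon> * real p / 4)" using j \<epsilon> p0 by (simp add: field_simps)
      finally have "\<exists>CC. finite CC \<and> card CC \<le> (2 * (card GG)\<^sup>2) ^ j \<and> contained p c0 \<subseteq> (\<Union>c\<in>CC. contained p c) \<and>
          (\<forall>c\<in>CC. in_Zn p c \<and> real (num_solutions p c) < \<epsilon> * real p ^ 2)"
        using p0 \<epsilon> Kpos p G finG by (intro iterated_containers[of p \<epsilon> K]) (auto simp: c0_def in_Zn_def)
      then obtain CC where CC: "finite CC" "card CC \<le> (2 * (card GG)\<^sup>2) ^ j"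
          "contained p c0 \<subseteq> (\<Union>c\<in>CC. contained p c)"
          "\<And>c. c \<in> CC \<Longrightarrow> in_Zn p c" "\<And>c. c \<in> CC \<Longrightarrow> real (num_solutions p c) < \<epsilon> * real p ^ 2"
        by auto
      define L where "L = large_triples p (\<delta> * real p)"
      have LC: "L \<subseteq> (\<Union>c\<in>CC. contained p c \<inter> L)"
      proof
        fix x assume x: "x \<in> L"
        hence "x \<in> contained p c0"
          by (auto simp: L_def large_triples_def contained_def c0_def free_triples_def free_pairs_def)
        thus "x \<in> (\<Union>c\<in>CC. contained p c \<inter> L)" using CC(3) x by blast
      qed
      have finC: "finite (contained p c)" for c
        by (cases c, rule finite_subset[of _ "free_triples p"]) (auto simp: contained_def)
      have bound: "real (card (contained p c \<inter> L)) \<le> 2 powr ((1 + 2 * \<delta>) * real p)" if c: "c \<in> CC" for c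
      proof (cases "contained p c \<inter> L = {}")
        case False
        then obtain x where x: "x \<in> contained p c" "x \<in> L" by blast
        obtain A B C where abc: "x = (A, B, C)" by (cases x)
        obtain A' B' C' where c': "c = (A', B', C')" by (cases c)
        have sub: "A' \<subseteq> Zn p" "B' \<subseteq> Zn p" "C' \<subseteq> Zn p" using CC(4)[OF c] by (auto simp: c' in_Zn_def)
        have "card A \<le> card A'" "card B \<le> card B'" "card C \<le> card C'"
          using x sub by (auto simp: abc c' contained_def intro!: card_mono finite_subset_Zn)
        hence "real (total_size c) \<le> (1 + 2 * \<delta>) * real p"
          unfolding c' using x CC(4,5)[OF c] prime assms p
          by (intro total_size_few_solutions) (auto simp: abc c' L_def large_triples_def \<epsilon>_def)
        have "real (card (contained p c \<inter> L)) \<le> real (card (contained p c))"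
          by (intro of_nat_mono card_mono finC) auto
        also have "\<dots> \<le> real (2 ^ total_size c)"
          using card_contained_le[OF CC(4)[OF c]] of_nat_mono by blast
        also have "\<dots> = 2 powr real (total_size c)" by (simp add: powr_realpow)
        also have "\<dots> \<le> 2 powr ((1 + 2 * \<delta>) * real p)" using \<open>real (total_size c) \<le> _\<close> by simp
        finally show ?thesis .
      qed simp
      have "card L \<le> card (\<Union>c\<in>CC. contained p c \<inter> L)"
        using LC CC(1) finC by (intro card_mono) auto
      also have "\<dots> \<le> (\<Sum>c\<in>CC. card (contained p c \<inter> L))"
        using CC(1) by (rule card_UN_le)
      finally have "real (card L) \<le> (\<Sum>c\<in>CC. real (card (contained p c \<inter> L)))"
        by (simp flip: of_nat_sum)
      also have "\<dots> \<le> real (card CC) * 2 powr ((1 + 2 * \<delta>) * real p)"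
        using sum_bounded_above[of CC _ "2 powr ((1 + 2 * \<delta>) * real p)", OF bound] by simp
      also have "real (card CC) \<le> real ((2 * (card GG)\<^sup>2) ^ j)"
        using CC(2) of_nat_mono by blast
      also have "real ((2 * (card GG)\<^sup>2) ^ j) = (2 * (real (card GG))\<^sup>2) ^ j" by simp
      also have "\<dots> \<le> (2 * (\<gamma> ^ p)\<^sup>2) ^ j"
        using \<theta>(2)[of p] by (intro power_mono mult_left_mono) (auto simp: GG_def)
      also have "\<dots> = 2 powr real j * 2 powr (\<eta> * real p)"
      proof -
        have "(\<gamma> ^ p)\<^sup>2 ^ j = \<gamma> ^ (p * 2 * j)"
          by (simp only: power_mult)
        also have "\<dots> = \<gamma> powr real (p * 2 * j)"
          using \<open>\<gamma> > 1\<close> by (subst powr_realpow) auto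
        also have "\<dots> = 2 powr (\<eta> * real p)"
          using jpos by (simp add: \<gamma>_def powr_powr)
        finally show ?thesis
          unfolding power_mult_distrib by (simp only: powr_realpow zero_less_numeral)
      qed
      also have "2 powr real j * 2 powr (\<eta> * real p) * 2 powr ((1 + 2 * \<delta>) * real p)
          = 2 powr (real j + \<eta> * real p + (1 + 2 * \<delta>) * real p)"
        by (simp add: powr_add)
      also have "\<dots> \<le> 2 powr (\<beta> * real p)"
        using p(4) by (simp add: \<eta>(2) algebra_simps)
      finally show "real (card (large_triples p (\<delta> * real p))) \<le> 2 powr (\<beta> * real p)"
        by (simp add: L_def)
    qed
  qed
qed

section \<open>Exact counts by transfer matrices\<close>

lemma card_free_pairs_empty: "p > 0 \<Longrightarrow> card (free_pairs p {}) = 4 ^ p"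
  by (simp add: card_free_pairs_sum sumset_def card_Pow flip: power_mult_distrib)

lemma card_free_pairs_singleton:
  assumes "p > 0"
  shows "card (free_pairs p {a}) = 3 ^ p"
proof -
  have "card (free_pairs p {a}) = card (free_pairs p {0})"
    using card_free_pairs_affine[of p 1 a "{0}"] assms by simp
  also have "\<dots> = (\<Sum>B\<in>Pow (Zn p). 2 ^ card (Zn p - sumset p {0} B))"
    using assms by (rule card_free_pairs_sum)
  also have "\<dots> = (\<Sum>B\<in>Pow (Zn p). 2 ^ card (Zn p - B))"
  proof (rule sum.cong)
    fix B assume "B \<in> Pow (Zn p)"
    hence "sumset p {0} B = (\<lambda>b. b) ` B"
      unfolding sumset_def by (force simp: image_iff)
    thus "2 ^ card (Zn p - sumset p {0} B) = (2 :: nat) ^ card (Zn p - B)" by simp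
  qed simp
  also have "\<dots> = (\<Sum>B\<in>Pow (Zn p). 2 ^ card B)"
    by (rule sum.reindex_bij_witness[of _ "\<lambda>B. Zn p - B" "\<lambda>B. Zn p - B"]) (auto simp: double_diff)
  finally have "real (card (free_pairs p {a})) = (\<Sum>B\<in>Pow (Zn p). 2 ^ card B)" by simp
  also have "\<dots> = 3 ^ p" by (subst sum_power_card_Pow) auto
  finally have "real (card (free_pairs p {a})) = real (3 ^ p)" by simp
  thus ?thesis by (simp only: of_nat_eq_iff)
qed

definition cyclic_sum :: "(bool \<Rightarrow> bool \<Rightarrow> bool \<Rightarrow> real) \<Rightarrow> nat \<Rightarrow> real" where
  "cyclic_sum w p = (\<Sum>X\<in>Pow (Zn p). \<Prod>t\<in>Zn p. w (t \<in> X) ((t - 1) mod int p \<in> X) ((t - 2) mod int p \<in> X))"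

text \<open>One application of the transfer matrix. The last two arguments are the states of the two
  latest positions; the first two keep the states of positions 0 and 1, which are needed to close
  the cycle.\<close>

definition tstep :: "(bool \<Rightarrow> bool \<Rightarrow> bool \<Rightarrow> real) \<Rightarrow> (bool \<Rightarrow> bool \<Rightarrow> bool \<Rightarrow> bool \<Rightarrow> real) \<Rightarrow>
    bool \<Rightarrow> bool \<Rightarrow> bool \<Rightarrow> bool \<Rightarrow> real" where
  "tstep w G = (\<lambda>x0 x1 y0 y1. w False y1 y0 * G x0 x1 y1 False + w True y1 y0 * G x0 x1 y1 True)"

definition diag :: "(bool \<Rightarrow> bool \<Rightarrow> bool \<Rightarrow> bool \<Rightarrow> real) \<Rightarrow> real" where
  "diag G = G False False False False + G False True False True + G True False True False + G True True True True"

text \<open>The newest position is summed out and absorbed into G, which is therefore arbitrary in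
  the induction. At length two the first and the last two positions coincide, and this gives the
  trace \<open>diag\<close>.\<close>

lemma path_sum:
  "(\<Sum>X\<in>Pow (Zn (n + 2)). (\<Prod>t\<in>{2..<int n + 2}. w (t \<in> X) (t - 1 \<in> X) (t - 2 \<in> X)) *
     G (0 \<in> X) (1 \<in> X) (int n \<in> X) (int n + 1 \<in> X)) = diag ((tstep w ^^ n) G)"
proof (induction n arbitrary: G)
  case 0
  have "Zn 2 = {0, 1}" by auto
  hence "Pow (Zn 2) = {{}, {0}, {1}, {0, 1}}" by (auto simp: Pow_insert)
  moreover have "(0 :: int) \<noteq> 1" by simp
  ultimately show ?case
    by (simp add: diag_def insert_eq_iff numeral_2_eq_2[symmetric] doubleton_eq_iff add_ac)
next
  case (Suc n)
  define P where "P = (\<lambda>n X. \<Prod>t\<in>{2..<int n + 2}. w (t \<in> X) (t - 1 \<in> X) (t - 2 \<in> X))"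
  have step: "P (Suc n) X * G (0 \<in> X) (1 \<in> X) (int (Suc n) \<in> X) (int (Suc n) + 1 \<in> X)
      + P (Suc n) X' * G (0 \<in> X') (1 \<in> X') (int (Suc n) \<in> X') (int (Suc n) + 1 \<in> X')
      = P n X * tstep w G (0 \<in> X) (1 \<in> X) (int n \<in> X) (int n + 1 \<in> X)"
    if X: "X \<in> Pow (Zn (n + 2))" and X': "X' = insert (int (n + 2)) X" for X X'
  proof -
    have *: "{2..<int (Suc n) + 2} = insert (int n + 2) {2..<int n + 2}" by auto
    have notin: "int n + 2 \<notin> X" using X by auto
    have PX: "P (Suc n) X = w False (int n + 1 \<in> X) (int n \<in> X) * P n X"
      unfolding P_def * using notin by (simp add: add.commute)
    have "P n X' = P n X"
      unfolding P_def by (intro prod.cong) (auto simp: X')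
    hence PX': "P (Suc n) X' = w True (int n + 1 \<in> X) (int n \<in> X) * P n X"
      unfolding P_def * by (simp add: X' add.commute)
    have "int (Suc n) + 1 \<notin> X" using notin by (simp add: add.commute)
    thus ?thesis
      unfolding PX PX' tstep_def by (simp add: X' algebra_simps)
  qed
  have "(\<Sum>X\<in>Pow (Zn (Suc n + 2)). P (Suc n) X * G (0 \<in> X) (1 \<in> X) (int (Suc n) \<in> X) (int (Suc n) + 1 \<in> X))
      = (\<Sum>X\<in>Pow (Zn (n + 2)). P n X * tstep w G (0 \<in> X) (1 \<in> X) (int n \<in> X) (int n + 1 \<in> X))"
    unfolding add_Suc sum_Pow_Zn_Suc by (rule sum.cong[OF refl step[OF _ refl]])
  also have "\<dots> = diag ((tstep w ^^ n) (tstep w G))"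
    unfolding P_def by (rule Suc.IH)
  finally show ?case
    unfolding P_def by (simp add: funpow_swap1)
qed

lemma cyclic_sum_eq:
  "cyclic_sum w (n + 2) = diag ((tstep w ^^ n) (\<lambda>x0 x1 y0 y1. w x0 y1 y0 * w x1 x0 y1))"
proof -
  have Z: "Zn (n + 2) = insert 0 (insert 1 {2..<int n + 2})" by auto
  have m: "(- 1) mod (int n + 2) = int n + 1" "(- 2) mod (int n + 2) = int n"
    "(1 - 2) mod (int n + 2) = int n + 1"
  proof -
    have "(- 1) mod (int n + 2) = (- 1 + (int n + 2)) mod (int n + 2)" by (simp only: mod_add_self2)
    also have "\<dots> = int n + 1" by (subst mod_pos_pos_trivial) auto
    finally show "(- 1) mod (int n + 2) = int n + 1" .
    thus "(1 - 2) mod (int n + 2) = int n + 1" by simp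
    have "(- 2) mod (int n + 2) = (- 2 + (int n + 2)) mod (int n + 2)" by (simp only: mod_add_self2)
    also have "\<dots> = int n" by (subst mod_pos_pos_trivial) auto
    finally show "(- 2) mod (int n + 2) = int n" .
  qed
  have "(\<Prod>t\<in>Zn (n + 2). w (t \<in> X) ((t - 1) mod int (n + 2) \<in> X) ((t - 2) mod int (n + 2) \<in> X))
      = (\<Prod>t\<in>{2..<int n + 2}. w (t \<in> X) (t - 1 \<in> X) (t - 2 \<in> X)) *
        (w (0 \<in> X) (int n + 1 \<in> X) (int n \<in> X) * w (1 \<in> X) (0 \<in> X) (int n + 1 \<in> X))" for X
  proof -
    have "(\<Prod>t\<in>{2..<int n + 2}. w (t \<in> X) ((t - 1) mod int (n + 2) \<in> X) ((t - 2) mod int (n + 2) \<in> X))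
        = (\<Prod>t\<in>{2..<int n + 2}. w (t \<in> X) (t - 1 \<in> X) (t - 2 \<in> X))"
      by (intro prod.cong) (auto simp: mod_pos_pos_trivial)
    thus ?thesis
      unfolding Z by (simp add: m add.commute)
  qed
  thus ?thesis
    unfolding cyclic_sum_def path_sum[symmetric] by simp
qed

definition w2 :: "bool \<Rightarrow> bool \<Rightarrow> bool \<Rightarrow> real" where
  "w2 x y z = (if x \<or> y then 1 else 2)"

definition w3 :: "bool \<Rightarrow> bool \<Rightarrow> bool \<Rightarrow> real" where
  "w3 x y z = (if x \<or> y \<or> z then 1 else 2)"

lemma card_free_pairs_01:
  assumes "p \<ge> 2"
  shows "real (card (free_pairs p {0, 1})) = cyclic_sum w2 p"
proof -
  have "real (card (free_pairs p {0, 1})) =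
      (\<Sum>B\<in>Pow (Zn p). \<Prod>c\<in>Zn p. if \<exists>a\<in>{0, 1}. (c - a) mod int p \<in> B then 1 else 2)"
    using assms by (intro card_free_pairs_prod) auto
  also have "\<dots> = cyclic_sum w2 p"
    unfolding cyclic_sum_def by (intro sum.cong prod.cong) (auto simp: w2_def)
  finally show ?thesis .
qed

lemma card_free_pairs_012:
  assumes "p \<ge> 2"
  shows "real (card (free_pairs p {0, 1, 2})) = cyclic_sum w3 p"
proof -
  have "real (card (free_pairs p {0, 1, 2})) =
      (\<Sum>B\<in>Pow (Zn p). \<Prod>c\<in>Zn p. if \<exists>a\<in>{0, 1, 2}. (c - a) mod int p \<in> B then 1 else 2)"
    using assms by (intro card_free_pairs_prod) auto
  also have "\<dots> = cyclic_sum w3 p"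
    unfolding cyclic_sum_def by (intro sum.cong prod.cong) (auto simp: w3_def)
  finally show ?thesis .
qed

text \<open>The recurrences below are the Cayley--Hamilton identities of the transfer matrices.\<close>

lemma tstep_w2: "tstep w2 (tstep w2 (tstep w2 G)) x0 x1 y0 y1 =
    3 * tstep w2 (tstep w2 G) x0 x1 y0 y1 - tstep w2 G x0 x1 y0 y1"
  by (cases y0; cases y1) (simp_all add: tstep_def w2_def)

lemma tstep_w3: "tstep w3 (tstep w3 (tstep w3 (tstep w3 G))) x0 x1 y0 y1 =
    3 * tstep w3 (tstep w3 (tstep w3 G)) x0 x1 y0 y1 - tstep w3 (tstep w3 G) x0 x1 y0 y1 - tstep w3 G x0 x1 y0 y1"
  by (cases y0; cases y1) (simp_all add: tstep_def w3_def)

text \<open>The nonzero eigenvalues solve x^2 = 3 x - 1, so they are the squares of the golden ratio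
  and of its conjugate, and the sums are Lucas numbers of even index. The identity for the matrix
  contains the eigenvalue 0, so three initial values are compared.\<close>

lemma cyclic_sum_w2: "cyclic_sum w2 (n + 2) = ((1 + sqrt 5) / 2) ^ (2 * (n + 2)) + ((1 - sqrt 5) / 2) ^ (2 * (n + 2))"
proof -
  define G where "G = (\<lambda>x0 x1 y0 y1. w2 x0 y1 y0 * w2 x1 x0 y1)"
  define a where "a = (\<lambda>n. diag ((tstep w2 ^^ n) G))"
  define u v where "u = ((1 + sqrt 5) / 2)\<^sup>2" and "v = ((1 - sqrt 5) / 2)\<^sup>2"
  have uv: "u * u = 3 * u - 1" "v * v = 3 * v - 1" "u + v = 3"
    by (simp_all add: u_def v_def power2_eq_square field_simps)
  define f where "f = (\<lambda>m. u ^ m + v ^ m)"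
  have f2: "f (m + 2) = 3 * f (m + 1) - f m" for m
  proof -
    have "u ^ (m + 2) = u ^ m * (u * u)" "v ^ (m + 2) = v ^ m * (v * v)"
      by (simp_all add: numeral_eq_Suc)
    thus ?thesis unfolding uv by (simp add: f_def algebra_simps)
  qed
  have f0: "f 0 = 2" "f 1 = 3" using uv by (simp_all add: f_def)
  have f4: "f 2 = 7" "f 3 = 18" "f 4 = 47"
    using f2[of 0] f2[of 1] f2[of 2] f0 by (simp_all add: eval_nat_numeral)
  have rec: "a (Suc (Suc (Suc n))) = 3 * a (Suc (Suc n)) - a (Suc n)" for n
    by (simp add: a_def diag_def tstep_w2)
  have "a n = f (n + 2) \<and> a (Suc n) = f (n + 3) \<and> a (Suc (Suc n)) = f (n + 4)" for n
  proof (induction n)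
    case 0
    have "a 0 = 7" "a (Suc 0) = 18" "a (Suc (Suc 0)) = 47"
      by (simp_all add: a_def diag_def tstep_def G_def w2_def)
    thus ?case using f4 by (simp add: eval_nat_numeral)
  next
    case (Suc n)
    thus ?case using rec[of n] f2[of "n + 3"] by (simp add: eval_nat_numeral)
  qed
  hence "a n = f (n + 2)" by blast
  thus ?thesis
    unfolding cyclic_sum_eq a_def G_def f_def u_def v_def by (simp only: power_mult)
qed

text \<open>Here x^3 - 3 x^2 + x + 1 = (x - 1) (x^2 - 2 x - 1), so the nonzero eigenvalues are 1 and
  1 + sqrt 2 with its conjugate; the summand 1 is the trivial eigenvalue.\<close>

lemma cyclic_sum_w3: "cyclic_sum w3 (n + 2) = (1 + sqrt 2) ^ (n + 2) + (1 - sqrt 2) ^ (n + 2) + 1"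
proof -
  define G where "G = (\<lambda>x0 x1 y0 y1. w3 x0 y1 y0 * w3 x1 x0 y1)"
  define a where "a = (\<lambda>n. diag ((tstep w3 ^^ n) G))"
  define u v where "u = 1 + sqrt 2" and "v = 1 - sqrt 2"
  have uv: "u * u = 2 * u + 1" "v * v = 2 * v + 1" "u + v = 2"
    by (simp_all add: u_def v_def algebra_simps)
  define f where "f = (\<lambda>m. u ^ m + v ^ m + 1)"
  have f2: "f (m + 2) = 2 * f (m + 1) + f m - 2" for m
  proof -
    have "u ^ (m + 2) = u ^ m * (u * u)" "v ^ (m + 2) = v ^ m * (v * v)"
      by (simp_all add: numeral_eq_Suc)
    thus ?thesis unfolding uv by (simp add: f_def algebra_simps)
  qed
  have f0: "f 0 = 3" "f 1 = 3" using uv by (simp_all add: f_def)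
  have f5: "f 2 = 7" "f 3 = 15" "f 4 = 35" "f 5 = 83"
    using f2[of 0] f2[of 1] f2[of 2] f2[of 3] f0 by (simp_all add: eval_nat_numeral)
  have rec: "a (Suc (Suc (Suc (Suc n)))) = 3 * a (Suc (Suc (Suc n))) - a (Suc (Suc n)) - a (Suc n)" for n
    by (simp add: a_def diag_def tstep_w3)
  have "a n = f (n + 2) \<and> a (Suc n) = f (n + 3) \<and> a (Suc (Suc n)) = f (n + 4) \<and> a (Suc (Suc (Suc n))) = f (n + 5)" for n
  proof (induction n)
    case 0
    have "a 0 = 7" "a (Suc 0) = 15" "a (Suc (Suc 0)) = 35" "a (Suc (Suc (Suc 0))) = 83"
      by (simp_all add: a_def diag_def tstep_def G_def w3_def)
    thus ?case using f5 by (simp add: eval_nat_numeral)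
  next
    case (Suc n)
    \<comment> \<open>The difference of two consecutive instances of \<open>f2\<close> eliminates
      the constant - 2.\<close>
    have "f (n + 6) = 3 * f (n + 5) - f (n + 4) - f (n + 3)"
      using f2[of "n + 4"] f2[of "n + 3"] by (simp add: eval_nat_numeral)
    thus ?case using Suc rec[of n] by (simp add: eval_nat_numeral)
  qed
  hence "a n = f (n + 2)" by blast
  thus ?thesis
    unfolding cyclic_sum_eq a_def G_def f_def u_def v_def .
qed

lemma prime_coprime_diff:
  assumes "prime p" "x \<in> Zn p" "y \<in> Zn p" "x \<noteq> y"
  shows "coprime (y - x) (int p)"
proof -
  have "\<not> int p dvd y - x"
  proof
    assume "int p dvd y - x"
    hence "y mod int p = x mod int p" by (simp add: mod_eq_dvd_iff)
    thus False using assms by simp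
  qed
  thus ?thesis
    using assms(1) by (metis coprime_commute prime_imp_coprime prime_nat_int_transfer)
qed

lemma card_free_pairs_two:
  assumes "prime p" "A \<subseteq> Zn p" "card A = 2"
  shows "real (card (free_pairs p A)) = ((1 + sqrt 5) / 2) ^ (2 * p) + ((1 - sqrt 5) / 2) ^ (2 * p)"
proof -
  have p: "p \<ge> 2" using assms(1) prime_ge_2_nat by blast
  obtain x y where A: "A = {x, y}" "x \<noteq> y" using assms(3) by (auto simp: card_2_iff)
  have "A = (\<lambda>a. (y - x) * a + x) ` {0, 1}" using A by auto
  hence "card (free_pairs p A) = card (free_pairs p {0, 1})"
    using card_free_pairs_affine[OF _ prime_coprime_diff[OF assms(1), of x y], of x "{0, 1}"] A assms(2) p by simp
  moreover obtain n where "p = n + 2" using p le_Suc_ex[of 2 p] by (auto simp: add.commute)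
  ultimately show ?thesis
    using card_free_pairs_01[OF p] cyclic_sum_w2[of n] by simp
qed

section \<open>Three-term progressions\<close>

definition is_AP :: "nat \<Rightarrow> int set \<Rightarrow> bool" where
  "is_AP p A \<longleftrightarrow> (\<exists>x\<in>A. \<exists>y\<in>A. \<exists>z\<in>A. x \<noteq> z \<and> int p dvd x + z - 2 * y)"

text \<open>The middle y differs from both ends, since otherwise p would divide z - x; a set of size
  three is therefore exhausted by x, y, z.\<close>

lemma is_AP_card_3:
  assumes "prime p" "A \<subseteq> Zn p" "card A = 3" "is_AP p A"
  obtains x y z where "A = {x, y, z}" "x \<noteq> y" "y \<noteq> z" "x \<noteq> z" "int p dvd x + z - 2 * y"
proof -
  obtain x y z where xyz: "x \<in> A" "y \<in> A" "z \<in> A" "x \<noteq> z" "int p dvd x + z - 2 * y"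
    using assms(4) by (auto simp: is_AP_def)
  have Z: "x \<in> Zn p" "z \<in> Zn p" using xyz assms(2) by auto
  have nd: "\<not> int p dvd z - x"
  proof
    assume "int p dvd z - x"
    hence "z mod int p = x mod int p" by (simp add: mod_eq_dvd_iff)
    thus False using xyz Z by simp
  qed
  have "y \<noteq> x" using xyz(5) nd by auto
  moreover have "y \<noteq> z" using xyz(5) nd by (metis add_diff_cancel_right diff_add_cancel dvd_diff_commute mult_2)
  moreover have "A = {x, y, z}"
  proof (rule card_seteq[symmetric])
    show "finite A" using assms(3) card.infinite by fastforce
    show "card A \<le> card {x, y, z}" using calculation xyz(4) assms(3) by simp
  qed (use xyz in auto)
  ultimately show ?thesis using that[of x y z] xyz by auto
qed

lemma card_free_pairs_AP:
  assumes "prime p" "A \<subseteq> Zn p" "card A = 3" "is_AP p A"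
  shows "real (card (free_pairs p A)) = (1 + sqrt 2) ^ p + (1 - sqrt 2) ^ p + 1"
proof -
  have p: "p \<ge> 2" using assms(1) prime_ge_2_nat by blast
  obtain x y z where xyz: "A = {x, y, z}" "x \<noteq> y" "y \<noteq> z" "x \<noteq> z" "int p dvd x + z - 2 * y"
    using is_AP_card_3[OF assms] by blast
  have "(2 * y - x) mod int p = z mod int p"
    using xyz(5) by (metis diff_diff_eq2 add.commute dvd_diff_commute mod_eq_dvd_iff)
  hence "(\<lambda>a. a mod int p) ` A = (\<lambda>a. a mod int p) ` (\<lambda>a. (y - x) * a + x) ` {0, 1, 2}"
    by (simp add: xyz(1) algebra_simps)
  hence "card (free_pairs p A) = card (free_pairs p {0, 1, 2})"
    using card_free_pairs_affine[OF _ prime_coprime_diff[OF assms(1), of x y], of x "{0, 1, 2}"]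
      free_pairs_cong_mod[of p A "(\<lambda>a. (y - x) * a + x) ` {0, 1, 2}"] xyz assms(2) p by simp
  moreover obtain n where "p = n + 2" using p le_Suc_ex[of 2 p] by (auto simp: add.commute)
  ultimately show ?thesis
    using card_free_pairs_012[OF p] cyclic_sum_w3[of n] by simp
qed

text \<open>A progression is determined by its pair of ends, to which \<open>f\<close> adds the
  midpoint, and conversely by the progression the ends are determined. The latter fails for p = 3,
  where each element of {0, 1, 2} is the midpoint of the others.\<close>

lemma card_AP_sets:
  assumes "prime p" "p \<ge> 5"
  shows "card {A. A \<subseteq> Zn p \<and> card A = 3 \<and> is_AP p A} = p choose 2"
proof -
  \<comment> \<open>The inverse of 2 modulo the odd number p.\<close>
  define h where "h = (int p + 1) div 2"
  have "odd p" using assms primes_dvd_imp_eq[of 2 p] two_is_prime_nat by auto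
  hence h: "2 * h = int p + 1" by (auto simp: h_def elim!: oddE)
  define mid where "mid = (\<lambda>E. (h * \<Sum>E) mod int p)"
  define f where "f = (\<lambda>E. insert (mid E) E)"
  define E2 where "E2 = {E. E \<subseteq> Zn p \<and> card E = 2}"
  have p0: "p > 0" using assms by simp
  have mid: "int p dvd x + z - 2 * mid {x, z}" if "x \<noteq> z" for x z
  proof -
    have "(2 * mid {x, z}) mod int p = (2 * (h * (x + z))) mod int p"
      unfolding mid_def using that by (simp add: mod_mult_right_eq)
    also have "2 * (h * (x + z)) = (x + z) + int p * (x + z)"
      using h by (metis (no_types, opaque_lifting) add.commute distrib_right mult.assoc mult_1)
    finally have "(2 * mid {x, z}) mod int p = (x + z) mod int p" by simp
    thus ?thesis by (simp add: mod_eq_dvd_iff dvd_diff_commute)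
  qed
  have uniq: "False" if "int p dvd x + z - 2 * y" "int p dvd y + z - 2 * x" "x \<in> Zn p" "y \<in> Zn p" "x \<noteq> y" for x y z
  proof -
    have "int p dvd (x + z - 2 * y) - (y + z - 2 * x)" using that(1,2) by (rule dvd_diff)
    hence "int p dvd 3 * (x - y)" by (simp add: algebra_simps)
    moreover have "coprime (int p) 3"
      using assms primes_coprime_nat[of p 3] by (simp add: coprime_int_iff[of p 3, simplified])
    moreover have "coprime (int p) (x - y)"
      using prime_coprime_diff[OF assms(1), of y x] that by (simp add: coprime_commute)
    ultimately have "is_unit (int p)"
      by (meson coprime_dvd_mult_right_iff coprime_common_divisor dvd_refl)
    thus False using assms by simp
  qed
  have "bij_betw f E2 {A. A \<subseteq> Zn p \<and> card A = 3 \<and> is_AP p A}"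
    unfolding bij_betw_def
  proof (intro conjI equalityI subsetI)
    have fE: "\<exists>x z. E = {x, z} \<and> x \<noteq> z \<and> x \<in> Zn p \<and> z \<in> Zn p \<and> mid E \<in> Zn p \<and> mid E \<noteq> x \<and> mid E \<noteq> z \<and> int p dvd x + z - 2 * mid E"
      if E: "E \<in> E2" for E
    proof -
      obtain x z where xz: "E = {x, z}" "x \<noteq> z" using E by (auto simp: E2_def card_2_iff)
      have Z: "x \<in> Zn p" "z \<in> Zn p" using E xz by (auto simp: E2_def)
      have d: "int p dvd x + z - 2 * mid E" using mid xz by blast
      have nd: "\<not> int p dvd z - x"
      proof
        assume "int p dvd z - x"
        hence "z mod int p = x mod int p" by (simp add: mod_eq_dvd_iff)
        thus False using xz Z by simp
      qed
      have "mid E \<noteq> x" using d nd by auto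
      moreover have "mid E \<noteq> z"
      proof
        assume "mid E = z"
        hence "int p dvd x - z" using d by (simp add: algebra_simps)
        thus False using nd by (simp add: dvd_diff_commute)
      qed
      ultimately show ?thesis using xz Z d p0 by (auto simp: mid_def)
    qed
    show "inj_on f E2"
    proof (rule inj_onI)
      fix E E' assume E: "E \<in> E2" "E' \<in> E2" "f E = f E'"
      obtain x z where 1: "E = {x, z}" "x \<noteq> z" "x \<in> Zn p" "z \<in> Zn p" "mid E \<in> Zn p" "mid E \<noteq> x" "mid E \<noteq> z" "int p dvd x + z - 2 * mid E"
        using fE[OF E(1)] by blast
      obtain x' z' where 2: "E' = {x', z'}" "x' \<noteq> z'" "mid E' \<in> Zn p" "mid E' \<noteq> x'" "mid E' \<noteq> z'" "int p dvd x' + z' - 2 * mid E'"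
        using fE[OF E(2)] by blast
      have eq: "{mid E, x, z} = {mid E', x', z'}" using E(3) 1 2 by (simp add: f_def)
      show "E = E'"
      proof (cases "mid E = mid E'")
        case True
        have "mid E \<notin> {x, z}" using 1(6,7) by blast
        moreover have "mid E \<notin> {x', z'}" unfolding True using 2(4,5) by blast
        moreover have "insert (mid E) {x, z} = insert (mid E) {x', z'}" using eq True by simp
        ultimately show ?thesis using insert_ident 1(1) 2(1) by metis
      next
        case False
        define y where "y = mid E"
        \<comment> \<open>If the midpoints differ, y' is an end of the first pair and y an end of
          the second, so one three-element set has two midpoints, which \<open>uniq\<close>
          forbids.\<close>
        define y' where "y' = mid E'"
        have "\<exists>w. int p dvd y' + w - 2 * y \<and> int p dvd y + w - 2 * y'"
        proof (cases "y' = x")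
          case True
          have "{x', z'} = {y, z}"
            using eq True 1(2,6,7) 2(4,5) unfolding y_def y'_def by blast
          hence "x' + z' = y + z" using 2(2) by (auto simp: doubleton_eq_iff)
          thus ?thesis using 1(8) 2(6) True by (intro exI[of _ z]) (simp add: y_def y'_def)
        next
          case F: False
          have "mid E' \<in> {mid E, x, z}" unfolding eq by simp
          hence y'z: "y' = z" using F False by (auto simp: y'_def)
          have "{x', z'} = {y, x}"
            using eq y'z 1(2,6,7) 2(4,5) unfolding y_def y'_def by blast
          hence "x' + z' = y + x" using 2(2) by (auto simp: doubleton_eq_iff)
          thus ?thesis using 1(8) 2(6) y'z by (intro exI[of _ x]) (simp add: y_def y'_def add.commute)
        qed
        hence False using uniq[of y' _ y] 1 2 False by (auto simp: y_def y'_def)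
        thus ?thesis ..
      qed
    qed
    show "A \<in> {A. A \<subseteq> Zn p \<and> card A = 3 \<and> is_AP p A}" if A_im: "A \<in> f ` E2" for A
    proof -
      obtain E where E: "E \<in> E2" "A = f E" using A_im by auto
      obtain x z where 1: "E = {x, z}" "x \<noteq> z" "x \<in> Zn p" "z \<in> Zn p" "mid E \<in> Zn p" "mid E \<noteq> x" "mid E \<noteq> z" "int p dvd x + z - 2 * mid E"
        using fE[OF E(1)] by blast
      have A: "A = {mid E, x, z}" using E 1(1) by (simp add: f_def)
      have "is_AP p A" unfolding is_AP_def A using 1(2,8) by blast
      moreover have "card A = 3" unfolding A using 1(2,6,7) by simp
      moreover have "A \<subseteq> Zn p" unfolding A using 1(3-5) by blast
      ultimately show ?thesis by blast
    qed
    show "A \<in> f ` E2" if A_AP: "A \<in> {A. A \<subseteq> Zn p \<and> card A = 3 \<and> is_AP p A}" for A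
    proof -
      obtain x y z where xyz: "A = {x, y, z}" "x \<noteq> y" "y \<noteq> z" "x \<noteq> z" "int p dvd x + z - 2 * y"
        using is_AP_card_3[OF assms(1), of A] A_AP by blast
      have Z: "x \<in> Zn p" "y \<in> Zn p" "z \<in> Zn p" using A_AP xyz(1) by auto
      have "int p dvd (x + z - 2 * mid {x, z}) - (x + z - 2 * y)"
        using mid[OF xyz(4)] xyz(5) by (rule dvd_diff)
      hence "int p dvd 2 * (y - mid {x, z})" by (simp add: algebra_simps)
      moreover have "coprime (int p) 2" using \<open>odd p\<close> by simp
      ultimately have "int p dvd y - mid {x, z}" using coprime_dvd_mult_right_iff by blast
      hence "y mod int p = mid {x, z} mod int p" by (simp add: mod_eq_dvd_iff)
      hence "mid {x, z} = y" using Z by (simp add: mid_def)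
      hence "A = f {x, z}" by (auto simp: f_def xyz(1))
      moreover have "{x, z} \<in> E2" using Z xyz(4) by (simp add: E2_def)
      ultimately show ?thesis by blast
    qed
  qed
  hence "card {A. A \<subseteq> Zn p \<and> card A = 3 \<and> is_AP p A} = card E2"
    using bij_betw_same_card by fastforce
  also have "\<dots> = p choose 2"
    unfolding E2_def using n_subsets[of "Zn p" 2] by simp
  finally show ?thesis .
qed

section \<open>Dirichlet approximation\<close>

lemma same_box_close:
  fixes x y k m :: int
  assumes "m > 0" "(k * x) div m = (k * y) div m" "k > 0"
  shows "k * \<bar>x - y\<bar> < m"
proof -
  have "k * x = m * ((k * x) div m) + (k * x) mod m" "k * y = m * ((k * y) div m) + (k * y) mod m"
    by simp_all
  hence "k * x - k * y = (k * x) mod m - (k * y) mod m"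
    by (metis add_diff_cancel_left assms(2))
  moreover have "0 \<le> (k * x) mod m" "(k * x) mod m < m" "0 \<le> (k * y) mod m" "(k * y) mod m < m"
    using assms(1) by simp_all
  ultimately have "\<bar>k * x - k * y\<bar> < m" by linarith
  thus ?thesis using assms(3) by (simp add: abs_mult flip: right_diff_distrib)
qed

text \<open>The p points (u x, u y) modulo p fall into k^2 < p boxes of side p / k. Two of them
  share a box, and the difference of their multipliers does the job.\<close>

lemma simultaneous_approximation:
  fixes p k :: nat and x y :: int
  assumes "k > 0" "k * k < p"
  obtains u s t :: int where "0 < u" "u < int p" "[u * x = s] (mod int p)" "[u * y = t] (mod int p)"
    "int k * \<bar>s\<bar> < int p" "int k * \<bar>t\<bar> < int p"
proof -
  have p: "p > 0" using assms by simp
  define \<phi> where "\<phi> = (\<lambda>u. ((int k * (u * x mod int p)) div int p, (int k * (u * y mod int p)) div int p))"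
  have box: "(int k * (v mod int p)) div int p \<in> {0..<int k}" for v
  proof -
    have "int k * (v mod int p) < int k * int p" using assms p by simp
    moreover have "(int k * (v mod int p)) div int p * int p \<le> int k * (v mod int p)"
      using p by (simp add: div_mult_mod_eq minus_mod_eq_div_mult[symmetric])
    ultimately have "(int k * (v mod int p)) div int p * int p < int k * int p"
      by linarith
    hence "(int k * (v mod int p)) div int p < int k"
      using p by simp
    thus ?thesis using p by (simp add: pos_imp_zdiv_nonneg_iff)
  qed
  have "\<phi> ` Zn p \<subseteq> {0..<int k} \<times> {0..<int k}"
    unfolding \<phi>_def using box by blast
  hence "card (\<phi> ` Zn p) \<le> card ({0..<int k} \<times> {0..<int k})"
    by (intro card_mono) auto
  also have "\<dots> < card (Zn p)" using assms by (simp add: card_cartesian_product)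
  finally have "\<not> inj_on \<phi> (Zn p)" using pigeonhole by blast
  then obtain u1 u2 where u: "u1 \<in> Zn p" "u2 \<in> Zn p" "u1 < u2" "\<phi> u1 = \<phi> u2"
    by (metis inj_onI linorder_neqE)
  define s where "s = u2 * x mod int p - u1 * x mod int p"
  define t where "t = u2 * y mod int p - u1 * y mod int p"
  have "[(u2 - u1) * x = s] (mod int p)" "[(u2 - u1) * y = t] (mod int p)"
    unfolding s_def t_def cong_def left_diff_distrib by (simp_all add: mod_diff_eq)
  moreover have "int k * \<bar>s\<bar> < int p" "int k * \<bar>t\<bar> < int p"
    unfolding s_def t_def using u(4) p assms by (auto intro!: same_box_close simp: \<phi>_def)
  ultimately show ?thesis
    using that[of "u2 - u1" s t] u by auto
qed

lemma sorted_triple: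
  fixes f :: "'a \<Rightarrow> int"
  assumes "card A = 3" "inj_on f A"
  obtains l m h where "A = {l, m, h}" "f l < f m" "f m < f h"
proof -
  obtain x y z where A: "A = {x, y, z}" "x \<noteq> y" "y \<noteq> z" "x \<noteq> z"
    using assms(1) by (auto simp: card_3_iff)
  have "f x \<noteq> f y" "f y \<noteq> f z" "f x \<noteq> f z"
    using assms(2) A by (auto simp: inj_on_def)
  then consider "f x < f y \<and> f y < f z" | "f x < f z \<and> f z < f y" | "f y < f x \<and> f x < f z"
    | "f y < f z \<and> f z < f x" | "f z < f x \<and> f x < f y" | "f z < f y \<and> f y < f x"
    by linarith
  thus ?thesis
    by cases (use that A in \<open>blast+\<close>)
qed

text \<open>One element is moved to 0 and the two differences are made small at once, so that A
  becomes a set of three integers in an interval shorter than 2 p / k. There is then no wrap-around,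
  and the integers can be sorted; the shorter of the two gaps becomes a.\<close>

lemma reduce_non_AP:
  assumes "prime p" "A \<subseteq> Zn p" "card A = 3" "\<not> is_AP p A" "k > 0" "k * k < p"
  obtains a d :: nat where "a > 0" "d > 0" "k * (2 * a + d) < 2 * p"
    "card (free_pairs p A) = card (free_pairs p {0, int a, int (2 * a + d)})"
proof -
  have p: "p > 0" using assms(1) prime_gt_0_nat by blast
  obtain x y z where A: "A = {x, y, z}" "x \<noteq> y" "y \<noteq> z" "x \<noteq> z"
    using assms(3) by (auto simp: card_3_iff)
  obtain u s t where u: "0 < u" "u < int p" "[u * (y - x) = s] (mod int p)" "[u * (z - x) = t] (mod int p)"
    "int k * \<bar>s\<bar> < int p" "int k * \<bar>t\<bar> < int p"
    using simultaneous_approximation[OF assms(5,6)] by blast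
  have cu: "coprime u (int p)"
    using prime_coprime_diff[OF assms(1), of 0 u] u(1,2) p by simp
  define f where "f = (\<lambda>w. if w = x then 0 else if w = y then s else t)"
  have cong: "[u * w + - (u * x) = f w] (mod int p)" if "w \<in> A" for w
    using that u A by (auto simp: f_def algebra_simps)
  have inj: "inj_on f A"
  proof (rule inj_onI)
    fix v w assume vw: "v \<in> A" "w \<in> A" "f v = f w"
    have "[u * v + - (u * x) = u * w + - (u * x)] (mod int p)"
      using cong[OF vw(1)] cong[OF vw(2)] vw(3) by (metis cong_sym cong_trans)
    hence "[v = w] (mod int p)"
      using cu by (simp add: cong_add_rcancel cong_mult_lcancel del: add_uminus_conv_diff)
    moreover have "v \<in> Zn p" "w \<in> Zn p" using vw assms(2) by blast+
    ultimately show "v = w" by (simp add: cong_def)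
  qed
  obtain l m h where lmh: "A = {l, m, h}" "f l < f m" "f m < f h"
    using sorted_triple[OF assms(3) inj] .
  have in_A: "l \<in> A" "m \<in> A" "h \<in> A" using lmh(1) by auto
  have range: "int k * (f h - f l) < 2 * int p"
  proof -
    have "\<bar>f w\<bar> \<le> max \<bar>s\<bar> \<bar>t\<bar>" for w by (auto simp: f_def max_def)
    hence "f h - f l \<le> 2 * max \<bar>s\<bar> \<bar>t\<bar>" by (smt (verit))
    hence "int k * (f h - f l) \<le> int k * (2 * max \<bar>s\<bar> \<bar>t\<bar>)" by (intro mult_left_mono) auto
    also have "\<dots> < 2 * int p" using u(5,6) by (simp add: max_def)
    finally show ?thesis .
  qed
  have "(\<lambda>a. a mod int p) ` f ` A = (\<lambda>a. a mod int p) ` (\<lambda>w. u * w + - (u * x)) ` A"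
    unfolding image_image using cong by (intro image_cong) (auto simp: cong_def)
  hence "card (free_pairs p (f ` A)) = card (free_pairs p ((\<lambda>w. u * w + - (u * x)) ` A))"
    using free_pairs_cong_mod by metis
  hence card_f: "card (free_pairs p A) = card (free_pairs p {f l, f m, f h})"
    using card_free_pairs_affine[OF p cu, of "- (u * x)" A] lmh(1) by simp
  \<comment> \<open>A progression among the integers would be one modulo p, as u is invertible;
    hence one gap is strictly shorter than the other and d > 0.\<close>
  have "2 * f m \<noteq> f l + f h"
  proof
    assume eq: "2 * f m = f l + f h"
    have "[(u * l + - (u * x)) + (u * h + - (u * x)) - 2 * (u * m + - (u * x)) = f l + f h - 2 * f m] (mod int p)"
      using in_A by (intro cong_add cong_diff cong_mult cong cong_refl)
    hence "[u * (l + h - 2 * m) = u * 0] (mod int p)" using eq by (simp add: algebra_simps)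
    hence "[l + h - 2 * m = 0] (mod int p)" using cu by (simp only: cong_mult_lcancel)
    hence "int p dvd l + h - 2 * m" by (simp add: cong_0_iff)
    moreover have "l \<noteq> h" using lmh by auto
    ultimately have "is_AP p A" unfolding is_AP_def using in_A by blast
    thus False using assms(4) by blast
  qed
  hence "2 * (f m - f l) < f h - f l \<or> 2 * (f h - f m) < f h - f l" by arith
  then consider "2 * (f m - f l) < f h - f l" | "2 * (f h - f m) < f h - f l" by blast
  thus ?thesis
  proof cases
    case 1
    define a where "a = nat (f m - f l)"
    define d where "d = nat (f h - f l - 2 * (f m - f l))"
    have ad: "int a = f m - f l" "int (2 * a + d) = f h - f l" "a > 0" "d > 0"
      using 1 lmh by (auto simp: a_def d_def)
    have "(\<lambda>v. 1 * v + - f l) ` {f l, f m, f h} = {0, int a, int (2 * a + d)}"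
      unfolding ad(1,2) by simp
    hence "card (free_pairs p {f l, f m, f h}) = card (free_pairs p {0, int a, int (2 * a + d)})"
      using card_free_pairs_affine[OF p, of 1 "- f l" "{f l, f m, f h}"] by simp
    moreover have "k * (2 * a + d) < 2 * p"
    proof -
      have "int (k * (2 * a + d)) < int (2 * p)"
        unfolding of_nat_mult[of k] ad(2) using range by simp
      thus ?thesis by (simp only: of_nat_less_iff)
    qed
    ultimately show ?thesis using that[of a d] ad card_f by simp
  next
    case 2
    \<comment> \<open>The shorter gap is at the upper end, so the set is reflected.\<close>
    define a where "a = nat (f h - f m)"
    define d where "d = nat (f h - f l - 2 * (f h - f m))"
    have ad: "int a = f h - f m" "int (2 * a + d) = f h - f l" "a > 0" "d > 0"
      using 2 lmh by (auto simp: a_def d_def)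
    have "(\<lambda>v. (- 1) * v + f h) ` {f l, f m, f h} = {0, int a, int (2 * a + d)}"
      unfolding ad(1,2) by auto
    hence "card (free_pairs p {f l, f m, f h}) = card (free_pairs p {0, int a, int (2 * a + d)})"
      using card_free_pairs_affine[OF p, of "- 1" "f h" "{f l, f m, f h}"] by simp
    moreover have "k * (2 * a + d) < 2 * p"
    proof -
      have "int (k * (2 * a + d)) < int (2 * p)"
        unfolding of_nat_mult[of k] ad(2) using range by simp
      thus ?thesis by (simp only: of_nat_less_iff)
    qed
    ultimately show ?thesis using that[of a d] ad card_f by simp
  qed
qed

text \<open>Bernoulli's inequality gives (1 + 4/100000)^500000 >= 21, far more than 4, and 500000 b
  < p.\<close>

lemma boundary_factor:
  assumes "1000000 * b < 2 * p"
  shows "(4 :: real) ^ b \<le> (100004 / 100000) ^ p"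
proof -
  have "(4 :: real) \<le> 1 + real 500000 * (4 / 100000)" by simp
  also have "\<dots> \<le> (1 + 4 / 100000) ^ 500000"
    by (rule Bernoulli_inequality) simp
  finally have "(4 :: real) ^ b \<le> ((1 + 4 / 100000) ^ 500000) ^ b"
    by (intro power_mono) auto
  also have "\<dots> = (1 + 4 / 100000) ^ (500000 * b)"
    by (simp only: power_mult)
  also have "\<dots> \<le> (1 + 4 / 100000) ^ p"
    using assms by (intro power_increasing) auto
  finally show ?thesis by simp
qed

text \<open>Approximation is applied with k = 10^6, whence p > 10^12. The boundary factor fits
  because 1.00004 * 2.398 <= 2.399 and 1.00004 * 2.389 <= 2.3891.\<close>

lemma card_free_pairs_non_AP:
  assumes "prime p" "A \<subseteq> Zn p" "card A = 3" "\<not> is_AP p A" "p > 1000000 * 1000000"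
  shows "real (card (free_pairs p A)) \<le> (2399 / 1000) ^ p"
    and "(2389 / 1000) ^ p \<le> real (card (free_pairs p A))"
proof -
  obtain a d :: nat where ad: "a > 0" "d > 0" "1000000 * (2 * a + d) < 2 * p"
    "card (free_pairs p A) = card (free_pairs p {0, int a, int (2 * a + d)})"
    using reduce_non_AP[OF assms(1-4), of 1000000] assms(5) by auto
  have "2 * (2 * a + d) \<le> 1000000 * (2 * a + d)" by (rule mult_le_mono1) simp
  hence "2 * (2 * a + d) < 2 * p" using ad(3) by (rule le_less_trans)
  hence b: "2 * a + d < p" by simp
  have bf: "(4 :: real) ^ (2 * a + d) \<le> (100004 / 100000) ^ p"
    using ad(3) by (rule boundary_factor)
  have "real (card (free_pairs p A)) \<le> 4 ^ (2 * a + d) * (2398 / 1000) ^ p"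
    unfolding ad(4) by (rule card_free_pairs_triangular_le[OF ad(1,2) b])
  also have "\<dots> \<le> (100004 / 100000) ^ p * (2398 / 1000) ^ p"
    using bf by (rule mult_right_mono) simp
  also have "\<dots> = ((100004 / 100000) * (2398 / 1000)) ^ p"
    by (rule power_mult_distrib[symmetric])
  also have "\<dots> \<le> (2399 / 1000) ^ p"
    by (rule power_mono) simp_all
  finally show "real (card (free_pairs p A)) \<le> (2399 / 1000) ^ p" .
  have "(100004 / 100000) ^ p * (2389 / 1000 :: real) ^ p = ((100004 / 100000) * (2389 / 1000)) ^ p"
    by (rule power_mult_distrib[symmetric])
  also have "\<dots> \<le> (23891 / 10000) ^ p"
    by (rule power_mono) simp_all
  also have "\<dots> \<le> 4 ^ (2 * a + d) * real (card (free_pairs p A))"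
    unfolding ad(4) by (rule card_free_pairs_triangular_ge[OF ad(1,2) b])
  also have "\<dots> \<le> (100004 / 100000) ^ p * real (card (free_pairs p A))"
    using bf by (rule mult_right_mono) simp
  finally show "(2389 / 1000) ^ p \<le> real (card (free_pairs p A))"
    by (rule mult_left_le_imp_le) simp
qed

section \<open>The two bounds\<close>

definition neg :: "nat \<Rightarrow> int set \<Rightarrow> int set" where
  "neg p A = (\<lambda>a. (- a) mod int p) ` A"

lemma neg_subset: "p > 0 \<Longrightarrow> neg p A \<subseteq> Zn p"
  by (auto simp: neg_def)

lemma neg_neg: "A \<subseteq> Zn p \<Longrightarrow> neg p (neg p A) = A"
  unfolding neg_def image_image by (force simp: mod_minus_eq image_iff)

lemma card_neg: "p > 0 \<Longrightarrow> A \<subseteq> Zn p \<Longrightarrow> card (neg p A) = card A"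
  using inj_on_diff_mod[of p A 0] by (simp add: neg_def card_image)

lemma in_free_triples:
  "(A, B, C) \<in> free_triples p \<longleftrightarrow>
     A \<subseteq> Zn p \<and> B \<subseteq> Zn p \<and> C \<subseteq> Zn p \<and> (\<forall>a\<in>A. \<forall>b\<in>B. (a + b) mod int p \<notin> C)"
  by (auto simp: free_triples_def free_pairs_def sumset_def)

lemma free_triples_swap: "(A, B, C) \<in> free_triples p \<Longrightarrow> (B, A, C) \<in> free_triples p"
  unfolding in_free_triples by (metis add.commute)

text \<open>The equation a + b = c is the same as (- c) + b = - a.\<close>

lemma free_triples_rotate:
  assumes "p > 0" "(A, B, C) \<in> free_triples p"
  shows "(neg p C, B, neg p A) \<in> free_triples p"
  unfolding in_free_triples
proof (intro conjI ballI neg_subset assms(1))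
  show "B \<subseteq> Zn p" using assms by (simp add: in_free_triples)
  fix c' b assume "c' \<in> neg p C" "b \<in> B"
  then obtain c where c: "c \<in> C" "c' = (- c) mod int p" by (auto simp: neg_def)
  show "(c' + b) mod int p \<notin> neg p A"
  proof
    assume "(c' + b) mod int p \<in> neg p A"
    then obtain a where a: "a \<in> A" "(c' + b) mod int p = (- a) mod int p" by (auto simp: neg_def)
    have "(- c + b) mod int p = (- a) mod int p"
      using a(2) unfolding c(2) mod_add_left_eq .
    hence "int p dvd (a + b) - c"
      by (simp add: mod_eq_dvd_iff algebra_simps)
    hence "(a + b) mod int p = c mod int p"
      by (simp only: mod_eq_dvd_iff)
    moreover have "c \<in> Zn p" using assms(2) c(1) by (auto simp: in_free_triples)
    ultimately have "(a + b) mod int p = c" by simp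
    thus False using assms(2) a(1) \<open>b \<in> B\<close> c(1) by (auto simp: in_free_triples)
  qed
qed

lemma card_by_involution:
  assumes "\<And>x. x \<in> S \<Longrightarrow> g x \<in> S" "\<And>x. x \<in> S \<Longrightarrow> g (g x) = x"
  shows "card {x \<in> S. Q (g x)} = card {x \<in> S. Q x}"
  by (rule bij_betw_same_card[of g], rule bij_betw_byWitness[of _ g]) (use assms in auto)

text \<open>The predicate is a parameter because two cut-offs occur: sizes up to 3 for the main
  terms and sizes up to p / 100 for the upper bound.\<close>

definition first_set where "first_set P p = {(A, B, C) \<in> free_triples p. P (card A)}"
definition second_set where "second_set P p = {(A, B, C) \<in> free_triples p. P (card B)}"
definition third_set where "third_set P p = {(A, B, C) \<in> free_triples p. P (card C)}"

lemma card_second_set: "card (second_set P p) = card (first_set P p)"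
proof -
  have "card {x \<in> free_triples p. (\<lambda>(A, B, C). P (card A)) ((\<lambda>(A, B, C). (B, A, C)) x)}
      = card {x \<in> free_triples p. (\<lambda>(A, B, C). P (card A)) x}"
    by (rule card_by_involution) (auto intro: free_triples_swap)
  moreover have "{x \<in> free_triples p. (\<lambda>(A, B, C). P (card A)) ((\<lambda>(A, B, C). (B, A, C)) x)} = second_set P p"
    by (auto simp: second_set_def)
  moreover have "{x \<in> free_triples p. (\<lambda>(A, B, C). P (card A)) x} = first_set P p"
    by (auto simp: first_set_def)
  ultimately show ?thesis by simp
qed

lemma card_third_set:
  assumes "p > 0"
  shows "card (third_set P p) = card (first_set P p)"
proof -
  have "card {x \<in> free_triples p. (\<lambda>(A, B, C). P (card A)) ((\<lambda>(A, B, C). (neg p C, B, neg p A)) x)}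
      = card {x \<in> free_triples p. (\<lambda>(A, B, C). P (card A)) x}"
  proof (rule card_by_involution)
    fix x assume "x \<in> free_triples p"
    moreover obtain A B C where "x = (A, B, C)" by (cases x)
    ultimately show "(\<lambda>(A, B, C). (neg p C, B, neg p A)) x \<in> free_triples p"
      "(\<lambda>(A, B, C). (neg p C, B, neg p A)) ((\<lambda>(A, B, C). (neg p C, B, neg p A)) x) = x"
      using free_triples_rotate[OF assms, of A B C] by (auto simp: in_free_triples neg_neg)
  qed
  moreover have "{x \<in> free_triples p. (\<lambda>(A, B, C). P (card A)) ((\<lambda>(A, B, C). (neg p C, B, neg p A)) x)} = third_set P p"
  proof -
    have "P (card (neg p C)) \<longleftrightarrow> P (card C)" if "(A, B, C) \<in> free_triples p" for A B C
      using that assms by (simp add: in_free_triples card_neg)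
    thus ?thesis unfolding third_set_def by fast
  qed
  moreover have "{x \<in> free_triples p. (\<lambda>(A, B, C). P (card A)) x} = first_set P p"
    by (auto simp: first_set_def)
  ultimately show ?thesis by simp
qed

lemma card_first_set:
  "card (first_set P p) = (\<Sum>A | A \<subseteq> Zn p \<and> P (card A). card (free_pairs p A))"
  unfolding first_set_def by (rule card_free_triples_sum)

lemma finite_sets [simp]:
  "finite (first_set P p)" "finite (second_set P p)" "finite (third_set P p)"
  unfolding first_set_def second_set_def third_set_def
  by (rule finite_subset[OF _ finite_free_triples[of p]]; auto)+

section \<open>Coefficients and total counts by the size of A\<close>

lemma three_times_choose_3: "p \<ge> 2 \<Longrightarrow> 3 * real (p choose 3) = (real p - 2) * real (p choose 2)"
proof -
  assume p: "p \<ge> 2"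
  have "Suc 2 * (p choose Suc 2) = (p - 2) * (p choose 2)"
  proof -
    have "Suc 2 * (p choose Suc 2) = p * ((p - 1) choose 2)"
      using binomial_absorption[of 2 "p"] p by (cases p) (auto simp: binomial_absorption)
    also have "\<dots> = (p - 2) * (p choose 2)"
      by (rule binomial_absorb_comp[symmetric])
    finally show ?thesis .
  qed
  hence "3 * (p choose 3) = (p - 2) * (p choose 2)" by (simp only: eval_nat_numeral)
  hence "real (3 * (p choose 3)) = real ((p - 2) * (p choose 2))" by (rule arg_cong)
  thus ?thesis using p by (simp add: of_nat_diff)
qed

lemma Q31_eq: "p > 2 \<Longrightarrow> Q31 p = 3 * real (p choose 2)"
  using three_times_choose_3[of p] by (simp add: Q31_def field_simps)

text \<open>By \<open>card_AP_sets\<close>, for p >= 5 the difference is the number of three-element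
  sets that are not progressions; the factor 3 stands for the choice of the small set.\<close>

lemma Q32_eq:
  assumes "p > 2"
  shows "Q32 p = 3 * (real (p choose 3) - real (p choose 2))"
proof -
  have "Q32 p = (real p - 5) / (real p - 2) * (3 * real (p choose 3))"
    by (simp add: Q32_def)
  also have "\<dots> = (real p - 5) * real (p choose 2)"
    using three_times_choose_3[of p] assms by simp
  also have "\<dots> = 3 * (real (p choose 3) - real (p choose 2))"
    using three_times_choose_3[of p] assms by (simp add: algebra_simps)
  finally show ?thesis .
qed

definition weight :: "nat \<Rightarrow> nat \<Rightarrow> real" where
  "weight p k = (\<Sum>A | A \<subseteq> Zn p \<and> card A = k. real (card (free_pairs p A)))"

lemma finite_Collect_Zn [simp]: "finite {A. A \<subseteq> Zn p \<and> P A}"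
  by (rule finite_subset[of _ "Pow (Zn p)"]) auto

lemma card_subsets_Zn: "card {A. A \<subseteq> Zn p \<and> card A = k} = p choose k"
  using n_subsets[of "Zn p" k] by simp

lemma weight_0: "p > 0 \<Longrightarrow> weight p 0 = 4 ^ p"
proof -
  assume p: "p > 0"
  have "{A. A \<subseteq> Zn p \<and> card A = 0} = {{}}"
    using finite_subset_Zn by auto
  thus ?thesis using card_free_pairs_empty[OF p] by (simp add: weight_def)
qed

lemma weight_1: "p > 0 \<Longrightarrow> weight p 1 = real p * 3 ^ p"
proof -
  assume p: "p > 0"
  have "weight p 1 = (\<Sum>A | A \<subseteq> Zn p \<and> card A = 1. 3 ^ p)"
    unfolding weight_def using card_free_pairs_singleton[OF p]
    by (intro sum.cong) (auto simp: card_1_singleton_iff)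
  thus ?thesis using card_subsets_Zn[of p 1] by simp
qed

lemma weight_2: "prime p \<Longrightarrow> weight p 2 =
    real (p choose 2) * (((1 + sqrt 5) / 2) ^ (2 * p) + ((1 - sqrt 5) / 2) ^ (2 * p))"
  unfolding weight_def using card_subsets_Zn[of p 2] by (simp add: card_free_pairs_two)

lemma weight_3:
  assumes "prime p" "p > 1000000 * 1000000"
  defines "AP \<equiv> real (p choose 2) * ((1 + sqrt 2) ^ p + (1 - sqrt 2) ^ p + 1)"
    and "D \<equiv> real (p choose 3) - real (p choose 2)"
  shows "weight p 3 \<le> AP + D * (2399 / 1000) ^ p" "AP + D * (2389 / 1000) ^ p \<le> weight p 3"
proof -
  define S where "S = {A. A \<subseteq> Zn p \<and> card A = 3 \<and> is_AP p A}"
  define T where "T = {A. A \<subseteq> Zn p \<and> card A = 3 \<and> \<not> is_AP p A}"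
  have ST: "{A. A \<subseteq> Zn p \<and> card A = 3} = S \<union> T" "S \<inter> T = {}" "finite S" "finite T"
    by (auto simp: S_def T_def)
  have cS: "card S = p choose 2" unfolding S_def using assms by (intro card_AP_sets) auto
  have "card S + card T = p choose 3"
    using card_subsets_Zn[of p 3] ST by (simp add: card_Un_disjoint)
  hence cT: "real (card T) = D" using cS by (simp add: D_def)
  have "weight p 3 = (\<Sum>A\<in>S. real (card (free_pairs p A))) + (\<Sum>A\<in>T. real (card (free_pairs p A)))"
    unfolding weight_def ST(1) using ST by (intro sum.union_disjoint) auto
  also have "(\<Sum>A\<in>S. real (card (free_pairs p A))) = AP"
    using card_free_pairs_AP[OF assms(1)] cS by (simp add: S_def AP_def)
  finally have w: "weight p 3 = AP + (\<Sum>A\<in>T. real (card (free_pairs p A)))" .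
  have "(\<Sum>A\<in>T. real (card (free_pairs p A))) \<le> (\<Sum>A\<in>T. (2399 / 1000) ^ p)"
    using card_free_pairs_non_AP(1)[OF assms(1)] assms(2) by (intro sum_mono) (auto simp: T_def)
  thus "weight p 3 \<le> AP + D * (2399 / 1000) ^ p" by (simp add: w cT)
  have "(\<Sum>A\<in>T. (2389 / 1000) ^ p) \<le> (\<Sum>A\<in>T. real (card (free_pairs p A)))"
    using card_free_pairs_non_AP(2)[OF assms(1)] assms(2) by (intro sum_mono) (auto simp: T_def)
  thus "AP + D * (2389 / 1000) ^ p \<le> weight p 3" by (simp add: w cT)
qed

text \<open>Kahn's bound at size four has the base 31 = 2^5 - 1, which is the origin of the last
  term of the theorem.\<close>

lemma weight_4:
  assumes "p > 0"
  shows "weight p 4 \<le> real (p choose 4) * 31 powr (real p / 4)"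
proof -
  have "weight p 4 \<le> (\<Sum>A | A \<subseteq> Zn p \<and> card A = 4. 31 powr (real p / 4))"
    unfolding weight_def
  proof (rule sum_mono)
    fix A assume "A \<in> {A. A \<subseteq> Zn p \<and> card A = 4}"
    hence A: "A \<subseteq> Zn p" "card A = 4" "A \<noteq> {}" by auto
    show "real (card (free_pairs p A)) \<le> 31 powr (real p / 4)"
      using card_free_pairs_le_Kahn[OF assms A(1,3)] A(2) by simp
  qed
  thus ?thesis using card_subsets_Zn[of p 4] by simp
qed

text \<open>Enlarging A only destroys pairs, so Kahn's bound for any k-element subset
  applies.\<close>

lemma card_free_pairs_le_of_card_ge:
  assumes "p > 0" "A \<subseteq> Zn p" "k \<le> card A" "k > 0"
  shows "real (card (free_pairs p A)) \<le> (2 ^ (k + 1) - 1) powr (real p / real k)"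
proof -
  obtain T where T: "T \<subseteq> A" "card T = k"
    using assms(3) by (meson obtain_subset_with_card_n)
  have "real (card (free_pairs p A)) \<le> real (card (free_pairs p T))"
    using card_free_pairs_antimono[OF T(1)] by simp
  also have "\<dots> \<le> (2 ^ (k + 1) - 1) powr (real p / real k)"
  proof -
    have "T \<subseteq> Zn p" "T \<noteq> {}" using T assms by auto
    thus ?thesis using card_free_pairs_le_Kahn[OF assms(1), of T] unfolding T(2) by blast
  qed
  finally show ?thesis .
qed

lemma sum_weights_le_3:
  "real (card (first_set (\<lambda>k. k \<le> 3) p)) = weight p 0 + weight p 1 + weight p 2 + weight p 3"
proof -
  have "{A. A \<subseteq> Zn p \<and> card A \<le> 3} = (\<Union>k\<in>{0, 1, 2, 3}. {A. A \<subseteq> Zn p \<and> card A = k})"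
    by auto
  hence "real (card (first_set (\<lambda>k. k \<le> 3) p)) = (\<Sum>A\<in>(\<Union>k\<in>{0, 1, 2, 3}. {A. A \<subseteq> Zn p \<and> card A = k}). real (card (free_pairs p A)))"
    by (simp add: card_first_set)
  also have "\<dots> = (\<Sum>k\<in>{0, 1, 2, 3}. weight p k)"
    unfolding weight_def by (rule sum.UNION_disjoint) auto
  finally show ?thesis by simp
qed

text \<open>Together with the next lemma this reduces comparisons with k-th roots to rational
  arithmetic on k-th powers.\<close>

lemma power_le_powr_div:
  fixes x y :: real
  assumes "0 < x" "0 < y" "k > 0" "x ^ k \<le> y"
  shows "x ^ p \<le> y powr (real p / real k)"
proof -
  have "x ^ p = (x ^ k) powr (real p / real k)"
    using assms by (simp add: powr_powr flip: powr_realpow)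
  also have "\<dots> \<le> y powr (real p / real k)"
    using assms by (intro powr_mono2) auto
  finally show ?thesis .
qed

lemma powr_div_le_power:
  fixes x y :: real
  assumes "0 < x" "0 < y" "k > 0" "y \<le> x ^ k"
  shows "y powr (real p / real k) \<le> x ^ p"
proof -
  have "y powr (real p / real k) \<le> (x ^ k) powr (real p / real k)"
    using assms by (intro powr_mono2) auto
  also have "\<dots> = x ^ p"
    using assms by (simp add: powr_powr flip: powr_realpow)
  finally show ?thesis .
qed

lemma eventually_few_bounded_subsets:
  fixes \<gamma> :: real
  assumes "\<gamma> > 1"
  shows "\<forall>\<^sub>F p in sequentially. real (card {A. A \<subseteq> Zn p \<and> card A \<le> m}) \<le> \<gamma> ^ p"
proof -
  obtain \<theta> where \<theta>: "\<theta> > 0"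
    "\<And>p. real (card {F. F \<subseteq> Zn p \<and> real (card F) \<le> \<theta> * real p}) \<le> \<gamma> ^ p"
    using few_small_subsets[OF assms] by blast
  show ?thesis
    using eventually_ge_at_top[of "nat \<lceil>real m / \<theta>\<rceil>"]
  proof eventually_elim
    case (elim p)
    hence "real m / \<theta> \<le> real p" by linarith
    hence m: "real m \<le> \<theta> * real p" using \<theta>(1) by (simp add: field_simps)
    have "card {A. A \<subseteq> Zn p \<and> card A \<le> m} \<le> card {F. F \<subseteq> Zn p \<and> real (card F) \<le> \<theta> * real p}"
    proof (rule card_mono)
      show "{A. A \<subseteq> Zn p \<and> card A \<le> m} \<subseteq> {F. F \<subseteq> Zn p \<and> real (card F) \<le> \<theta> * real p}"
        using m by force
    qed simp
    thus ?case using \<theta>(2)[of p] by linarith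
  qed
qed

text \<open>Two ranges are necessary. Sets of size up to p / 100 number about 1.07^p in the estimate
  used here, too many for the rate 2.291 of size five; from size 20 on Kahn's rate is 2.071 and can
  afford them. There are only polynomially many sets of size at most 20.\<close>

lemma middle_weight:
  "\<forall>\<^sub>F p in sequentially.
     (\<Sum>A | A \<subseteq> Zn p \<and> 5 \<le> card A \<and> real (card A) \<le> real p / 100. real (card (free_pairs p A)))
       \<le> (234 / 100) ^ p + (224 / 100) ^ p"
proof -
  have "\<forall>\<^sub>F p in sequentially. real (card {A. A \<subseteq> Zn p \<and> card A \<le> 20}) \<le> (102 / 100) ^ p"
    by (rule eventually_few_bounded_subsets) simp
  thus ?thesis using eventually_gt_at_top[of 0]
  proof eventually_elim
    case (elim p)
    define I where "I = (\<lambda>A. real (card (free_pairs p A)))"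
    define S1 where "S1 = {A. A \<subseteq> Zn p \<and> 5 \<le> card A \<and> card A \<le> 20}"
    define S2 where "S2 = {A. A \<subseteq> Zn p \<and> 20 \<le> card A \<and> real (card A) \<le> real p / 100}"
    have fin: "finite S1" "finite S2" by (simp_all add: S1_def S2_def)
    have I: "I A \<ge> 0" for A by (simp add: I_def)
    have "(\<Sum>A | A \<subseteq> Zn p \<and> 5 \<le> card A \<and> real (card A) \<le> real p / 100. I A) \<le> (\<Sum>A\<in>S1 \<union> S2. I A)"
      using fin I by (intro sum_mono2) (auto simp: S1_def S2_def)
    also have "\<dots> \<le> (\<Sum>A\<in>S1. I A) + (\<Sum>A\<in>S2. I A)"
    proof -
      have "(\<Sum>A\<in>S1 \<inter> S2. I A) \<ge> 0" using I by (simp add: sum_nonneg)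
      thus ?thesis using sum.union_inter[OF fin, of I] by linarith
    qed
    also have "(\<Sum>A\<in>S1. I A) \<le> (234 / 100) ^ p"
    proof -
      have "(\<Sum>A\<in>S1. I A) \<le> (\<Sum>A\<in>S1. (2291 / 1000) ^ p)"
      proof (rule sum_mono)
        fix A assume "A \<in> S1"
        hence "I A \<le> (2 ^ (5 + 1) - 1) powr (real p / real 5)"
          unfolding I_def using elim by (intro card_free_pairs_le_of_card_ge) (auto simp: S1_def)
        also have "\<dots> \<le> (2291 / 1000) ^ p"
          by (rule powr_div_le_power) (simp_all add: power_divide)
        finally show "I A \<le> (2291 / 1000) ^ p" .
      qed
      also have "\<dots> = real (card S1) * (2291 / 1000) ^ p" by simp
      also have "real (card S1) \<le> real (card {A. A \<subseteq> Zn p \<and> card A \<le> 20})"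
        by (intro of_nat_mono card_mono) (auto simp: S1_def)
      also have "\<dots> \<le> (102 / 100) ^ p" using elim by simp
      also have "(102 / 100) ^ p * (2291 / 1000) ^ p = ((102 / 100) * (2291 / 1000) :: real) ^ p"
        by (rule power_mult_distrib[symmetric])
      also have "\<dots> \<le> (234 / 100) ^ p" by (rule power_mono) simp_all
      finally show ?thesis by simp
    qed
    also have "(\<Sum>A\<in>S2. I A) \<le> (224 / 100) ^ p"
    proof -
      have "(\<Sum>A\<in>S2. I A) \<le> (\<Sum>A\<in>S2. (2071 / 1000) ^ p)"
      proof (rule sum_mono)
        fix A assume "A \<in> S2"
        hence "I A \<le> (2 ^ (20 + 1) - 1) powr (real p / real 20)"
          unfolding I_def using elim by (intro card_free_pairs_le_of_card_ge) (auto simp: S2_def)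
        also have "\<dots> \<le> (2071 / 1000) ^ p"
          by (rule powr_div_le_power) (simp_all add: power_divide)
        finally show "I A \<le> (2071 / 1000) ^ p" .
      qed
      also have "\<dots> = real (card S2) * (2071 / 1000) ^ p" by simp
      also have "real (card S2) \<le> real (card {F. F \<subseteq> Zn p \<and> real (card F) \<le> real p / 100})"
        by (intro of_nat_mono card_mono) (auto simp: S2_def)
      \<comment> \<open>With x = 1/25 the number of sets is at most (25^(1/100) * 1.04)^p, and 25 <=
        1.038^100.\<close>
      also have "\<dots> \<le> (1 / 25) powr (- (real p / 100)) * (1 + 1 / 25) ^ card (Zn p)"
        by (rule card_small_subsets_le) auto
      also have "(1 / 25 :: real) powr (- (real p / 100)) = 25 powr (real p / real 100)"
        by (simp add: powr_divide powr_minus)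
      also have "\<dots> \<le> (1038 / 1000) ^ p"
        by (rule powr_div_le_power) (simp_all add: power_divide)
      also have "(1038 / 1000) ^ p * (1 + 1 / 25) ^ card (Zn p) = ((1038 / 1000) * (1 + 1 / 25) :: real) ^ p"
        by (simp only: power_mult_distrib card_atLeastLessThan_int) simp
      also have "((1038 / 1000) * (1 + 1 / 25)) ^ p * (2071 / 1000) ^ p
          = ((1038 / 1000) * (1 + 1 / 25) * (2071 / 1000) :: real) ^ p"
        by (rule power_mult_distrib[symmetric])
      also have "\<dots> \<le> (224 / 100) ^ p" by (rule power_mono) simp_all
      finally show ?thesis by simp
    qed
    finally show ?case by (simp add: I_def)
  qed
qed

definition main_term :: "nat \<Rightarrow> real" where
  "main_term p = 3 * 4 ^ p + 3 * real p * 3 ^ p + 3 * real (p choose 2) * ((1 + sqrt 5) / 2) ^ (2 * p)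
      + Q31 p * (1 + sqrt 2) ^ p"

text \<open>Besides the main terms the exact counts contain powers of conjugates: that of the golden
  ratio lies in [0, 1] and (1 - sqrt 2)^p + 1 in [0, 2]. For each pair they add between 0 and 3,
  which leaves the lower bound clean.\<close>

lemma three_small_weights:
  assumes "prime p" "p > 1000000 * 1000000"
  shows "3 * real (card (first_set (\<lambda>k. k \<le> 3) p)) \<le> main_term p + Q32 p * (2399 / 1000) ^ p + 9 * real (p choose 2)"
    and "main_term p + Q32 p * (2389 / 1000) ^ p \<le> 3 * real (card (first_set (\<lambda>k. k \<le> 3) p))"
proof -
  have p: "p > 2" "p > 0" using assms(2) by simp_all
  define \<phi> where "\<phi> = ((1 - sqrt 5) / 2) ^ (2 * p)"
  define \<psi> where "\<psi> = (1 - sqrt 2) ^ p"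
  have "\<bar>(1 - sqrt 5) / 2\<bar> \<le> 1" by (simp add: abs_le_iff) (simp add: real_le_lsqrt)
  hence \<phi>: "0 \<le> \<phi>" "\<phi> \<le> 1"
    using power_le_one[of "\<bar>(1 - sqrt 5) / 2\<bar>" "2 * p"]
    by (simp_all add: \<phi>_def power_even_abs zero_le_even_power del: abs_divide)
  have "\<bar>1 - sqrt 2\<bar> \<le> 1" by (simp add: abs_le_iff) (simp add: real_le_lsqrt)
  hence "\<bar>\<psi>\<bar> \<le> 1" unfolding \<psi>_def power_abs by (intro power_le_one) auto
  hence \<psi>: "0 \<le> \<psi> + 1" "\<psi> \<le> 1" by linarith+
  define c where "c = real (p choose 2)"
  have c: "c \<ge> 0" by (simp add: c_def)
  define D where "D = real (p choose 3) - real (p choose 2)"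
  have Q: "Q31 p = 3 * c" "Q32 p = 3 * D" using Q31_eq Q32_eq p by (simp_all add: c_def D_def)
  have sum: "real (card (first_set (\<lambda>k. k \<le> 3) p)) =
      4 ^ p + real p * 3 ^ p + c * (((1 + sqrt 5) / 2) ^ (2 * p) + \<phi>) + weight p 3"
    unfolding sum_weights_le_3 weight_0[OF p(2)] weight_1[OF p(2)] weight_2[OF assms(1)] c_def \<phi>_def ..
  have w3: "weight p 3 \<le> c * ((1 + sqrt 2) ^ p + \<psi> + 1) + D * (2399 / 1000) ^ p"
     "c * ((1 + sqrt 2) ^ p + \<psi> + 1) + D * (2389 / 1000) ^ p \<le> weight p 3"
    using weight_3[OF assms] unfolding c_def \<psi>_def D_def by blast+
  have "c * \<phi> + c * (\<psi> + 1) \<le> 3 * c"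
    using mult_left_mono[OF \<phi>(2) c] mult_left_mono[OF \<psi>(2) c] by (simp add: algebra_simps)
  thus "3 * real (card (first_set (\<lambda>k. k \<le> 3) p)) \<le> main_term p + Q32 p * (2399 / 1000) ^ p + 9 * real (p choose 2)"
    using w3(1) unfolding sum main_term_def Q c_def[symmetric] by (simp add: algebra_simps)
  have "c * \<phi> + c * (\<psi> + 1) \<ge> 0"
    by (rule add_nonneg_nonneg; rule mult_nonneg_nonneg) (fact c \<phi>(1) \<psi>(1))+
  thus "main_term p + Q32 p * (2389 / 1000) ^ p \<le> 3 * real (card (first_set (\<lambda>k. k \<le> 3) p))"
    using w3(2) unfolding sum main_term_def Q c_def[symmetric] by (simp add: algebra_simps)
qed

section \<open>Assembling the bounds\<close>

lemma num_sum_free_triplets_eq: "p > 0 \<Longrightarrow> num_sum_free_triplets p = card (free_triples p)"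
  by (simp add: num_sum_free_triplets_def free_triples_eq)

lemma num_sum_free_triplets_le: "p > 0 \<Longrightarrow> num_sum_free_triplets p \<le> 2 ^ (3 * p)"
proof -
  assume p: "p > 0"
  have "card (free_triples p) \<le> card (Pow (Zn p) \<times> Pow (Zn p) \<times> Pow (Zn p))"
    by (rule card_mono) (auto simp: free_triples_def free_pairs_def)
  also have "\<dots> = 2 ^ (3 * p)"
    by (simp add: card_cartesian_product card_Pow power_mult power3_eq_cube power_mult_distrib[symmetric])
  finally show ?thesis using num_sum_free_triplets_eq[OF p] by simp
qed

lemma first_set_small:
  assumes "p > 400"
  shows "real (card (first_set (\<lambda>k. real k \<le> real p / 100) p)) =
    real (card (first_set (\<lambda>k. k \<le> 3) p)) + weight p 4 +
    (\<Sum>A | A \<subseteq> Zn p \<and> 5 \<le> card A \<and> real (card A) \<le> real p / 100. real (card (free_pairs p A)))"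
proof -
  define S0 where "S0 = {A. A \<subseteq> Zn p \<and> card A \<le> 3}"
  define S4 where "S4 = {A. A \<subseteq> Zn p \<and> card A = 4}"
  define S5 where "S5 = {A. A \<subseteq> Zn p \<and> 5 \<le> card A \<and> real (card A) \<le> real p / 100}"
  have eq: "{A. A \<subseteq> Zn p \<and> real (card A) \<le> real p / 100} = (S0 \<union> S4) \<union> S5"
    using assms by (auto simp: S0_def S4_def S5_def)
  have fin: "finite S0" "finite S4" "finite S5" by (simp_all add: S0_def S4_def S5_def)
  have disj: "S0 \<inter> S4 = {}" "(S0 \<union> S4) \<inter> S5 = {}" by (auto simp: S0_def S4_def S5_def)
  define I where "I = (\<lambda>A. real (card (free_pairs p A)))"
  have "(\<Sum>A\<in>(S0 \<union> S4) \<union> S5. I A) = (\<Sum>A\<in>S0. I A) + (\<Sum>A\<in>S4. I A) + (\<Sum>A\<in>S5. I A)"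
    using fin disj by (simp add: sum.union_disjoint)
  thus ?thesis
    unfolding card_first_set eq weight_def I_def S0_def S4_def S5_def of_nat_sum .
qed

text \<open>Every triplet has a set of size at most p / 100 or is large; the union bound may count
  overlaps several times. Large triplets have rate 2^1.1 < 2.15, and 2.399^7 <= 458 turns the rate
  of the general three-element sets into the stated one.\<close>

lemma upper_bound_eventually:
  "\<forall>\<^sub>F p in sequentially. prime p \<longrightarrow> real (num_sum_free_triplets p) \<le>
     main_term p + Q32 p * 458 powr (real p / 7) + 3 * real (p choose 4) * 31 powr (real p / 4)
     + (9 * real (p choose 2) + 3 * ((234 / 100) ^ p + (224 / 100) ^ p) + (215 / 100) ^ p)"
proof -
  have "\<forall>\<^sub>F p in sequentially. prime p \<longrightarrow> real (card (large_triples p (1 / 100 * real p))) \<le> 2 powr (11 / 10 * real p)"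
    by (rule few_large_triples) simp_all
  thus ?thesis using middle_weight eventually_gt_at_top[of "1000000 * 1000000"]
  proof eventually_elim
    case (elim p)
    show ?case
    proof
      assume prime: "prime p"
      have p: "p > 0" "p > 2" "p > 400" "p > 1000000 * 1000000" using elim(3) by simp_all
      define P where "P = (\<lambda>k :: nat. real k \<le> real p / 100)"
      define L where "L = large_triples p (1 / 100 * real p)"
      have finL: "finite L"
        by (rule finite_subset[of _ "free_triples p"]) (auto simp: L_def large_triples_def)
      have "free_triples p \<subseteq> (first_set P p \<union> second_set P p \<union> third_set P p) \<union> L"
        by (auto simp: L_def large_triples_def first_set_def second_set_def third_set_def P_def)
      hence "card (free_triples p) \<le> card ((first_set P p \<union> second_set P p \<union> third_set P p) \<union> L)"
        using finL by (intro card_mono) auto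
      also have "\<dots> \<le> card (first_set P p) + card (second_set P p) + card (third_set P p) + card L"
        by (intro order_trans[OF card_Un_le] add_mono order_refl)
      finally have "card (free_triples p) \<le> 3 * card (first_set P p) + card L"
        using card_second_set card_third_set[OF p(1)] by simp
      hence "real (num_sum_free_triplets p) \<le> real (3 * card (first_set P p) + card L)"
        unfolding num_sum_free_triplets_eq[OF p(1)] by (rule of_nat_mono)
      also have "\<dots> = 3 * real (card (first_set P p)) + real (card L)" by simp
      also have "real (card L) \<le> (215 / 100) ^ p"
      proof -
        have "real (card L) \<le> 2 powr (11 / 10 * real p)" using elim(1) prime by (simp add: L_def)
        also have "\<dots> = (2 powr 11) powr (real p / real 10)" by (subst powr_powr) simp
        also have "\<dots> \<le> (215 / 100) ^ p"
          by (rule powr_div_le_power) (simp_all add: power_divide)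
        finally show ?thesis .
      qed
      also have "3 * real (card (first_set P p)) \<le>
          (main_term p + Q32 p * (2399 / 1000) ^ p + 9 * real (p choose 2))
          + 3 * (real (p choose 4) * 31 powr (real p / 4)) + 3 * ((234 / 100) ^ p + (224 / 100) ^ p)"
      proof -
        have "3 * (x + y + z) \<le> u + 3 * v + 3 * w" if "3 * x \<le> u" "y \<le> v" "z \<le> w" for x y z u v w :: real
          unfolding distrib_left using that by (intro add_mono) auto
        from this[OF three_small_weights(1)[OF prime p(4)] weight_4[OF p(1)] elim(2)]
        show ?thesis unfolding P_def first_set_small[OF p(3)] .
      qed
      also have "Q32 p * (2399 / 1000) ^ p \<le> Q32 p * 458 powr (real p / 7)"
      proof (rule mult_left_mono)
        have "(2399 / 1000 :: real) ^ p \<le> 458 powr (real p / real 7)"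
          by (rule power_le_powr_div) (simp_all add: power_divide)
        thus "(2399 / 1000 :: real) ^ p \<le> 458 powr (real p / 7)" by simp
        show "Q32 p \<ge> 0" using p(4) by (simp add: Q32_def)
      qed
      finally show "real (num_sum_free_triplets p) \<le>
          main_term p + Q32 p * 458 powr (real p / 7) + 3 * real (p choose 4) * 31 powr (real p / 4)
          + (9 * real (p choose 2) + 3 * ((234 / 100) ^ p + (224 / 100) ^ p) + (215 / 100) ^ p)"
        by (simp add: algebra_simps)
    qed
  qed
qed

text \<open>In an overlap two of the sets have at most three elements and the third is arbitrary, so
  overlaps have rate at most 1.02^2 * 2 < 2.081. They are paid for by lowering 2.389 to
  2.38898.\<close>

lemma lower_bound_eventually:
  "\<forall>\<^sub>F p in sequentially. prime p \<longrightarrow> main_term p + Q32 p * 2.38898 ^ p \<le> real (num_sum_free_triplets p)"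
proof -
  have "\<forall>\<^sub>F p in sequentially. real (card {A. A \<subseteq> Zn p \<and> card A \<le> 3}) \<le> (102 / 100) ^ p"
    by (rule eventually_few_bounded_subsets) simp
  thus ?thesis using eventually_gt_at_top[of "1000000 * 1000000"]
  proof eventually_elim
    case (elim p)
    show ?case
    proof
      assume prime: "prime p"
      have p: "p > 0" "p > 2" "p > 1000000 * 1000000" using elim(2) by simp_all
      define X where "X = first_set (\<lambda>k. k \<le> 3) p"
      define Y where "Y = second_set (\<lambda>k. k \<le> 3) p"
      define Z where "Z = third_set (\<lambda>k. k \<le> 3) p"
      define S where "S = {A. A \<subseteq> Zn p \<and> card A \<le> 3}"
      have fin: "finite X" "finite Y" "finite Z" by (simp_all add: X_def Y_def Z_def)
      have finS: "finite S" by (simp add: S_def)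
      have cards: "card Y = card X" "card Z = card X"
        unfolding X_def Y_def Z_def using card_second_set card_third_set[OF p(1)] by blast+
      have "card (S \<times> S \<times> Pow (Zn p)) = (card S * card S) * 2 ^ p"
        by (simp add: card_cartesian_product card_Pow)
      hence "real (card (S \<times> S \<times> Pow (Zn p))) = (real (card S) * real (card S)) * 2 ^ p" by simp
      also have "\<dots> \<le> ((102 / 100) ^ p * (102 / 100) ^ p) * 2 ^ p"
        using elim(1) unfolding S_def by (intro mult_right_mono mult_mono) auto
      also have "\<dots> = ((102 / 100) * (102 / 100) * 2) ^ p"
        by (simp only: power_mult_distrib)
      also have "\<dots> \<le> (2081 / 1000) ^ p" by (rule power_mono) simp_all
      finally have SS: "real (card (S \<times> S \<times> Pow (Zn p))) \<le> (2081 / 1000) ^ p" .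
      have overlap: "real (card W) \<le> (2081 / 1000) ^ p"
        if "inj_on g W" "g ` W \<subseteq> S \<times> S \<times> Pow (Zn p)" for W and g :: "int set \<times> int set \<times> int set \<Rightarrow> int set \<times> int set \<times> int set"
      proof -
        have "card W \<le> card (S \<times> S \<times> Pow (Zn p))"
          using that finS by (intro card_inj_on_le[of g]) auto
        thus ?thesis using SS by linarith
      qed
      have XY: "real (card (X \<inter> Y)) \<le> (2081 / 1000) ^ p"
        by (rule overlap[of "\<lambda>x. x"])
           (auto simp: X_def Y_def S_def first_set_def second_set_def in_free_triples)
      have XYZ: "real (card ((X \<union> Y) \<inter> Z)) \<le> 2 * (2081 / 1000) ^ p"
      proof -
        have "real (card (X \<inter> Z)) \<le> (2081 / 1000) ^ p"
          by (rule overlap[of "\<lambda>(A, B, C). (A, C, B)"])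
             (auto simp: X_def Z_def S_def first_set_def third_set_def in_free_triples inj_on_def)
        moreover have "real (card (Y \<inter> Z)) \<le> (2081 / 1000) ^ p"
          by (rule overlap[of "\<lambda>(A, B, C). (B, C, A)"])
             (auto simp: Y_def Z_def S_def second_set_def third_set_def in_free_triples inj_on_def)
        moreover have "card ((X \<union> Y) \<inter> Z) \<le> card (X \<inter> Z) + card (Y \<inter> Z)"
          unfolding Int_Un_distrib2 by (rule card_Un_le)
        ultimately show ?thesis by linarith
      qed
      have "card (X \<union> Y \<union> Z) \<le> card (free_triples p)"
        by (rule card_mono) (auto simp: X_def Y_def Z_def first_set_def second_set_def third_set_def)
      moreover have "card (X \<union> Y) + card (X \<inter> Y) = card X + card Y"
        using card_Un_Int[OF fin(1,2)] by simp
      moreover have "card (X \<union> Y \<union> Z) + card ((X \<union> Y) \<inter> Z) = card (X \<union> Y) + card Z"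
        using card_Un_Int[of "X \<union> Y" Z] fin by simp
      ultimately have N: "3 * real (card X) \<le> real (card (free_triples p)) + 3 * (2081 / 1000) ^ p"
        using XY XYZ cards by linarith
      have Q: "Q32 p \<ge> 3"
      proof -
        have "Q32 p = (real p - 5) * real (p choose 2)"
          using Q32_eq[OF p(2)] three_times_choose_3[of p] p(2) by (simp add: algebra_simps)
        moreover have "1 \<le> p choose 2" using p(2) by (simp add: Suc_leI zero_less_binomial)
        ultimately show ?thesis
          using p(3) mult_mono[of 3 "real p - 5" 1 "real (p choose 2)"] by simp
      qed
      \<comment> \<open>The quotient of 2.389 and 2.38898 exceeds 1 + 1/200000, and p > 10^12 makes
        its p-th power at least 2.\<close>
      have "2 * 2.38898 ^ p \<le> (1 + real p * (1 / 200000)) * (2.38898 :: real) ^ p"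
        using p(3) by (intro mult_right_mono) auto
      also have "\<dots> \<le> (1 + 1 / 200000) ^ p * 2.38898 ^ p"
        by (intro mult_right_mono Bernoulli_inequality) auto
      also have "\<dots> = ((1 + 1 / 200000) * 2.38898) ^ p"
        by (rule power_mult_distrib[symmetric])
      also have "\<dots> \<le> (2389 / 1000) ^ p"
        by (rule power_mono) simp_all
      finally have "2.38898 ^ p \<le> (2389 / 1000 :: real) ^ p - 2.38898 ^ p" by simp
      moreover have "(2081 / 1000 :: real) ^ p \<le> 2.38898 ^ p"
        by (rule power_mono) simp_all
      ultimately have gap: "(2081 / 1000 :: real) ^ p \<le> (2389 / 1000) ^ p - 2.38898 ^ p"
        by (rule order_trans[rotated])
      have "3 * (2081 / 1000 :: real) ^ p \<le> Q32 p * ((2389 / 1000) ^ p - 2.38898 ^ p)"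
        using Q gap by (intro mult_mono) auto
      moreover have "main_term p + Q32 p * (2389 / 1000) ^ p \<le> 3 * real (card X)"
        unfolding X_def by (rule three_small_weights(2)[OF prime p(3)])
      ultimately show "main_term p + Q32 p * 2.38898 ^ p \<le> real (num_sum_free_triplets p)"
        using N unfolding num_sum_free_triplets_eq[OF p(1)] by (simp add: algebra_simps)
    qed
  qed
qed

section \<open>Small primes and the o(1) term\<close>

lemma upper_bound_small_primes:
  assumes "p = 2 \<or> p = 3"
  shows "real (num_sum_free_triplets p) \<le> main_term p + Q32 p * 458 powr (real p / 7)"
proof -
  have N: "real (num_sum_free_triplets p) \<le> 2 ^ (3 * p)"
    using num_sum_free_triplets_le[of p] assms by (metis of_nat_le_iff of_nat_numeral of_nat_power pos2 zero_less_numeral)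
  show ?thesis
    using assms
  proof
    assume [simp]: "p = 2"
    \<comment> \<open>The first two terms give 48 + 54, against 2^6 triplets of subsets in
      all.\<close>
    have "main_term p \<ge> 64" by (simp add: main_term_def Q31_def)
    thus ?thesis using N by (simp add: Q32_def)
  next
    assume [simp]: "p = 3"
    have s5: "sqrt 5 \<ge> 2" by (rule real_le_rsqrt) simp
    have s2: "sqrt 2 \<ge> 7 / 5" by (rule real_le_rsqrt) (simp add: power_divide)
    have "((3 / 2) :: real) ^ 6 \<le> ((1 + sqrt 5) / 2) ^ 6"
      using s5 by (intro power_mono) auto
    moreover have "((12 / 5) :: real) ^ 3 \<le> (1 + sqrt 2) ^ 3"
      using s2 by (intro power_mono) auto
    \<comment> \<open>Here \<open>Q32 3\<close> is -6, so this term has to be bounded from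
      above.\<close>
    moreover have "458 powr (3 / 7 :: real) \<le> 458 powr (1 / 2)" by simp
    moreover have "458 powr (1 / 2 :: real) \<le> 22"
      by (simp add: powr_half_sqrt real_le_lsqrt)
    ultimately have "3 * 4 ^ 3 + 3 * 3 * 3 ^ 3 + 9 * (3 / 2) ^ 6 + 9 * (12 / 5) ^ 3 - 6 * 22
        \<le> 3 * 4 ^ 3 + 3 * 3 * 3 ^ 3 + 9 * ((1 + sqrt 5) / 2) ^ 6 + 9 * (1 + sqrt 2) ^ 3 - 6 * (458 powr (3 / 7) :: real)"
      by linarith
    also have "\<dots> = main_term p + Q32 p * 458 powr (real p / 7)"
    proof -
      have "(3 :: nat) choose 2 = 3" by (simp add: choose_two)
      thus ?thesis by (simp add: main_term_def Q31_def Q32_def)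
    qed
    finally have "512 \<le> main_term p + Q32 p * 458 powr (real p / 7)"
      by (simp add: power_divide)
    thus ?thesis using N by simp
  qed
qed

text \<open>The normalised excess over the bound with \<epsilon> = 0, so that the upper bound holds
  by construction and only the limit needs proof. For p < 5 the binomial coefficient vanishes and no
  choice of \<epsilon> could help; those primes are compared with the trivial bound instead.\<close>

definition error_term :: "nat \<Rightarrow> real" where
  "error_term p = (if prime p \<and> p \<ge> 5 then
     max 0 ((real (num_sum_free_triplets p) - (main_term p + Q32 p * 458 powr (real p / 7)
              + 3 * real (p choose 4) * 31 powr (real p / 4)))
            / (3 * real (p choose 4) * 31 powr (real p / 4)))
   else 0)"

text \<open>All remaining errors together are eventually below 2.35^p, whereas the last term is at
  least 2.359^p, because 2.359^4 <= 31.\<close>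

lemma error_term_tendsto_0: "error_term \<longlonglongrightarrow> 0"
proof (rule tendsto_sandwich[of "\<lambda>_. 0"])
  show "\<forall>\<^sub>F p in sequentially. 0 \<le> error_term p"
    by (simp add: error_term_def)
  have "\<forall>\<^sub>F p in sequentially. 9 * (real p * real p) + 3 * ((234 / 100 :: real) ^ p + (224 / 100) ^ p) + (215 / 100) ^ p \<le> (235 / 100) ^ p"
    by real_asymp
  thus "\<forall>\<^sub>F p in sequentially. error_term p \<le> (235 / 100) ^ p / (2359 / 1000) ^ p"
    using upper_bound_eventually eventually_ge_at_top[of 5]
  proof eventually_elim
    case (elim p)
    show ?case
    proof (cases "prime p")
      case True
      define W where "W = 3 * real (p choose 4) * 31 powr (real p / 4)"
      define E where "E = real (num_sum_free_triplets p) - (main_term p + Q32 p * 458 powr (real p / 7) + W)"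
      have "p choose 2 \<le> p * p"
        using binomial_le_pow2[of p 2] by (simp add: choose_two) (meson div_le_dividend diff_le_self le_trans mult_le_mono2)
      hence "real (p choose 2) \<le> real p * real p" by (metis of_nat_le_iff of_nat_mult)
      hence E: "E \<le> (235 / 100) ^ p"
        using elim(1,2) True by (simp add: E_def W_def)
      have "(2359 / 1000 :: real) ^ p \<le> 31 powr (real p / real 4)"
        by (rule power_le_powr_div) (simp_all add: power_divide)
      moreover have "1 \<le> real (p choose 4)"
        using elim(3) zero_less_binomial[of 4 p] by linarith
      ultimately have "1 * (2359 / 1000) ^ p \<le> 3 * real (p choose 4) * 31 powr (real p / 4)"
        by (intro mult_mono) auto
      hence W: "(2359 / 1000) ^ p \<le> W" by (simp add: W_def)
      have "max 0 (E / W) \<le> (235 / 100) ^ p / (2359 / 1000) ^ p"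
      proof (rule max.boundedI)
        have Wpos: "W > 0" using W by (rule less_le_trans[rotated]) simp
        have "E / W \<le> (235 / 100) ^ p / W" using E Wpos by (simp add: divide_right_mono)
        also have "\<dots> \<le> (235 / 100) ^ p / (2359 / 1000) ^ p" using W Wpos by (intro divide_left_mono mult_pos_pos) auto
        finally show "E / W \<le> (235 / 100) ^ p / (2359 / 1000) ^ p" .
      qed simp
      thus ?thesis using True elim(3) by (simp add: error_term_def E_def W_def)
    qed (simp add: error_term_def)
  qed
  show "(\<lambda>p. (235 / 100) ^ p / (2359 / 1000 :: real) ^ p) \<longlonglongrightarrow> 0"
    by real_asymp
qed simp

lemma upper_bound:
  assumes "prime p"
  shows "real (num_sum_free_triplets p) \<le> main_term p + Q32 p * 458 powr (real p / 7)
     + 3 * real (p choose 4) * (1 + error_term p) * 31 powr (real p / 4)"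
proof (cases "p \<ge> 5")
  case False
  have "p \<noteq> 4" using assms primes_dvd_imp_eq[of 2 4] by auto
  hence "p = 2 \<or> p = 3" using False prime_ge_2_nat[OF assms] by linarith
  thus ?thesis using upper_bound_small_primes[of p] by (auto simp: numeral_eq_Suc)
next
  case True
  define W where "W = 3 * real (p choose 4) * 31 powr (real p / 4)"
  have W: "W > 0" using True zero_less_binomial[of 4 p] by (simp add: W_def)
  have "(real (num_sum_free_triplets p) - (main_term p + Q32 p * 458 powr (real p / 7) + W)) / W \<le> error_term p"
    using assms True by (simp add: error_term_def W_def)
  hence "real (num_sum_free_triplets p) - (main_term p + Q32 p * 458 powr (real p / 7) + W) \<le> error_term p * W"
    using W by (simp only: pos_divide_le_eq)
  thus ?thesis by (simp add: W_def algebra_simps)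
qed

text \<open>The lower inequality is asserted for large p: at p = 2 its first two terms give 102, but
  there are only 64 triplets of subsets.\<close>

theorem theorem1p1:
  shows "(\<exists>\<epsilon> :: nat \<Rightarrow> real. \<epsilon> \<longlonglongrightarrow> 0 \<and>
            (\<forall>p. prime p \<longrightarrow>
               real (num_sum_free_triplets p) \<le>
                 3 * 4 ^ p + 3 * real p * 3 ^ p
                 + 3 * real (p choose 2) * ((1 + sqrt 5) / 2) ^ (2 * p)
                 + Q31 p * (1 + sqrt 2) ^ p
                 + Q32 p * 458 powr (real p / 7)
                 + 3 * real (p choose 4) * (1 + \<epsilon> p) * 31 powr (real p / 4)))
       \<and> (\<forall>\<^sub>F p in sequentially. prime p \<longrightarrow>
            3 * 4 ^ p + 3 * real p * 3 ^ p
            + 3 * real (p choose 2) * ((1 + sqrt 5) / 2) ^ (2 * p)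
            + Q31 p * (1 + sqrt 2) ^ p
            + Q32 p * 2.38898 ^ p
            \<le> real (num_sum_free_triplets p))
       \<and> (\<forall>p. prime p \<and> p > 2 \<longrightarrow> Q31 p = 3 * real (p choose 2))"
  using error_term_tendsto_0 upper_bound lower_bound_eventually Q31_eq
  unfolding main_term_def by blast

end
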